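(* Let $Y$ be an affine algebraic variety defined over $\mathbb{R}$ and let $f\in\mathbb{R}[Y]$. Assume that $Y_{\mathrm{reg}}$ contains a flexible connected component $Y^1$ of dimension at least $2$ such that $\mathrm{SAut}(Y)$ acts infinitely transitively on $Y^1$ and $f|_{Y^1}$ is non-constant. Let $X^1$ be a connected component of the smooth locus of the suspension $\mathrm{Susp}(Y^1,f)\subseteq X=\mathrm{Susp}(Y,f)$. Then $X^1$ is flexible and $\mathrm{SAut}(X)$ acts infinitely transitively on $X^1$.
   Context: Varieties are affine algebraic varieties over $\mathbb{R}$, considered through their real points; $\mathbb{R}[Y]$ is the algebra of regular (polynomial) functions, $Y_{\mathrm{reg}}$ is the set of smooth points of $Y$, and connected components are taken in the Euclidean topology. Suspension: for a non-constant $f\in\mathbb{R}[Y]$, the suspension $\mathrm{Susp}(Y,f)$ is the hypersurface $X=\{(y,u,v): uv-f(y)=0\}\subseteq Y\times\mathbb{A}^2$. For a connected component $Y^1$ of $Y_{\mathrm{reg}}$, $\mathrm{Susp}(Y^1,f)=\{(y,u,v)\in X: y\in Y^1\}$, and its smooth locus is $\mathrm{Susp}(Y^1,f)\cap X_{\mathrm{reg}}$. Special automorphism group: $\mathrm{SAut}(X)$ is the subgroup of $\mathrm{Aut}(X)$ (algebraic automorphisms over $\mathbb{R}$) generated by all one-parameter subgroups isomorphic to the additive group $(\mathbb{R},+)$ (acting algebraically, i.e. of the form $t\mapsto\exp(t\partial)$ for a locally nilpotent derivation $\partial$ of $\mathbb{R}[X]$). Flexibility: a point $y\in Y$ is flexible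 if $T_yY$ is spanned by the tangent vectors at $y$ to the orbits $H\cdot y$ of one-parameter subgroups $H\subseteq\mathrm{SAut}(Y)$, $H\cong(\mathbb{R},+)$. A connected component of $Y_{\mathrm{reg}}$ (respectively $X_{\mathrm{reg}}$) is flexible if each of its points is a flexible point of $Y$ (respectively $X$). Infinite transitivity: a group $G$ acts infinitely transitively on a set $Z$ if for every positive integer $m$ it is transitive on ordered $m$-tuples of pairwise distinct points of $Z$; here each element of $\mathrm{SAut}$ maps every connected component of the smooth locus to itself. *)

theory Defs
  imports "HOL-Analysis.Analysis" "HOL-Algebra.Generated_Groups"
begin

text \<open>
  A real affine variety is the real zero locus of finitely many polynomials in a Euclidean space;
  it is not assumed to be irreducible. Its ideal is the ideal of all polynomials vanishing on the
  real points. Polynomials are represented by polynomial functions on the ambient space.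
\<close>

definition affine_variety :: "'a::euclidean_space set \<Rightarrow> bool" where
  "affine_variety Y \<longleftrightarrow>
     (\<exists>S. finite S \<and> (\<forall>p\<in>S. real_polynomial_function p) \<and> Y = {x. \<forall>p\<in>S. p x = 0})"

definition vanishing_ideal :: "'a::euclidean_space set \<Rightarrow> ('a \<Rightarrow> real) set" where
  "vanishing_ideal Y = {p. real_polynomial_function p \<and> (\<forall>y\<in>Y. p y = 0)}"

text \<open>
  A regular function on \<open>Y\<close> is the restriction of a polynomial to \<open>Y\<close>. It is
  represented by its extension by \<open>0\<close> outside \<open>Y\<close>, so that functions that
  agree on \<open>Y\<close> are equal and the ring operations are the pointwise ones.
\<close>

definition coordinate_ring :: "'a::euclidean_space set \<Rightarrow> ('a \<Rightarrow> real) set" where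
  "coordinate_ring Y = {\<lambda>x. if x \<in> Y then p x else 0 | p. real_polynomial_function p}"

definition tangent_space :: "'a::euclidean_space set \<Rightarrow> 'a \<Rightarrow> 'a set" where
  "tangent_space Y y = {v. \<forall>p\<in>vanishing_ideal Y. frechet_derivative p (at y) v = 0}"

text \<open>
  Smoothness is the Jacobian condition: in the local ring of the ambient space at \<open>y\<close>, the
  ideal of \<open>Y\<close> is generated by finitely many elements whose differentials at \<open>y\<close>
  are linearly independent. The function \<open>h\<close> is the denominator allowed by localization.
\<close>

definition smooth_point :: "'a::euclidean_space set \<Rightarrow> 'a \<Rightarrow> bool" where
  "smooth_point Y y \<longleftrightarrow> y \<in> Y \<and>
     (\<exists>B. finite B \<and> B \<subseteq> vanishing_ideal Y \<and>
        (\<forall>c. (\<forall>v. (\<Sum>p\<in>B. c p * frechet_derivative p (at y) v) = 0) \<longrightarrow> (\<forall>p\<in>B. c p = 0)) \<and>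
        (\<forall>q\<in>vanishing_ideal Y. \<exists>h a. real_polynomial_function h \<and> h y \<noteq> 0 \<and>
           (\<forall>p\<in>B. real_polynomial_function (a p)) \<and>
           (\<forall>x. h x * q x = (\<Sum>p\<in>B. a p x * p x))))"

definition smooth_locus :: "'a::euclidean_space set \<Rightarrow> 'a set" where
  "smooth_locus Y = {y. smooth_point Y y}"

text \<open>
  Automorphisms are extended by the identity outside \<open>Y\<close>, so that each of them is
  represented by exactly one map and the group operation is composition.
\<close>

definition variety_aut :: "'a::euclidean_space set \<Rightarrow> ('a \<Rightarrow> 'a) set" where
  "variety_aut Y = {g. (\<forall>x. x \<notin> Y \<longrightarrow> g x = x) \<and>
     (\<exists>p q. polynomial_function p \<and> polynomial_function q \<and>
        (\<forall>y\<in>Y. g y = p y \<and> p y \<in> Y \<and> q y \<in> Y \<and> q (p y) = y \<and> p (q y) = y))}"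

definition aut_group :: "'a::euclidean_space set \<Rightarrow> ('a \<Rightarrow> 'a) monoid" where
  "aut_group Y = \<lparr>carrier = variety_aut Y, monoid.mult = (\<circ>), one = id\<rparr>"

definition locally_nilpotent_derivation ::
    "'a::euclidean_space set \<Rightarrow> (('a \<Rightarrow> real) \<Rightarrow> ('a \<Rightarrow> real)) \<Rightarrow> bool" where
  "locally_nilpotent_derivation Y D \<longleftrightarrow>
     (\<forall>a\<in>coordinate_ring Y. D a \<in> coordinate_ring Y) \<and>
     (\<forall>a\<in>coordinate_ring Y. \<forall>b\<in>coordinate_ring Y. D (\<lambda>x. a x + b x) = (\<lambda>x. D a x + D b x)) \<and>
     (\<forall>r. \<forall>a\<in>coordinate_ring Y. D (\<lambda>x. r * a x) = (\<lambda>x. r * D a x)) \<and>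
     (\<forall>a\<in>coordinate_ring Y. \<forall>b\<in>coordinate_ring Y.
        D (\<lambda>x. a x * b x) = (\<lambda>x. D a x * b x + a x * D b x)) \<and>
     (\<forall>a\<in>coordinate_ring Y. \<exists>n. (D ^^ n) a = (\<lambda>x. 0))"

text \<open>
  The automorphism \<open>\<phi> t\<close> is \<open>exp (t D)\<close> in the sense that pulling back regular
  functions along it is the algebra automorphism \<open>exp (t D)\<close>; the series is a finite sum
  because \<open>D\<close> is locally nilpotent. The case \<open>D = 0\<close> gives the trivial group, which
  changes neither the generated group nor the span of the tangent vectors.
\<close>

definition one_parameter_subgroup ::
    "'a::euclidean_space set \<Rightarrow> (real \<Rightarrow> 'a \<Rightarrow> 'a) \<Rightarrow> bool" where
  "one_parameter_subgroup Y \<phi> \<longleftrightarrow>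
     (\<exists>D. locally_nilpotent_derivation Y D \<and>
        (\<forall>t. \<phi> t \<in> variety_aut Y \<and>
           (\<forall>a\<in>coordinate_ring Y. \<forall>y\<in>Y. a (\<phi> t y) = (\<Sum>k. t ^ k / fact k * (D ^^ k) a y))))"

definition SAut :: "'a::euclidean_space set \<Rightarrow> ('a \<Rightarrow> 'a) set" where
  "SAut Y = generate (aut_group Y) {\<phi> t | \<phi> t. one_parameter_subgroup Y \<phi>}"

definition flexible_point :: "'a::euclidean_space set \<Rightarrow> 'a \<Rightarrow> bool" where
  "flexible_point Y y \<longleftrightarrow> y \<in> Y \<and>
     span {v. \<exists>\<phi>. one_parameter_subgroup Y \<phi> \<and> ((\<lambda>t. \<phi> t y) has_vector_derivative v) (at 0)}
       = tangent_space Y y"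

definition flexible_on :: "'a::euclidean_space set \<Rightarrow> 'a set \<Rightarrow> bool" where
  "flexible_on Y Z \<longleftrightarrow> (\<forall>z\<in>Z. flexible_point Y z)"

definition infinitely_transitive_on :: "('a \<Rightarrow> 'a) set \<Rightarrow> 'a set \<Rightarrow> bool" where
  "infinitely_transitive_on G Z \<longleftrightarrow>
     (\<forall>g\<in>G. g ` Z = Z) \<and>
     (\<forall>m\<ge>1. \<forall>xs ys. length xs = m \<and> length ys = m \<and> distinct xs \<and> distinct ys \<and>
        set xs \<subseteq> Z \<and> set ys \<subseteq> Z \<longrightarrow> (\<exists>g\<in>G. map g xs = ys))"

text \<open>For \<open>A \<subseteq> Y\<close>, this is the part of the suspension of \<open>Y\<close> lying over \<open>A\<close>.\<close>

definition Susp :: "'a::euclidean_space set \<Rightarrow> ('a \<Rightarrow> real) \<Rightarrow> ('a \<times> real \<times> real) set" where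
  "Susp A f = {(y, u, v). y \<in> A \<and> u * v - f y = 0}"

end

theory Submission
  imports Defs
begin

text \<open>
  An additive one-parameter group of automorphisms is the same as a flow that is polynomial in time
  and space. A flow \<open>\<phi>\<close> on \<open>Y\<close> lifts to \<open>X = Susp Y f\<close>: run \<open>\<phi>\<close> on the level \<open>u = c\<close> for time \<open>t c q(c)\<close>,
  keep \<open>u\<close> and let \<open>v\<close> follow from \<open>uv = f\<close>. Choosing the polynomial \<open>q\<close> by interpolation, \<open>SAut Y\<close> acts
  independently on finitely many levels \<open>u = c \<noteq> 0\<close>, and by symmetry on levels of \<open>v\<close>. A tuple in \<open>X1\<close> is
  first moved to \<open>u \<noteq> 0\<close>; alternating moves along levels of \<open>u\<close> and \<open>v\<close> then rescale each \<open>u\<close>-coordinate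
  arbitrarily up to sign (and change its sign if \<open>f\<close> changes sign on \<open>Y1\<close>), and a last move along the levels
  of \<open>u\<close> adjusts the \<open>y\<close>-coordinates. If \<open>f\<close> does not change sign, the sign of \<open>u\<close> is constant on \<open>X1\<close>, because
  \<open>(y, 0, 0)\<close> is singular where the differential of \<open>f\<close> vanishes. Flexibility is checked directly at one point
  and spread by transitivity. The flows preserve \<open>X1\<close>, since automorphisms preserve smoothness and a smooth
  point of \<open>X\<close> lies over a smooth point of \<open>Y\<close>.
\<close>

subsection \<open>Polynomial functions\<close>

text \<open>The obstacle is the crossing points \<open>(y, 0, 0)\<close>. Fixing a nonzero
  \<open>u\<close> or \<open>v\<close> gives a section of the projection to \<open>Y\<close>, but at
  a crossing point both vanish, and where the differential of \<open>f\<close> is zero on the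
  tangent space every lifted flow fixes such a point. So smoothness of \<open>X\<close> must be
  compared with \<open>Y\<close> and with the differential of \<open>f\<close> exactly where no such
  section passes. A condition on chosen generators does not carry over well along sections and
  limits, hence the detour through an intrinsic criterion on differentials. For transitivity, what
  is known about the values of \<open>f\<close> is that the image of \<open>Y1\<close> is connected
  and has more than one point. Inside it small relative changes of a nonzero value are possible, and
  repeating them yields every positive factor. As it is infinite, auxiliary values can be chosen so
  that different points of a tuple never collide on a level.\<close>

lemma real_polynomial_function_comp:
  assumes "real_polynomial_function p" "polynomial_function s"
  shows "real_polynomial_function (\<lambda>x. p (s x))"
  using polynomial_function_compose[of s p] assms by (simp add: real_polynomial_function_eq o_def)

lemma polynomial_function_comp:
  assumes "polynomial_function p" "polynomial_function s"
  shows "polynomial_function (\<lambda>x. p (s x))"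
  using polynomial_function_compose[of s p] assms by (simp add: o_def)

lemma polynomial_function_Pair:
  assumes "polynomial_function p" "polynomial_function q"
  shows "polynomial_function (\<lambda>x. (p x, q x))"
proof -
  have "polynomial_function (\<lambda>x. (p x, 0) + (0, q x))"
  proof (rule polynomial_function_add)
    show "polynomial_function (\<lambda>x. (p x, 0))"
      using polynomial_function_comp[OF polynomial_function_bounded_linear assms(1), of "\<lambda>z. (z, 0)"]
      by (simp add: bounded_linear_Pair bounded_linear_zero bounded_linear_ident)
    show "polynomial_function (\<lambda>x. (0, q x))"
      using polynomial_function_comp[OF polynomial_function_bounded_linear assms(2), of "\<lambda>z. (0, z)"]
      by (simp add: bounded_linear_Pair bounded_linear_zero bounded_linear_ident)
  qed
  then show ?thesis by simp
qed

lemma polynomial_function_fst: "polynomial_function p \<Longrightarrow> polynomial_function (\<lambda>x. fst (p x))"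
  by (rule polynomial_function_comp[OF polynomial_function_bounded_linear[OF bounded_linear_fst]])

lemma polynomial_function_snd: "polynomial_function p \<Longrightarrow> polynomial_function (\<lambda>x. snd (p x))"
  by (rule polynomial_function_comp[OF polynomial_function_bounded_linear[OF bounded_linear_snd]])

lemma polynomial_function_times:
  fixes p q :: "'a::real_normed_vector \<Rightarrow> real"
  assumes "polynomial_function p" "polynomial_function q"
  shows "polynomial_function (\<lambda>x. p x * q x)"
  using assms by (auto simp: real_polynomial_function_eq[symmetric])

lemmas polynomial_intros =
  polynomial_function_Pair polynomial_function_fst polynomial_function_snd
  polynomial_function_times polynomial_function_const polynomial_function_id
  polynomial_function_add polynomial_function_diff polynomial_function_minus

declare real_polynomial_function.intros(2) [simp]

lemma real_polynomial_function_has_derivative: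
  "real_polynomial_function p \<Longrightarrow> (p has_derivative frechet_derivative p (at x)) (at x)"
  using differentiable_at_real_polynomial_function frechet_derivative_works by blast

lemma polynomial_function_has_derivative:
  fixes p :: "'a::euclidean_space \<Rightarrow> 'b::euclidean_space"
  shows "polynomial_function p \<Longrightarrow> (p has_derivative frechet_derivative p (at x)) (at x)"
  using differentiable_at_polynomial_function frechet_derivative_works by blast

lemma polynomial_function_continuous:
  fixes p :: "'a::euclidean_space \<Rightarrow> 'b::euclidean_space"
  shows "polynomial_function p \<Longrightarrow> continuous_on S p"
  using differentiable_on_polynomial_function differentiable_imp_continuous_on by blast

lemma frechet_derivative_comp:
  fixes s :: "'a::euclidean_space \<Rightarrow> 'b::euclidean_space"
  assumes "real_polynomial_function p" "polynomial_function s"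
  shows "frechet_derivative (\<lambda>x. p (s x)) (at x) v =
    frechet_derivative p (at (s x)) (frechet_derivative s (at x) v)"
proof -
  have "((\<lambda>x. p (s x)) has_derivative (\<lambda>v. frechet_derivative p (at (s x)) (frechet_derivative s (at x) v))) (at x)"
    by (rule has_derivative_compose[OF polynomial_function_has_derivative[OF assms(2)]
      real_polynomial_function_has_derivative[OF assms(1)]])
  from frechet_derivative_at[OF this] show ?thesis by metis
qed

text \<open>The degree bound is stated as vanishing of \<open>c k\<close> beyond \<open>n\<close>,
  so that expansions of different length can be padded for addition and convolved for
  multiplication. The first coordinate later plays the time of a flow, the coordinate
  \<open>u\<close>, or an independent variable standing for the inverse of \<open>u\<close>.\<close>

lemma real_polynomial_function_coeffs:
  fixes p :: "real \<times> 'a::real_normed_vector \<Rightarrow> real"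
  assumes "real_polynomial_function p"
  obtains c n where "\<And>k. real_polynomial_function (c k)" "\<And>k. k > n \<Longrightarrow> c k = (\<lambda>x. 0)"
    "\<And>t x. p (t, x) = (\<Sum>k\<le>n. c k x * t ^ k)"
proof -
  have "\<exists>c n. (\<forall>k. real_polynomial_function (c k)) \<and> (\<forall>k>n. c k = (\<lambda>x. 0)) \<and>
      (\<forall>t x. p (t, x) = (\<Sum>k\<le>n. c k x * t ^ k))"
    using assms
  proof (induction p rule: real_polynomial_function.induct)
    case (linear p)
    interpret p: bounded_linear p by fact
    have eq: "p (t, x) = p (0, x) + p (1, 0) * t" for t x
    proof -
      have "(t, x) = (0, x) + t *\<^sub>R (1, 0)" by simp
      then show ?thesis by (metis p.add p.scale mult.commute real_scaleR_def)
    qed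
    let ?c = "\<lambda>k. if k = 0 then (\<lambda>x. p (0, x)) else if k = Suc 0 then (\<lambda>x. p (1, 0)) else (\<lambda>x. 0)"
    have "real_polynomial_function (\<lambda>x. p (0, x))"
      by (rule real_polynomial_function.intros(1))
        (intro bounded_linear_compose[OF linear.hyps] bounded_linear_Pair bounded_linear_zero bounded_linear_ident)
    then have "\<forall>k. real_polynomial_function (?c k)" by simp
    moreover have "\<forall>k>Suc 0. ?c k = (\<lambda>x. 0)" by simp
    moreover have "\<forall>t x. p (t, x) = (\<Sum>k\<le>Suc 0. ?c k x * t ^ k)"
      by (intro allI, subst eq) simp
    ultimately show ?case by (intro exI[of _ ?c] exI[of _ "Suc 0"] conjI)
  next
    case (const a)
    show ?case by (rule exI[of _ "\<lambda>k. if k = 0 then (\<lambda>x. a) else (\<lambda>x. 0)"], rule exI[of _ 0]) simp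
  next
    case (add p q)
    then obtain c n d m where c: "\<forall>k. real_polynomial_function (c k)" "\<forall>k>n. c k = (\<lambda>x. 0)"
        "\<forall>t x. p (t, x) = (\<Sum>k\<le>n. c k x * t ^ k)"
      and d: "\<forall>k. real_polynomial_function (d k)" "\<forall>k>m. d k = (\<lambda>x. 0)"
        "\<forall>t x. q (t, x) = (\<Sum>k\<le>m. d k x * t ^ k)" by blast
    have 1: "p (t, x) = (\<Sum>k\<le>max n m. c k x * t ^ k)" for t x
      unfolding c(3)[rule_format] by (rule sum.mono_neutral_left) (use c(2) in auto)
    have 2: "q (t, x) = (\<Sum>k\<le>max n m. d k x * t ^ k)" for t x
      unfolding d(3)[rule_format] by (rule sum.mono_neutral_left) (use d(2) in auto)
    show ?case
      using c d by (intro exI[of _ "\<lambda>k x. c k x + d k x"] exI[of _ "max n m"])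
        (auto simp: 1 2 sum.distrib algebra_simps)
  next
    case (mult p q)
    then obtain c n d m where c: "\<forall>k. real_polynomial_function (c k)" "\<forall>k>n. c k = (\<lambda>x. 0)"
        "\<forall>t x. p (t, x) = (\<Sum>k\<le>n. c k x * t ^ k)"
      and d: "\<forall>k. real_polynomial_function (d k)" "\<forall>k>m. d k = (\<lambda>x. 0)"
        "\<forall>t x. q (t, x) = (\<Sum>k\<le>m. d k x * t ^ k)" by blast
    have "p (t, x) * q (t, x) = (\<Sum>r\<le>n + m. (\<Sum>k\<le>r. c k x * d (r - k) x) * t ^ r)" for t x
      unfolding c(3)[rule_format] d(3)[rule_format]
      by (rule polynomial_product) (use c(2) d(2) in auto)
    moreover have "(\<Sum>k\<le>r. c k x * d (r - k) x) = 0" if "r > n + m" for r x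
    proof (rule sum.neutral, safe)
      fix k assume "k \<le> r"
      show "c k x * d (r - k) x = 0"
      proof (cases "k > n")
        case False
        then have "r - k > m" using that by auto
        then show ?thesis using d(2) by simp
      qed (use c(2) in simp)
    qed
    moreover have "real_polynomial_function (\<lambda>x. \<Sum>k\<le>r. c k x * d (r - k) x)" for r
      by (intro real_polynomial_function_sum real_polynomial_function.intros(4) finite_atMost
        c(1)[rule_format] d(1)[rule_format])
    ultimately show ?case
      by (intro exI[of _ "\<lambda>r x. (\<Sum>k\<le>r. c k x * d (r - k) x)"] exI[of _ "n + m"]) auto
  qed
  then show ?thesis using that by blast
qed

text \<open>Hadamard's lemma with polynomial divided differences. For a product, the difference
  telescopes through \<open>p z * q w\<close>, which is why the coefficients combine
  \<open>p (fst x)\<close> with \<open>q (snd x)\<close>.\<close>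

lemma real_polynomial_function_difference:
  fixes s :: "'a::euclidean_space \<Rightarrow> real"
  assumes "real_polynomial_function s"
  obtains c where "\<And>i. real_polynomial_function (c i)"
    "\<And>i x. i \<in> Basis \<Longrightarrow> c i (x, x) = frechet_derivative s (at x) i"
    "\<And>z w. s z - s w = (\<Sum>i\<in>Basis. c i (z, w) * ((z - w) \<bullet> i))"
proof -
  have "\<exists>c. (\<forall>i. real_polynomial_function (c i)) \<and>
      (\<forall>i\<in>Basis. \<forall>x. c i (x, x) = frechet_derivative s (at x) i) \<and>
      (\<forall>z w. s z - s w = (\<Sum>i\<in>Basis. c i (z, w) * ((z - w) \<bullet> i)))"
    using assms
  proof (induction s rule: real_polynomial_function.induct)
    case (linear s)
    have "s z - s w = (\<Sum>i\<in>Basis. s i * ((z - w) \<bullet> i))" for z w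
    proof -
      interpret bounded_linear s by fact
      have "s z - s w = s (\<Sum>i\<in>Basis. ((z - w) \<bullet> i) *\<^sub>R i)"
        by (simp add: euclidean_representation diff)
      also have "\<dots> = (\<Sum>i\<in>Basis. s i * ((z - w) \<bullet> i))"
        by (simp add: sum scale mult.commute)
      finally show ?thesis .
    qed
    moreover have "frechet_derivative s (at x) = s" for x
      using frechet_derivative_at[OF bounded_linear_imp_has_derivative[OF linear]] by metis
    ultimately show ?case by (intro exI[of _ "\<lambda>i _. s i"]) auto
  next
    case (const a)
    show ?case by (rule exI[of _ "\<lambda>i _. 0"]) auto
  next
    case (add p q)
    then obtain c d where c: "\<forall>i. real_polynomial_function (c i)"
        "\<forall>i\<in>Basis. \<forall>x. c i (x, x) = frechet_derivative p (at x) i"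
        "\<forall>z w. p z - p w = (\<Sum>i\<in>Basis. c i (z, w) * ((z - w) \<bullet> i))"
      and d: "\<forall>i. real_polynomial_function (d i)"
        "\<forall>i\<in>Basis. \<forall>x. d i (x, x) = frechet_derivative q (at x) i"
        "\<forall>z w. q z - q w = (\<Sum>i\<in>Basis. d i (z, w) * ((z - w) \<bullet> i))" by blast
    have "frechet_derivative (\<lambda>x. p x + q x) (at x) i =
        frechet_derivative p (at x) i + frechet_derivative q (at x) i" for x i
      using frechet_derivative_at[OF has_derivative_add[OF
        real_polynomial_function_has_derivative[OF add.hyps(1)]
        real_polynomial_function_has_derivative[OF add.hyps(2)]]] by metis
    moreover have "(p z + q z) - (p w + q w) = (\<Sum>i\<in>Basis. (c i (z, w) + d i (z, w)) * ((z - w) \<bullet> i))" for z w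
      using c(3)[rule_format, of z w] d(3)[rule_format, of z w]
      by (simp add: sum.distrib distrib_right)
    ultimately show ?case
      using c(1,2) d(1,2) by (intro exI[of _ "\<lambda>i x. c i x + d i x"]) auto
  next
    case (mult p q)
    then obtain c d where c: "\<forall>i. real_polynomial_function (c i)"
        "\<forall>i\<in>Basis. \<forall>x. c i (x, x) = frechet_derivative p (at x) i"
        "\<forall>z w. p z - p w = (\<Sum>i\<in>Basis. c i (z, w) * ((z - w) \<bullet> i))"
      and d: "\<forall>i. real_polynomial_function (d i)"
        "\<forall>i\<in>Basis. \<forall>x. d i (x, x) = frechet_derivative q (at x) i"
        "\<forall>z w. q z - q w = (\<Sum>i\<in>Basis. d i (z, w) * ((z - w) \<bullet> i))" by blast
    have "frechet_derivative (\<lambda>x. p x * q x) (at x) i =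
        p x * frechet_derivative q (at x) i + frechet_derivative p (at x) i * q x" for x i
      using frechet_derivative_at[OF has_derivative_mult[OF
        real_polynomial_function_has_derivative[OF mult.hyps(1)]
        real_polynomial_function_has_derivative[OF mult.hyps(2)]]] by metis
    moreover have "p z * q z - p w * q w =
        (\<Sum>i\<in>Basis. (p z * d i (z, w) + c i (z, w) * q w) * ((z - w) \<bullet> i))" for z w
    proof -
      have "p z * q z - p w * q w = p z * (q z - q w) + (p z - p w) * q w"
        by (simp add: algebra_simps)
      also have "\<dots> = (\<Sum>i\<in>Basis. (p z * d i (z, w) + c i (z, w) * q w) * ((z - w) \<bullet> i))"
        unfolding c(3)[rule_format] d(3)[rule_format]
        by (simp add: sum_distrib_left sum_distrib_right sum.distrib[symmetric] algebra_simps)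
      finally show ?thesis .
    qed
    moreover have "real_polynomial_function (\<lambda>x. p (fst x) * d i x + c i x * q (snd x))" for i
      by (intro real_polynomial_function.intros(3,4) real_polynomial_function_comp[OF mult.hyps(1)]
        real_polynomial_function_comp[OF mult.hyps(2)] polynomial_intros c(1)[rule_format] d(1)[rule_format])
    ultimately show ?case
      using c(2) d(2) by (intro exI[of _ "\<lambda>i x. p (fst x) * d i x + c i x * q (snd x)"]) auto
  qed
  then obtain c where "\<forall>i. real_polynomial_function (c i)"
    "\<forall>i\<in>Basis. \<forall>x. c i (x, x) = frechet_derivative s (at x) i"
    "\<forall>z w. s z - s w = (\<Sum>i\<in>Basis. c i (z, w) * ((z - w) \<bullet> i))" by blast
  then show ?thesis by (intro that[of c]) auto
qed

text \<open>With \<open>w\<close> in \<open>v = w * f y\<close> treated as an independent variable,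
  \<open>p\<close> becomes a polynomial in \<open>w\<close> of some degree at most \<open>n\<close>.
  Setting \<open>w = 1 / t\<close> and multiplying by \<open>t ^ n\<close> leaves only nonnegative
  powers of \<open>t\<close>.\<close>

lemma real_polynomial_function_clear_denominator:
  fixes p :: "'a::real_normed_vector \<times> real \<times> real \<Rightarrow> real"
  assumes "real_polynomial_function p" "real_polynomial_function f"
  obtains q n where "real_polynomial_function q"
    "\<And>t y. t \<noteq> 0 \<Longrightarrow> t ^ n * p (y, t, f y / t) = q (t, y)"
proof -
  let ?r = "\<lambda>(w, t, y). p (y, t, w * f y)"
  have eq: "?r = (\<lambda>z. p (snd (snd z), fst (snd z), fst z * f (snd (snd z))))" by auto
  have "polynomial_function (\<lambda>z. f (snd (snd z)))"
    by (rule polynomial_function_comp[OF assms(2)[unfolded real_polynomial_function_eq]])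
      (intro polynomial_intros)
  then have "real_polynomial_function ?r"
    unfolding eq by (intro real_polynomial_function_comp[OF assms(1)] polynomial_intros)
  then obtain c :: "nat \<Rightarrow> real \<times> 'a \<Rightarrow> real" and n
    where c: "\<And>k. real_polynomial_function (c k)" "\<And>k. k > n \<Longrightarrow> c k = (\<lambda>x. 0)"
    and eq: "\<And>w ty. ?r (w, ty) = (\<Sum>k\<le>n. c k ty * w ^ k)" by (rule real_polynomial_function_coeffs) (rule that)
  show ?thesis
  proof
    show "real_polynomial_function (\<lambda>z. \<Sum>k\<le>n. c k z * fst z ^ (n - k))"
      by (intro real_polynomial_function_sum real_polynomial_function.intros(4) c(1) finite_atMost
        real_polynomial_function_power real_polynomial_function.intros(1) bounded_linear_fst)
    fix t y assume t: "(t::real) \<noteq> 0"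
    have "t ^ n * p (y, t, f y / t) = t ^ n * (\<Sum>k\<le>n. c k (t, y) * (1 / t) ^ k)"
      using eq[of "1 / t" "(t, y)"] by simp
    also have "\<dots> = (\<Sum>k\<le>n. c k (t, y) * fst (t, y) ^ (n - k))"
      unfolding sum_distrib_left using t
      by (intro sum.cong) (auto simp: power_diff field_simps)
    finally show "t ^ n * p (y, t, f y / t) = (\<Sum>k\<le>n. c k (t, y) * fst (t, y) ^ (n - k))" .
  qed
qed

subsection \<open>Smooth points and the local ring\<close>

text \<open>
  The contraction to functions of the ideal generated by \<open>S\<close> in the local ring of the ambient space
  at \<open>y\<close>: \<open>cancel\<close> inverts the polynomials that do not vanish at \<open>y\<close>.
\<close>

inductive_set local_ideal :: "'a::euclidean_space \<Rightarrow> ('a \<Rightarrow> real) set \<Rightarrow> ('a \<Rightarrow> real) set"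
  for y S where
  zero: "(\<lambda>x. 0) \<in> local_ideal y S"
| add_mult: "\<lbrakk>real_polynomial_function a; s \<in> S; F \<in> local_ideal y S\<rbrakk>
    \<Longrightarrow> (\<lambda>x. a x * s x + F x) \<in> local_ideal y S"
| cancel: "\<lbrakk>real_polynomial_function h; h y \<noteq> 0; (\<lambda>x. h x * F x) \<in> local_ideal y S\<rbrakk>
    \<Longrightarrow> F \<in> local_ideal y S"

lemma local_ideal_mult:
  assumes "F \<in> local_ideal y S" "real_polynomial_function g"
  shows "(\<lambda>x. g x * F x) \<in> local_ideal y S"
  using assms(1)
proof induction
  case zero
  then show ?case using local_ideal.zero[of y S] by simp
next
  case (add_mult a s F)
  have "(\<lambda>x. (g x * a x) * s x + g x * F x) \<in> local_ideal y S"
    using add_mult assms(2) by (intro local_ideal.add_mult real_polynomial_function.intros(4))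
  then show ?case by (simp add: algebra_simps)
next
  case (cancel h F)
  show ?case by (rule local_ideal.cancel[of h]) (use cancel in \<open>simp_all add: algebra_simps\<close>)
qed

lemma local_ideal_add:
  assumes "F \<in> local_ideal y S" "G \<in> local_ideal y S"
  shows "(\<lambda>x. F x + G x) \<in> local_ideal y S"
  using assms
proof (induction arbitrary: G)
  case zero
  then show ?case by simp
next
  case (add_mult a s F)
  have "(\<lambda>x. a x * s x + (F x + G x)) \<in> local_ideal y S"
    using add_mult by (intro local_ideal.add_mult)
  then show ?case by (simp add: algebra_simps)
next
  case (cancel h F)
  have *: "(\<lambda>x. h x * F x + h x * G x) \<in> local_ideal y S"
    using cancel local_ideal_mult by blast
  show ?case by (rule local_ideal.cancel[of h]) (use cancel * in \<open>simp_all add: algebra_simps\<close>)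
qed

lemma local_ideal_base:
  assumes "s \<in> S"
  shows "s \<in> local_ideal y S"
  using local_ideal.add_mult[OF _ assms local_ideal.zero, of "\<lambda>x. 1" y] by simp

lemma local_ideal_sum:
  assumes "finite K" "\<And>k. k \<in> K \<Longrightarrow> F k \<in> local_ideal y S"
  shows "(\<lambda>x. \<Sum>k\<in>K. F k x) \<in> local_ideal y S"
  using assms by (induction K rule: finite_induct) (auto intro: local_ideal.zero local_ideal_add)

lemma local_ideal_subset:
  assumes "S \<subseteq> local_ideal y T"
  shows "local_ideal y S \<subseteq> local_ideal y T"
proof
  fix F assume "F \<in> local_ideal y S"
  then show "F \<in> local_ideal y T"
  proof induction
    case (add_mult a s F)
    then show ?case using assms local_ideal_mult local_ideal_add by blast
  qed (auto intro: local_ideal.zero local_ideal.cancel)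
qed

lemma local_ideal_compose:
  assumes "F \<in> local_ideal (r y) S" "polynomial_function r"
  shows "(\<lambda>x. F (r x)) \<in> local_ideal y ((\<lambda>s x. s (r x)) ` S)"
  using assms(1)
proof induction
  case zero
  then show ?case by (rule local_ideal.zero)
next
  case (add_mult a s F)
  then show ?case
    by (intro local_ideal.add_mult real_polynomial_function_comp[OF _ assms(2)] imageI)
next
  case (cancel h F)
  show ?case
    using cancel local_ideal.cancel[of "\<lambda>x. h (r x)" y "\<lambda>x. F (r x)"] real_polynomial_function_comp[OF _ assms(2)] by simp
qed

text \<open>Denominators introduced anywhere in an inductive derivation can be multiplied into a
  single \<open>h\<close>. This links \<open>local_ideal\<close> with the form used in
  \<open>smooth_point\<close>.\<close>

lemma local_ideal_finite_iff:
  assumes "finite B"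
  shows "q \<in> local_ideal y B \<longleftrightarrow> (\<exists>h a. real_polynomial_function h \<and> h y \<noteq> 0 \<and>
    (\<forall>p\<in>B. real_polynomial_function (a p)) \<and> (\<forall>x. h x * q x = (\<Sum>p\<in>B. a p x * p x)))"
    (is "_ \<longleftrightarrow> ?R q")
proof
  assume "q \<in> local_ideal y B"
  then show "?R q"
  proof induction
    case zero
    show ?case by (rule exI[of _ "\<lambda>x. 1"], rule exI[of _ "\<lambda>p x. 0"]) simp
  next
    case (add_mult b s F)
    then obtain h a where ha: "real_polynomial_function h" "h y \<noteq> 0"
      "\<forall>p\<in>B. real_polynomial_function (a p)" "\<forall>x. h x * F x = (\<Sum>p\<in>B. a p x * p x)" by blast
    let ?a = "\<lambda>p x. h x * (if p = s then b x else 0) + a p x"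
    have "real_polynomial_function (\<lambda>x. if p = s then b x else 0)" for p
      using add_mult.hyps(1) by (cases "p = s") simp_all
    then have "\<forall>p\<in>B. real_polynomial_function (?a p)"
      using ha(1,3) by (intro ballI real_polynomial_function.intros(3,4)) auto
    moreover have "h x * (b x * s x + F x) = (\<Sum>p\<in>B. ?a p x * p x)" for x
    proof -
      have "(\<Sum>p\<in>B. ?a p x * p x) = (\<Sum>p\<in>B. if p = s then h x * b x * s x else 0) + (\<Sum>p\<in>B. a p x * p x)"
        unfolding sum.distrib[symmetric] by (intro sum.cong) (auto simp: algebra_simps)
      also have "\<dots> = h x * b x * s x + h x * F x"
        using assms add_mult.hyps(2) ha(4) by simp
      finally show ?thesis by (simp add: algebra_simps)
    qed
    ultimately show ?case using ha(1,2) by (intro exI[of _ h] exI[of _ ?a]) blast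
  next
    case (cancel g F)
    then obtain h a where ha: "real_polynomial_function h" "h y \<noteq> 0"
      "\<forall>p\<in>B. real_polynomial_function (a p)" "\<forall>x. h x * (g x * F x) = (\<Sum>p\<in>B. a p x * p x)" by blast
    then show ?case using cancel.hyps
      by (intro exI[of _ "\<lambda>x. h x * g x"] exI[of _ a])
        (simp add: mult.assoc real_polynomial_function.intros(4))
  qed
next
  assume "?R q"
  then obtain h a where ha: "real_polynomial_function h" "h y \<noteq> 0"
      "\<forall>p\<in>B. real_polynomial_function (a p)" "\<forall>x. h x * q x = (\<Sum>p\<in>B. a p x * p x)" by blast
  have *: "(\<lambda>x. \<Sum>p\<in>B. a p x * p x) \<in> local_ideal y B"
    using assms ha(3) by (intro local_ideal_sum local_ideal_mult local_ideal_base) auto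
  show "q \<in> local_ideal y B"
    by (rule local_ideal.cancel[of h]) (use ha * in simp_all)
qed

lemma smooth_point_alt:
  "smooth_point Y y \<longleftrightarrow> y \<in> Y \<and>
     (\<exists>B. finite B \<and> B \<subseteq> vanishing_ideal Y \<and>
        (\<forall>c. (\<forall>v. (\<Sum>p\<in>B. c p * frechet_derivative p (at y) v) = 0) \<longrightarrow> (\<forall>p\<in>B. c p = 0)) \<and>
        vanishing_ideal Y \<subseteq> local_ideal y B)"
proof -
  have eq: "(\<forall>q\<in>vanishing_ideal Y. \<exists>h a. real_polynomial_function h \<and> h y \<noteq> 0 \<and>
      (\<forall>p\<in>B. real_polynomial_function (a p)) \<and> (\<forall>x. h x * q x = (\<Sum>p\<in>B. a p x * p x)))
    \<longleftrightarrow> vanishing_ideal Y \<subseteq> local_ideal y B" if "finite B" for B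
    using local_ideal_finite_iff[OF that] by (simp add: subset_iff Ball_def)
  show ?thesis
    unfolding smooth_point_def by (simp only: eq cong: conj_cong)
qed

lemma vanishing_ideal_poly: "p \<in> vanishing_ideal Y \<Longrightarrow> real_polynomial_function p"
  by (simp add: vanishing_ideal_def)

lemma vanishing_ideal_zero: "p \<in> vanishing_ideal Y \<Longrightarrow> y \<in> Y \<Longrightarrow> p y = 0"
  by (simp add: vanishing_ideal_def)

lemma vanishing_ideal_compose:
  assumes "p \<in> vanishing_ideal X" "polynomial_function r" "r ` Y \<subseteq> X"
  shows "(\<lambda>x. p (r x)) \<in> vanishing_ideal Y"
  using assms by (auto simp: vanishing_ideal_def intro: real_polynomial_function_comp)

text \<open>Only the products themselves are collected; the ideal that they generate is
  \<open>local_ideal y (max_ideal_mult Y y)\<close>.\<close>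

definition max_ideal_mult :: "'a::euclidean_space set \<Rightarrow> 'a \<Rightarrow> ('a \<Rightarrow> real) set" where
  "max_ideal_mult Y y =
     {\<lambda>x. m x * r x | m r. real_polynomial_function m \<and> m y = 0 \<and> r \<in> vanishing_ideal Y}"

lemma max_ideal_multI:
  "\<lbrakk>real_polynomial_function m; m y = 0; r \<in> vanishing_ideal Y\<rbrakk>
    \<Longrightarrow> (\<lambda>x. m x * r x) \<in> max_ideal_mult Y y"
  unfolding max_ideal_mult_def by blast

text \<open>
  For the maximal ideal \<open>\<mm>\<close> at \<open>y\<close>, this says \<open>I(Y) \<inter> \<mm>\<^sup>2 = \<mm> I(Y)\<close> in the local ring.
  Given finite generation, Nakayama's lemma makes it equivalent to smoothness, and unlike
  the original definition it does not refer to a choice of generators.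
\<close>

definition conormal_injective :: "'a::euclidean_space set \<Rightarrow> 'a \<Rightarrow> bool" where
  "conormal_injective Y y \<longleftrightarrow> (\<forall>F\<in>vanishing_ideal Y.
     (\<forall>v. frechet_derivative F (at y) v = 0) \<longrightarrow> F \<in> local_ideal y (max_ideal_mult Y y))"

text \<open>At a common zero of the \<open>p\<close>, the product rule loses the derivatives of the
  coefficients, so only the values \<open>a p y\<close> matter.\<close>

lemma frechet_derivative_sum_mult:
  assumes "finite B" "\<And>p. p \<in> B \<Longrightarrow> real_polynomial_function p \<and> p y = 0"
    and "\<And>p. p \<in> B \<Longrightarrow> real_polynomial_function (a p)"
  shows "frechet_derivative (\<lambda>x. \<Sum>p\<in>B. a p x * p x) (at y) v =
    (\<Sum>p\<in>B. a p y * frechet_derivative p (at y) v)"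
proof -
  have "((\<lambda>x. \<Sum>p\<in>B. a p x * p x) has_derivative
      (\<lambda>v. \<Sum>p\<in>B. a p y * frechet_derivative p (at y) v + frechet_derivative (a p) (at y) v * p y)) (at y)"
    by (intro has_derivative_sum has_derivative_mult real_polynomial_function_has_derivative)
      (use assms in auto)
  moreover have "(\<lambda>v. \<Sum>p\<in>B. a p y * frechet_derivative p (at y) v + frechet_derivative (a p) (at y) v * p y) =
      (\<lambda>v. \<Sum>p\<in>B. a p y * frechet_derivative p (at y) v)"
    using assms(2) by (intro ext sum.cong) auto
  ultimately have D: "((\<lambda>x. \<Sum>p\<in>B. a p x * p x) has_derivative
      (\<lambda>v. \<Sum>p\<in>B. a p y * frechet_derivative p (at y) v)) (at y)" by simp
  show ?thesis by (simp add: frechet_derivative_at[OF D, symmetric])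
qed

lemma frechet_derivative_mult_zero:
  assumes "real_polynomial_function h" "real_polynomial_function F" "F y = 0"
  shows "frechet_derivative (\<lambda>x. h x * F x) (at y) v = h y * frechet_derivative F (at y) v"
  using frechet_derivative_sum_mult[of "{F}" y "\<lambda>_. h" v] assms by simp

text \<open>Differentiating a relation \<open>h F = \<Sum> a p * p\<close> at \<open>y\<close> gives
  a linear dependence of the differentials with coefficients \<open>a p y\<close>. Independence
  forces these to vanish, so each \<open>a p\<close> lies in the maximal ideal.\<close>

lemma smooth_imp_conormal_injective:
  assumes "smooth_point Y y"
  shows "conormal_injective Y y"
  unfolding conormal_injective_def
proof (intro ballI impI)
  fix F assume F: "F \<in> vanishing_ideal Y" and dF: "\<forall>v. frechet_derivative F (at y) v = 0"
  obtain B where B: "finite B" "B \<subseteq> vanishing_ideal Y" "y \<in> Y"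
    "\<And>c. (\<forall>v. (\<Sum>p\<in>B. c p * frechet_derivative p (at y) v) = 0) \<Longrightarrow> (\<forall>p\<in>B. c p = 0)"
    "vanishing_ideal Y \<subseteq> local_ideal y B"
    using assms unfolding smooth_point_alt by metis
  have "F \<in> local_ideal y B" using B(5) F by blast
  then obtain h a where ha: "real_polynomial_function h" "h y \<noteq> 0"
      "\<forall>p\<in>B. real_polynomial_function (a p)" "\<forall>x. h x * F x = (\<Sum>p\<in>B. a p x * p x)"
    unfolding local_ideal_finite_iff[OF B(1)] by blast
  have "(\<Sum>p\<in>B. a p y * frechet_derivative p (at y) v) = 0" for v
  proof -
    have "(\<Sum>p\<in>B. a p y * frechet_derivative p (at y) v) = frechet_derivative (\<lambda>x. h x * F x) (at y) v"
      unfolding ha(4)[rule_format] using B ha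
      by (intro frechet_derivative_sum_mult[symmetric])
        (auto intro: vanishing_ideal_poly vanishing_ideal_zero)
    also have "\<dots> = 0"
      using frechet_derivative_mult_zero[OF ha(1) vanishing_ideal_poly[OF F] vanishing_ideal_zero[OF F B(3)]] dF
      by simp
    finally show ?thesis .
  qed
  then have "\<forall>p\<in>B. a p y = 0" using B(4)[of "\<lambda>p. a p y"] by blast
  then have *: "(\<lambda>x. \<Sum>p\<in>B. a p x * p x) \<in> local_ideal y (max_ideal_mult Y y)"
    using B(1,2) ha(3) by (intro local_ideal_sum local_ideal_base max_ideal_multI) auto
  show "F \<in> local_ideal y (max_ideal_mult Y y)"
    by (rule local_ideal.cancel[of h]) (use ha * in simp_all)
qed

text \<open>The factor that vanishes at \<open>y\<close> is absorbed into the coefficients of the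
  other factor with respect to \<open>G\<close>. This is the form in which Nakayama's argument
  compares coefficients.\<close>

lemma local_ideal_max_ideal_mult:
  assumes "finite G" "vanishing_ideal Y \<subseteq> local_ideal y G"
    and "F \<in> local_ideal y (max_ideal_mult Y y)"
  obtains h a where "real_polynomial_function h" "h y \<noteq> 0"
    "\<forall>p\<in>G. real_polynomial_function (a p) \<and> a p y = 0" "\<forall>x. h x * F x = (\<Sum>p\<in>G. a p x * p x)"
proof -
  have "\<exists>h a. real_polynomial_function h \<and> h y \<noteq> 0 \<and>
    (\<forall>p\<in>G. real_polynomial_function (a p) \<and> a p y = 0) \<and> (\<forall>x. h x * F x = (\<Sum>p\<in>G. a p x * p x))"
    using assms(3)
  proof induction
    case zero
    show ?case by (rule exI[of _ "\<lambda>x. 1"], rule exI[of _ "\<lambda>p x. 0"]) simp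
  next
    case (add_mult b s F)
    then obtain h a where ha: "real_polynomial_function h" "h y \<noteq> 0"
      "\<forall>p\<in>G. real_polynomial_function (a p) \<and> a p y = 0" "\<forall>x. h x * F x = (\<Sum>p\<in>G. a p x * p x)" by blast
    obtain m r where mr: "s = (\<lambda>x. m x * r x)" "real_polynomial_function m" "m y = 0" "r \<in> vanishing_ideal Y"
      using add_mult.hyps(2) by (auto simp: max_ideal_mult_def)
    have "r \<in> local_ideal y G" using assms(2) mr(4) by blast
    then obtain g c where gc: "real_polynomial_function g" "g y \<noteq> 0"
      "\<forall>p\<in>G. real_polynomial_function (c p)" "\<forall>x. g x * r x = (\<Sum>p\<in>G. c p x * p x)"
      unfolding local_ideal_finite_iff[OF assms(1)] by blast
    let ?a = "\<lambda>p x. h x * (b x * (m x * c p x)) + g x * a p x"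
    have "h x * g x * (b x * s x + F x) = (\<Sum>p\<in>G. ?a p x * p x)" for x
    proof -
      have "h x * g x * (b x * s x + F x) = h x * b x * m x * (g x * r x) + g x * (h x * F x)"
        by (simp add: mr(1) algebra_simps)
      also have "\<dots> = (\<Sum>p\<in>G. ?a p x * p x)"
        unfolding gc(4)[rule_format] ha(4)[rule_format]
        by (simp add: sum_distrib_left sum.distrib[symmetric] algebra_simps)
      finally show ?thesis .
    qed
    moreover have "\<forall>p\<in>G. real_polynomial_function (?a p) \<and> ?a p y = 0"
      using ha(1,3) gc(1,3) mr(2,3) add_mult.hyps(1)
      by (auto intro!: real_polynomial_function.intros(3,4))
    moreover have "real_polynomial_function (\<lambda>x. h x * g x)"
      using ha(1) gc(1) by (rule real_polynomial_function.intros(4))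
    ultimately show ?case
      using ha(2) gc(2) by (intro exI[of _ "\<lambda>x. h x * g x"] exI[of _ ?a]) auto
  next
    case (cancel g F)
    then obtain h a where ha: "real_polynomial_function h" "h y \<noteq> 0"
      "\<forall>p\<in>G. real_polynomial_function (a p) \<and> a p y = 0" "\<forall>x. h x * (g x * F x) = (\<Sum>p\<in>G. a p x * p x)" by blast
    then show ?case using cancel.hyps
      by (intro exI[of _ "\<lambda>x. h x * g x"] exI[of _ a])
        (simp add: mult.assoc real_polynomial_function.intros(4))
  qed
  then show ?thesis using that by blast
qed

text \<open>The dependence \<open>c\<close> makes \<open>F = \<Sum> c p * p\<close> have zero
  differential, so \<open>h F\<close> also has an expression whose coefficients \<open>a p\<close>
  vanish at \<open>y\<close>. In the difference of the two expressions, \<open>g\<close> has the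
  coefficient \<open>a g - h * c g\<close>, which is nonzero at \<open>y\<close> and hence a unit of
  the local ring; so \<open>g\<close> is redundant.\<close>

lemma local_ideal_nakayama:
  assumes "finite G" "G \<subseteq> vanishing_ideal Y" "vanishing_ideal Y \<subseteq> local_ideal y G"
    and "conormal_injective Y y" "y \<in> Y"
    and c: "\<forall>v. (\<Sum>p\<in>G. c p * frechet_derivative p (at y) v) = 0" "g \<in> G" "c g \<noteq> 0"
  shows "vanishing_ideal Y \<subseteq> local_ideal y (G - {g})"
proof -
  define F where "F = (\<lambda>x. \<Sum>p\<in>G. c p * p x)"
  have "frechet_derivative F (at y) v = 0" for v
    unfolding F_def using c(1) assms(1,2,5)
    by (subst frechet_derivative_sum_mult[where a = "\<lambda>p x. c p"])
      (auto intro: vanishing_ideal_poly vanishing_ideal_zero)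
  moreover have "F \<in> vanishing_ideal Y"
    using assms(1,2) unfolding F_def vanishing_ideal_def
    by (auto intro!: real_polynomial_function_sum real_polynomial_function.intros(4) sum.neutral)
  ultimately have "F \<in> local_ideal y (max_ideal_mult Y y)"
    using assms(4) by (simp add: conormal_injective_def)
  then obtain h a where
    ha: "real_polynomial_function h" "h y \<noteq> 0"
    "\<forall>p\<in>G. real_polynomial_function (a p) \<and> a p y = 0" "\<forall>x. h x * F x = (\<Sum>p\<in>G. a p x * p x)"
    by (rule local_ideal_max_ideal_mult[OF assms(1,3)]) (rule that)
  let ?k = "\<lambda>p x. a p x - h x * c p"
  have k: "real_polynomial_function (?k p)" if "p \<in> G" for p
    using ha(1,3) that by (intro real_polynomial_function_diff real_polynomial_function.intros(4)) auto
  have zero: "(\<Sum>p\<in>G. ?k p x * p x) = 0" for x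
  proof -
    have "(\<Sum>p\<in>G. ?k p x * p x) = (\<Sum>p\<in>G. a p x * p x) - h x * F x"
      by (simp add: F_def sum_distrib_left sum_subtractf[symmetric] algebra_simps)
    then show ?thesis using ha(4) by simp
  qed
  have eq: "- ?k g x * g x = (\<Sum>p\<in>G - {g}. ?k p x * p x)" for x
    using zero[of x] sum.remove[OF assms(1) c(2), of "\<lambda>p. ?k p x * p x"] by linarith
  have "(\<lambda>x. - ?k g x * g x) \<in> local_ideal y (G - {g})"
    unfolding eq using assms(1) k by (intro local_ideal_sum local_ideal_mult local_ideal_base) auto
  moreover have "- ?k g y \<noteq> 0"
    using ha(2,3) c(2,3) by auto
  moreover have "real_polynomial_function (\<lambda>x. - ?k g x)"
    using k[OF c(2)] by (rule real_polynomial_function_minus)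
  ultimately have "g \<in> local_ideal y (G - {g})"
    using local_ideal.cancel[of "\<lambda>x. - ?k g x"] by blast
  then have "G \<subseteq> local_ideal y (G - {g})"
    using local_ideal_base[of _ "G - {g}" y] by blast
  then show ?thesis
    using local_ideal_subset assms(3) by blast
qed

text \<open>A local generating set of least cardinality has independent differentials, because a
  dependence would let \<open>local_ideal_nakayama\<close> discard a generator.\<close>

lemma smooth_point_iff_conormal_injective:
  "smooth_point Y y \<longleftrightarrow> y \<in> Y \<and> conormal_injective Y y \<and>
    (\<exists>G. finite G \<and> G \<subseteq> vanishing_ideal Y \<and> vanishing_ideal Y \<subseteq> local_ideal y G)"
proof
  assume "smooth_point Y y"
  then show "y \<in> Y \<and> conormal_injective Y y \<and>
    (\<exists>G. finite G \<and> G \<subseteq> vanishing_ideal Y \<and> vanishing_ideal Y \<subseteq> local_ideal y G)"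
    using smooth_imp_conormal_injective unfolding smooth_point_alt by blast
next
  assume asm: "y \<in> Y \<and> conormal_injective Y y \<and>
    (\<exists>G. finite G \<and> G \<subseteq> vanishing_ideal Y \<and> vanishing_ideal Y \<subseteq> local_ideal y G)"
  let ?P = "\<lambda>G. finite G \<and> G \<subseteq> vanishing_ideal Y \<and> vanishing_ideal Y \<subseteq> local_ideal y G"
  obtain G where G: "?P G" and min: "\<And>G'. ?P G' \<Longrightarrow> card G \<le> card G'"
    using asm ex_has_least_nat[of ?P _ card] by metis
  have "\<forall>p\<in>G. c p = 0" if "\<forall>v. (\<Sum>p\<in>G. c p * frechet_derivative p (at y) v) = 0" for c
  proof (rule ccontr)
    assume "\<not> (\<forall>p\<in>G. c p = 0)"
    then obtain g where g: "g \<in> G" "c g \<noteq> 0" by blast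
    have "?P (G - {g})"
      using local_ideal_nakayama[of G Y y c g] G asm that g by auto
    from min[OF this] show False
      using G g(1) by (metis card_Diff1_less not_le)
  qed
  then show "smooth_point Y y"
    using G asm unfolding smooth_point_alt by blast
qed

text \<open>
  The functions \<open>F - F \<circ> r \<circ> s\<close> are generated by the coordinates of \<open>x - r (s x)\<close>, which vanish on \<open>Y\<close>,
  and their coefficients at \<open>y\<close> are the partial derivatives of \<open>F\<close>. So both parts of the
  characterization of smoothness transfer from \<open>F \<circ> r\<close> on \<open>X\<close>.
\<close>

lemma smooth_point_retract:
  fixes s :: "'a::euclidean_space \<Rightarrow> 'b::euclidean_space"
  assumes "polynomial_function s" "polynomial_function r" "s ` Y \<subseteq> X" "r ` X \<subseteq> Y"
    and rs: "\<And>y. y \<in> Y \<Longrightarrow> r (s y) = y" and "y \<in> Y" "smooth_point X (s y)"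
  shows "smooth_point Y y"
proof -
  have rsp: "polynomial_function (\<lambda>x. r (s x))"
    using polynomial_function_comp assms(1,2) by blast
  define e where "e = (\<lambda>i x. (x - r (s x)) \<bullet> i)"
  have e: "e i \<in> vanishing_ideal Y" for i
  proof -
    have "polynomial_function (e i)"
      unfolding e_def
      by (intro polynomial_function_inner polynomial_function_diff polynomial_function_id rsp)
    then show ?thesis
      using rs by (auto simp: vanishing_ideal_def real_polynomial_function_eq e_def)
  qed
  have diff: "\<exists>d. (\<forall>i. real_polynomial_function (d i)) \<and>
      (\<forall>i\<in>Basis. d i y = frechet_derivative F (at y) i) \<and>
      (\<forall>x. F x = F (r (s x)) + (\<Sum>i\<in>Basis. d i x * e i x))"
    if F: "F \<in> vanishing_ideal Y" for F
  proof -
    obtain c where c: "\<And>i. real_polynomial_function (c i)"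
      "\<And>i x. i \<in> Basis \<Longrightarrow> c i (x, x) = frechet_derivative F (at x) i"
      "\<And>z w. F z - F w = (\<Sum>i\<in>Basis. c i (z, w) * ((z - w) \<bullet> i))"
      by (rule real_polynomial_function_difference[OF vanishing_ideal_poly[OF F]]) (rule that)
    have d1: "real_polynomial_function (\<lambda>x. c i (x, r (s x)))" for i
      by (intro real_polynomial_function_comp[OF c(1)] polynomial_function_Pair polynomial_function_id rsp)
    have d2: "c i (y, r (s y)) = frechet_derivative F (at y) i" if "i \<in> Basis" for i
      using c(2)[OF that] rs[OF assms(6)] by simp
    have d3: "F x = F (r (s x)) + (\<Sum>i\<in>Basis. c i (x, r (s x)) * e i x)" for x
      using c(3)[of x "r (s x)"] by (simp add: e_def)
    show ?thesis
      by (rule exI[of _ "\<lambda>i x. c i (x, r (s x))"]) (intro conjI allI ballI d1 d2 d3)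
  qed
  obtain G where G: "finite G" "G \<subseteq> vanishing_ideal X" "vanishing_ideal X \<subseteq> local_ideal (s y) G"
    and X: "conormal_injective X (s y)"
    using assms(7) by (auto simp: smooth_point_iff_conormal_injective)
  let ?G = "(\<lambda>p x. p (s x)) ` G \<union> e ` Basis"
  have "F \<in> local_ideal y ?G" if F: "F \<in> vanishing_ideal Y" for F
  proof -
    obtain d where d: "\<forall>i. real_polynomial_function (d i)"
      "\<forall>x. F x = F (r (s x)) + (\<Sum>i\<in>Basis. d i x * e i x)"
      using diff[OF F] by blast
    have "(\<lambda>x. F (r x)) \<in> local_ideal (s y) G"
      using vanishing_ideal_compose[OF F assms(2,4)] G(3) by blast
    from local_ideal_compose[OF this assms(1)]
    have "(\<lambda>x. F (r (s x))) \<in> local_ideal y ?G"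
      using local_ideal_subset[of "(\<lambda>p x. p (s x)) ` G" y ?G] local_ideal_base[of _ ?G y] by blast
    moreover have "(\<lambda>x. \<Sum>i\<in>Basis. d i x * e i x) \<in> local_ideal y ?G"
      using d(1) by (intro local_ideal_sum local_ideal_mult local_ideal_base) auto
    ultimately have mem: "(\<lambda>x. F (r (s x)) + (\<Sum>i\<in>Basis. d i x * e i x)) \<in> local_ideal y ?G"
      by (rule local_ideal_add)
    have "(\<lambda>x. F (r (s x)) + (\<Sum>i\<in>Basis. d i x * e i x)) = F"
      by (rule ext) (rule d(2)[rule_format, symmetric])
    then show ?thesis by (rule back_subst[of "\<lambda>f. f \<in> local_ideal y ?G", OF mem])
  qed
  moreover have "?G \<subseteq> vanishing_ideal Y"
    using G(2) e vanishing_ideal_compose[OF _ assms(1,3)] by blast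
  moreover have "conormal_injective Y y"
    unfolding conormal_injective_def
  proof (intro ballI impI)
    fix F assume F: "F \<in> vanishing_ideal Y" and dF: "\<forall>v. frechet_derivative F (at y) v = 0"
    obtain d where d: "\<forall>i. real_polynomial_function (d i)"
      "\<forall>i\<in>Basis. d i y = frechet_derivative F (at y) i"
      "\<forall>x. F x = F (r (s x)) + (\<Sum>i\<in>Basis. d i x * e i x)"
      using diff[OF F] by blast
    \<comment> \<open>The chain rule factors this derivative through that of \<open>F\<close> at
      \<open>r (s y) = y\<close>.\<close>
    have "frechet_derivative (\<lambda>x. F (r x)) (at (s y)) v = 0" for v
      using frechet_derivative_comp[OF vanishing_ideal_poly[OF F] assms(2)] dF rs[OF assms(6)] by simp
    then have "(\<lambda>x. F (r x)) \<in> local_ideal (s y) (max_ideal_mult X (s y))"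
      using X vanishing_ideal_compose[OF F assms(2,4)] by (auto simp: conormal_injective_def)
    from local_ideal_compose[OF this assms(1)]
    have "(\<lambda>x. F (r (s x))) \<in> local_ideal y ((\<lambda>p x. p (s x)) ` max_ideal_mult X (s y))" .
    moreover have "(\<lambda>p x. p (s x)) ` max_ideal_mult X (s y) \<subseteq> max_ideal_mult Y y"
      using vanishing_ideal_compose[OF _ assms(1,3)] real_polynomial_function_comp[OF _ assms(1)]
      by (auto simp: max_ideal_mult_def[of X] intro!: max_ideal_multI)
    ultimately have "(\<lambda>x. F (r (s x))) \<in> local_ideal y (max_ideal_mult Y y)"
      using local_ideal_subset[of "(\<lambda>p x. p (s x)) ` max_ideal_mult X (s y)" y "max_ideal_mult Y y"]
        local_ideal_base by blast
    moreover have "(\<lambda>x. \<Sum>i\<in>Basis. d i x * e i x) \<in> local_ideal y (max_ideal_mult Y y)"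
      using d(1,2) dF e
      by (intro local_ideal_sum local_ideal_base max_ideal_multI) auto
    ultimately have mem: "(\<lambda>x. F (r (s x)) + (\<Sum>i\<in>Basis. d i x * e i x)) \<in> local_ideal y (max_ideal_mult Y y)"
      by (rule local_ideal_add)
    have "(\<lambda>x. F (r (s x)) + (\<Sum>i\<in>Basis. d i x * e i x)) = F"
      by (rule ext) (rule d(3)[rule_format, symmetric])
    then show "F \<in> local_ideal y (max_ideal_mult Y y)"
      by (rule back_subst[of "\<lambda>f. f \<in> local_ideal y (max_ideal_mult Y y)", OF mem])
  qed
  ultimately show ?thesis
    using assms(6) G(1) unfolding smooth_point_iff_conormal_injective
    by (intro conjI exI[of _ ?G]) auto
qed

lemma real_polynomial_function_factor:
  fixes p :: "real \<times> 'a::real_normed_vector \<Rightarrow> real"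
  assumes "real_polynomial_function p"
  obtains r where "real_polynomial_function r" "\<And>t x. p (t, x) = p (0, x) + t * r (t, x)"
proof -
  obtain c n where c: "\<And>k. real_polynomial_function (c k)" "\<And>k. k > n \<Longrightarrow> c k = (\<lambda>x. 0)"
    "\<And>t x. p (t, x) = (\<Sum>k\<le>n. c k x * t ^ k)"
    by (rule real_polynomial_function_coeffs[OF assms]) (rule that)
  define r where "r = (\<lambda>z. \<Sum>k<n. c (Suc k) (snd z) * fst z ^ k)"
  have "real_polynomial_function r"
    unfolding r_def
    by (intro real_polynomial_function_sum real_polynomial_function.intros(4) finite_lessThan
      real_polynomial_function_power real_polynomial_function.intros(1)[OF bounded_linear_fst]
      real_polynomial_function_comp[OF c(1)] polynomial_intros)
  moreover have "p (t, x) = p (0, x) + t * r (t, x)" for t x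
  proof -
    have "p (t, x) = c 0 x + (\<Sum>k<n. c (Suc k) x * t ^ Suc k)"
      unfolding c(3) by (subst sum.atMost_shift) simp
    moreover have "p (0, x) = c 0 x"
      unfolding c(3) by (subst sum.atMost_shift) simp
    ultimately show ?thesis
      by (simp add: r_def sum_distrib_left algebra_simps)
  qed
  ultimately show ?thesis by (rule that)
qed

section \<open>Limits along curves, and invariance of smoothness\<close>

lemma polynomial_function_tendsto:
  fixes p :: "'a::euclidean_space \<Rightarrow> 'b::euclidean_space"
  assumes "polynomial_function p" "(g \<longlongrightarrow> a) F"
  shows "((\<lambda>t. p (g t)) \<longlongrightarrow> p a) F"
  using polynomial_function_continuous[OF assms(1), of UNIV] assms(2)
  by (auto simp: continuous_on_eq_continuous_at intro: isCont_tendsto_compose)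

lemma real_polynomial_function_tendsto:
  fixes p :: "'a::euclidean_space \<Rightarrow> real"
  assumes "real_polynomial_function p" "(g \<longlongrightarrow> a) F"
  shows "((\<lambda>t. p (g t)) \<longlongrightarrow> p a) F"
  using polynomial_function_tendsto assms by (auto simp: real_polynomial_function_eq)

lemma frechet_derivative_Basis:
  fixes p :: "'a::euclidean_space \<Rightarrow> real"
  assumes "real_polynomial_function p"
  shows "frechet_derivative p (at x) v = (\<Sum>i\<in>Basis. (v \<bullet> i) * frechet_derivative p (at x) i)"
proof -
  interpret bounded_linear "frechet_derivative p (at x)"
    by (rule has_derivative_bounded_linear[OF real_polynomial_function_has_derivative[OF assms]])
  have "frechet_derivative p (at x) v = frechet_derivative p (at x) (\<Sum>i\<in>Basis. (v \<bullet> i) *\<^sub>R i)"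
    by (simp add: euclidean_representation)
  then show ?thesis by (simp add: sum scale)
qed

text \<open>On the diagonal the polynomial divided differences are the partial derivatives, so these
  inherit continuity.\<close>

lemma frechet_derivative_tendsto:
  fixes p :: "'a::euclidean_space \<Rightarrow> real"
  assumes "real_polynomial_function p" "(g \<longlongrightarrow> a) F"
  shows "((\<lambda>t. frechet_derivative p (at (g t)) v) \<longlongrightarrow> frechet_derivative p (at a) v) F"
proof -
  obtain c where c: "\<And>i. real_polynomial_function (c i)"
    "\<And>i x. i \<in> Basis \<Longrightarrow> c i (x, x) = frechet_derivative p (at x) i"
    "\<And>z w. p z - p w = (\<Sum>i\<in>Basis. c i (z, w) * ((z - w) \<bullet> i))"
    by (rule real_polynomial_function_difference[OF assms(1)]) (rule that)
  have "frechet_derivative p (at x) v = (\<Sum>i\<in>Basis. (v \<bullet> i) * c i (x, x))" for x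
    unfolding frechet_derivative_Basis[OF assms(1), of x v] by (simp add: c(2))
  moreover have "((\<lambda>t. \<Sum>i\<in>Basis. (v \<bullet> i) * c i (g t, g t)) \<longlongrightarrow> (\<Sum>i\<in>Basis. (v \<bullet> i) * c i (a, a))) F"
    by (intro tendsto_sum tendsto_mult tendsto_const
      real_polynomial_function_tendsto[OF c(1)] tendsto_Pair assms(2))
  ultimately show ?thesis by simp
qed

text \<open>The inverse \<open>q\<close> acts as the section and \<open>p\<close> as the retraction,
  so smoothness at \<open>q (g y) = y\<close> passes to \<open>g y\<close>.\<close>

lemma variety_aut_smooth_point:
  assumes "g \<in> variety_aut Y" "smooth_point Y y"
  shows "smooth_point Y (g y)"
proof -
  have y: "y \<in> Y" using assms(2) by (simp add: smooth_point_def)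
  obtain p q where pq: "polynomial_function p" "polynomial_function q"
    "\<forall>y\<in>Y. g y = p y \<and> p y \<in> Y \<and> q y \<in> Y \<and> q (p y) = y \<and> p (q y) = y"
    using assms(1) by (auto simp: variety_aut_def)
  show ?thesis
    by (rule smooth_point_retract[of q p Y Y]) (use pq y assms(2) in auto)
qed

text \<open>If the \<open>\<alpha> b\<close> were not all zero, dividing the relation by the lowest
  power of \<open>t\<close> that occurs and letting \<open>t\<close> tend to 0 would give a
  nontrivial dependence at \<open>t = 0\<close>. The induction on \<open>k\<close> removes the
  coefficients of \<open>t ^ k\<close> one order at a time; from \<open>D\<close>, only continuity
  at 0 enters.\<close>

lemma analytic_dependence_zero:
  fixes \<alpha> :: "'b \<Rightarrow> real \<Rightarrow> real" and D :: "'b \<Rightarrow> real \<Rightarrow> 'v \<Rightarrow> real"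
  assumes "finite B" "\<And>b. b \<in> B \<Longrightarrow> real_polynomial_function (\<alpha> b)"
    and zero: "\<And>t v. (\<Sum>b\<in>B. \<alpha> b t * D b t v) = 0"
    and D: "\<And>b v. b \<in> B \<Longrightarrow> ((\<lambda>t. D b t v) \<longlongrightarrow> D b 0 v) (at 0)"
    and indep: "\<And>c. (\<forall>v. (\<Sum>b\<in>B. c b * D b 0 v) = 0) \<Longrightarrow> \<forall>b\<in>B. c b = 0"
    and "b \<in> B"
  shows "\<alpha> b t = 0"
proof -
  have "\<forall>b\<in>B. \<exists>c n. \<forall>t. \<alpha> b t = (\<Sum>i\<le>n. c i * t ^ i)"
    using assms(2) real_polynomial_function_imp_sum by metis
  then obtain c n where c: "\<And>b t. b \<in> B \<Longrightarrow> \<alpha> b t = (\<Sum>i\<le>n b. c b i * t ^ i)"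
    by metis
  have "\<forall>b\<in>B. k \<le> n b \<longrightarrow> c b k = 0" for k
  proof (induction k rule: less_induct)
    case (less k)
    define \<beta> where "\<beta> = (\<lambda>b t. \<Sum>j\<in>{k..n b}. c b j * t ^ (j - k))"
    have \<alpha>: "\<alpha> b t = t ^ k * \<beta> b t" if "b \<in> B" for b t
    proof -
      have "\<alpha> b t = (\<Sum>i\<in>{k..n b}. c b i * t ^ i)"
        unfolding c[OF that] using less that
        by (intro sum.mono_neutral_right) auto
      also have "\<dots> = (\<Sum>i\<in>{k..n b}. t ^ k * (c b i * t ^ (i - k)))"
        by (intro sum.cong) (auto simp: power_add[symmetric])
      finally show ?thesis by (simp add: \<beta>_def sum_distrib_left)
    qed
    have \<beta>0: "\<beta> b 0 = (if k \<le> n b then c b k else 0)" for b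
    proof (cases "k \<le> n b")
      case True
      have "\<beta> b 0 = (\<Sum>j\<in>{k..n b}. if j = k then c b k else 0)"
        unfolding \<beta>_def by (intro sum.cong) auto
      then show ?thesis using True by simp
    qed (simp add: \<beta>_def)
    have "(\<Sum>b\<in>B. \<beta> b 0 * D b 0 v) = 0" for v
    proof -
      have "((\<lambda>t. \<Sum>b\<in>B. \<beta> b t * D b t v) \<longlongrightarrow> (\<Sum>b\<in>B. \<beta> b 0 * D b 0 v)) (at 0)"
        unfolding \<beta>_def by (intro tendsto_intros D)
      moreover have "(\<Sum>b\<in>B. \<beta> b t * D b t v) = 0" if "t \<noteq> 0" for t
      proof -
        have "t ^ k * (\<Sum>b\<in>B. \<beta> b t * D b t v) = (\<Sum>b\<in>B. \<alpha> b t * D b t v)"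
          using \<alpha> by (simp add: sum_distrib_left mult.assoc)
        then show ?thesis using zero that by simp
      qed
      then have "((\<lambda>t. \<Sum>b\<in>B. \<beta> b t * D b t v) \<longlongrightarrow> 0) (at 0)"
        by (intro tendsto_eventually) (auto simp: eventually_at_filter)
      ultimately show ?thesis using tendsto_unique[OF trivial_limit_at] by blast
    qed
    then have "\<forall>b\<in>B. \<beta> b 0 = 0" by (intro indep) blast
    then show ?case by (auto simp: \<beta>0)
  qed
  then show ?thesis using assms(6) c by (simp add: sum.neutral)
qed

subsection \<open>Suspensions\<close>

text \<open>
  Since \<open>f y = 0\<close>, the points \<open>(y, t, 0)\<close> also lie on the suspension. For \<open>t \<noteq> 0\<close> the section
  \<open>z \<mapsto> (z, t, f z / t)\<close> passes through \<open>(y, t, 0)\<close>, and relations at \<open>(y, 0, 0)\<close> with a denominator \<open>h\<close>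
  are pulled back along it for a \<open>t\<close> with \<open>h (y, t, 0) \<noteq> 0\<close>. This \<open>t\<close> depends on the relation, so
  the generators are the coefficients of the powers of \<open>t\<close> in the pulled back elements of \<open>B\<close>.
\<close>

lemma Susp_smooth_origin:
  assumes p: "real_polynomial_function p" "\<And>y. y \<in> Y \<Longrightarrow> f y = p y"
    and x: "smooth_point (Susp Y f) (y, 0, 0)"
  shows "smooth_point Y y"
proof -
  let ?X = "Susp Y f"
  have X: "(y, u, v) \<in> ?X \<longleftrightarrow> y \<in> Y \<and> u * v = p y" for y u v
    using p(2) by (auto simp: Susp_def)
  have y: "y \<in> Y" "p y = 0" using x X[of y 0 0] by (auto simp: smooth_point_def)
  define s where "s = (\<lambda>t y. (y, t, p y / t))"
  have s_poly: "polynomial_function (s t)" for t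
    unfolding s_def
    by (intro polynomial_function_Pair polynomial_intros
      real_polynomial_function_divide[OF p(1), unfolded real_polynomial_function_eq])
  have s_X: "s t ` Y \<subseteq> ?X" if "t \<noteq> 0" for t
    using that by (auto simp: s_def X)
  have s_y: "s t y = (y, t, 0)" for t by (simp add: s_def y)
  obtain B where B: "finite B" "B \<subseteq> vanishing_ideal ?X"
    "\<And>c. (\<forall>v. (\<Sum>p\<in>B. c p * frechet_derivative p (at (y, 0, 0)) v) = 0) \<Longrightarrow> (\<forall>p\<in>B. c p = 0)"
    "vanishing_ideal ?X \<subseteq> local_ideal (y, 0, 0) B"
    using x unfolding smooth_point_alt by blast
  have "\<exists>c n N. \<forall>t y. t \<noteq> 0 \<longrightarrow> (\<forall>k. c k \<in> vanishing_ideal Y) \<and> t ^ N * b (s t y) = (\<Sum>k\<le>n. c k y * t ^ k)"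
    if "b \<in> B" for b :: "'a \<times> real \<times> real \<Rightarrow> real"
  proof -
    have b: "b \<in> vanishing_ideal ?X" using that B(2) by blast
    obtain q N where q: "real_polynomial_function q" "\<And>t y. t \<noteq> 0 \<Longrightarrow> t ^ N * b (y, t, p y / t) = q (t, y)"
      by (rule real_polynomial_function_clear_denominator[OF vanishing_ideal_poly[OF b] p(1)]) (rule that)
    obtain c n where c: "\<And>k. real_polynomial_function (c k)" "\<And>k. k > n \<Longrightarrow> c k = (\<lambda>x. 0)"
      "\<And>t x. q (t, x) = (\<Sum>k\<le>n. c k x * t ^ k)"
      by (rule real_polynomial_function_coeffs[OF q(1)]) (rule that)
    have "c k z = 0" if z: "z \<in> Y" for k z
    proof -
      have zero: "q (t, z) = 0" if "t \<noteq> 0" for t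
        using q(2)[OF that, of z] s_X[OF that] z vanishing_ideal_zero[OF b] unfolding s_def by auto
      \<comment> \<open>The relation with \<open>b\<close> gives \<open>q (t, z) = 0\<close> for
        \<open>t \<noteq> 0\<close> only; continuity adds \<open>t = 0\<close>, so that coefficients
        can be compared.\<close>
      have "((\<lambda>t. q (t, z)) \<longlongrightarrow> q (0, z)) (at 0)"
        by (intro real_polynomial_function_tendsto[OF q(1)] tendsto_intros)
      moreover have "((\<lambda>t. q (t, z)) \<longlongrightarrow> 0) (at 0)"
        using zero by (intro tendsto_eventually) (auto simp: eventually_at_filter)
      ultimately have "q (0, z) = 0" using tendsto_unique[OF trivial_limit_at] by blast
      with zero have "\<forall>t. (\<Sum>k\<le>n. c k z * t ^ k) = 0" unfolding c(3)[symmetric] by metis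
      then have "\<forall>k\<le>n. c k z = 0" by (subst (asm) polyfun_eq_0)
      then show ?thesis using c(2)[of k] by (cases "k \<le> n") auto
    qed
    then have "\<forall>k. c k \<in> vanishing_ideal Y" using c(1) by (simp add: vanishing_ideal_def)
    moreover have "t ^ N * b (s t y) = (\<Sum>k\<le>n. c k y * t ^ k)" if "t \<noteq> 0" for t y
      using q(2)[OF that, of y] c(3) by (simp add: s_def)
    ultimately show ?thesis by (intro exI[of _ c] exI[of _ n] exI[of _ N]) auto
  qed
  then have "\<exists>c n N. \<forall>b\<in>B. \<forall>t y. t \<noteq> 0 \<longrightarrow> (\<forall>k. c b k \<in> vanishing_ideal Y) \<and>
      t ^ N b * b (s t y) = (\<Sum>k\<le>n b. c b k y * t ^ k)"
    by metis
  then obtain c n N where "\<forall>b\<in>B. \<forall>t y. t \<noteq> 0 \<longrightarrow> (\<forall>k. c b k \<in> vanishing_ideal Y) \<and>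
      t ^ N b * b (s t y) = (\<Sum>k\<le>n b. c b k y * t ^ k)"
    by blast
  then have c: "\<And>b k. b \<in> B \<Longrightarrow> c b k \<in> vanishing_ideal Y"
      "\<And>b t y. b \<in> B \<Longrightarrow> t \<noteq> 0 \<Longrightarrow> t ^ N b * b (s t y) = (\<Sum>k\<le>n b. c b k y * t ^ k)"
    using zero_neq_one by metis+
  define G where "G = (\<Union>b\<in>B. c b ` {..n b})"
  have G: "finite G" "G \<subseteq> vanishing_ideal Y" using B(1) c(1) by (auto simp: G_def)
  have bs: "(\<lambda>y. b (s t y)) \<in> local_ideal y G" if "b \<in> B" "t \<noteq> 0" for b t
  proof -
    have "(\<lambda>y. \<Sum>k\<le>n b. t ^ k / t ^ N b * c b k y) \<in> local_ideal y G"
      using that by (intro local_ideal_sum local_ideal_mult local_ideal_base) (auto simp: G_def)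
    moreover have "(\<lambda>y. \<Sum>k\<le>n b. t ^ k / t ^ N b * c b k y) = (\<lambda>y. b (s t y))"
    proof
      fix z
      have "(\<Sum>k\<le>n b. t ^ k / t ^ N b * c b k z) = (\<Sum>k\<le>n b. c b k z * t ^ k) / t ^ N b"
        by (simp add: sum_divide_distrib mult.commute)
      also have "\<dots> = b (s t z)" unfolding c(2)[OF that, symmetric] using that by simp
      finally show "(\<Sum>k\<le>n b. t ^ k / t ^ N b * c b k z) = b (s t z)" .
    qed
    ultimately show ?thesis by simp
  qed
  \<comment> \<open>One pulled back relation serves both halves of the criterion: by itself it puts
    \<open>F\<close> into the ideal generated by \<open>G\<close>, and when the differential of
    \<open>F\<close> vanishes its coefficients lie in the maximal ideal.\<close>
  have key: "\<exists>h a t. t \<noteq> 0 \<and> real_polynomial_function h \<and> h y \<noteq> 0 \<and> (\<forall>b\<in>B. real_polynomial_function (a b)) \<and>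
      (\<forall>z. h z * F z = (\<Sum>b\<in>B. a b z * b (s t z))) \<and>
      ((\<forall>v. frechet_derivative F (at y) v = 0) \<longrightarrow> (\<forall>b\<in>B. a b y = 0))"
    if F: "F \<in> vanishing_ideal Y" for F
  proof -
    have Ff: "(\<lambda>x. F (fst x)) \<in> vanishing_ideal ?X"
      by (rule vanishing_ideal_compose[OF F polynomial_function_fst[OF polynomial_function_id]])
        (auto simp: X)
    then have "(\<lambda>x. F (fst x)) \<in> local_ideal (y, 0, 0) B" using B(4) by blast
    then obtain h a where ha: "real_polynomial_function h" "h (y, 0, 0) \<noteq> 0"
        "\<forall>p\<in>B. real_polynomial_function (a p)" "\<forall>x. h x * F (fst x) = (\<Sum>p\<in>B. a p x * p x)"
      unfolding local_ideal_finite_iff[OF B(1)] by blast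
    have lim: "((\<lambda>t. (y, t, 0)) \<longlongrightarrow> (y, 0, 0)) (at (0::real))"
      by (intro tendsto_intros)
    have "((\<lambda>t. h (y, t, 0)) \<longlongrightarrow> h (y, 0, 0)) (at (0::real))"
      by (rule real_polynomial_function_tendsto[OF ha(1) lim])
    then have "eventually (\<lambda>t. h (y, t, 0) \<noteq> 0) (at (0::real))"
      using ha(2) tendsto_imp_eventually_ne by blast
    then have "eventually (\<lambda>t. h (y, t, 0) \<noteq> 0 \<and> t \<noteq> 0) (at (0::real))"
      by (rule eventually_conj) (simp add: eventually_at_filter)
    then obtain t :: real where t: "t \<noteq> 0" "h (y, t, 0) \<noteq> 0"
      using eventually_happens'[OF trivial_limit_at] by blast
    \<comment> \<open>The differentials are independent at \<open>(y, 0, 0)\<close>, but the section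
      passes through \<open>(y, t, 0)\<close> for a fixed \<open>t \<noteq> 0\<close>. Since
      \<open>F \<circ> fst\<close> has zero differential at every point over \<open>y\<close>, the
      relation holds along the whole line as a dependence that is polynomial in \<open>t\<close>,
      and \<open>analytic_dependence_zero\<close> kills it for all \<open>t\<close>.\<close>
    have a0: "a b (y, t, 0) = 0" if dF: "\<forall>v. frechet_derivative F (at y) v = 0" and "b \<in> B" for b
    proof (rule analytic_dependence_zero[where B = B and \<alpha> = "\<lambda>b t. a b (y, t, 0)" and
          D = "\<lambda>b t v. frechet_derivative b (at (y, t, 0)) v", OF B(1)])
      show "real_polynomial_function (\<lambda>t. a b (y, t, 0))" if "b \<in> B" for b
        by (rule real_polynomial_function_comp[OF ha(3)[rule_format, OF that]]) (intro polynomial_intros)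
      show "((\<lambda>t. frechet_derivative b (at (y, t, 0)) v) \<longlongrightarrow> frechet_derivative b (at (y, 0, 0)) v) (at 0)"
        if "b \<in> B" for b v
        by (rule frechet_derivative_tendsto[OF _ lim]) (use that B(2) vanishing_ideal_poly in blast)
      show "\<forall>b\<in>B. c b = 0" if "\<forall>v. (\<Sum>b\<in>B. c b * frechet_derivative b (at (y, 0, 0)) v) = 0" for c
        using B(3)[OF that] .
      show "(\<Sum>b\<in>B. a b (y, t, 0) * frechet_derivative b (at (y, t, 0)) v) = 0" for t v
      proof -
        have xt: "(y, t, 0) \<in> ?X" by (simp add: X y)
        have "(\<Sum>b\<in>B. a b (y, t, 0) * frechet_derivative b (at (y, t, 0)) v) =
            frechet_derivative (\<lambda>x. h x * F (fst x)) (at (y, t, 0)) v"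
          unfolding ha(4)[rule_format] using B ha xt
          by (intro frechet_derivative_sum_mult[symmetric])
            (auto intro: vanishing_ideal_poly vanishing_ideal_zero)
        also have "\<dots> = h (y, t, 0) * frechet_derivative (\<lambda>x. F (fst x)) (at (y, t, 0)) v"
          by (rule frechet_derivative_mult_zero[OF ha(1) vanishing_ideal_poly[OF Ff]
            vanishing_ideal_zero[OF Ff xt]])
        also have "\<dots> = 0"
          using frechet_derivative_comp[OF vanishing_ideal_poly[OF F] polynomial_function_fst[OF polynomial_function_id],
            of "(y, t, 0)" v] dF by simp
        finally show ?thesis .
      qed
    qed (rule \<open>b \<in> B\<close>)
    show ?thesis
    proof (intro exI[of _ "\<lambda>z. h (s t z)"] exI[of _ "\<lambda>b z. a b (s t z)"] exI[of _ t] conjI ballI allI impI)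
      show "h (s t z) * F z = (\<Sum>b\<in>B. a b (s t z) * b (s t z))" for z
        using ha(4)[rule_format, of "s t z"] by (simp add: s_def)
    qed (use t ha a0 s_y real_polynomial_function_comp[OF _ s_poly] in auto)
  qed
  have "F \<in> local_ideal y G" if F: "F \<in> vanishing_ideal Y" for F
  proof -
    obtain h a t where *: "t \<noteq> 0" "real_polynomial_function h" "h y \<noteq> 0" "\<forall>b\<in>B. real_polynomial_function (a b)"
      "\<forall>z. h z * F z = (\<Sum>b\<in>B. a b z * b (s t z))"
      using key[OF F] by blast
    have **: "(\<lambda>z. \<Sum>b\<in>B. a b z * b (s t z)) \<in> local_ideal y G"
      using *(1,4) B(1) bs by (intro local_ideal_sum local_ideal_mult) auto
    show ?thesis by (rule local_ideal.cancel[of h]) (use * ** in simp_all)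
  qed
  moreover have "conormal_injective Y y"
    unfolding conormal_injective_def
  proof (intro ballI impI)
    fix F assume F: "F \<in> vanishing_ideal Y" and dF: "\<forall>v. frechet_derivative F (at y) v = 0"
    obtain h a t where *: "t \<noteq> 0" "real_polynomial_function h" "h y \<noteq> 0" "\<forall>b\<in>B. real_polynomial_function (a b)"
      "\<forall>z. h z * F z = (\<Sum>b\<in>B. a b z * b (s t z))" "\<forall>b\<in>B. a b y = 0"
      using key[OF F] dF by blast
    have "(\<lambda>z. b (s t z)) \<in> vanishing_ideal Y" if "b \<in> B" for b
      using that B(2) vanishing_ideal_compose[OF _ s_poly s_X[OF *(1)]] by blast
    then have **: "(\<lambda>z. \<Sum>b\<in>B. a b z * b (s t z)) \<in> local_ideal y (max_ideal_mult Y y)"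
      using *(4,6) B(1) by (intro local_ideal_sum local_ideal_base max_ideal_multI) auto
    show "F \<in> local_ideal y (max_ideal_mult Y y)"
      by (rule local_ideal.cancel[of h]) (use * ** in simp_all)
  qed
  ultimately show ?thesis
    using y(1) G unfolding smooth_point_iff_conormal_injective
    by (intro conjI exI[of _ G]) auto
qed

text \<open>If \<open>u\<close> or \<open>v\<close> is nonzero, keeping it fixed gives a polynomial
  section of \<open>fst\<close> through the point, and \<open>smooth_point_retract\<close> applies.
  What remains is the crossing point.\<close>

lemma Susp_smooth_base:
  assumes p: "real_polynomial_function p" "\<And>y. y \<in> Y \<Longrightarrow> f y = p y"
    and x: "smooth_point (Susp Y f) (y, u, v)"
  shows "smooth_point Y y"
proof -
  have X: "(y, u, v) \<in> Susp Y f \<longleftrightarrow> y \<in> Y \<and> u * v = p y" for y u v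
    using p(2) by (auto simp: Susp_def)
  have y: "y \<in> Y" "u * v = p y" using x X[of y u v] by (auto simp: smooth_point_def)
  have pd: "polynomial_function (\<lambda>y. p y / t)" for t
    using real_polynomial_function_divide[OF p(1)] by (simp add: real_polynomial_function_eq)
  have fst: "polynomial_function (fst :: 'a \<times> real \<times> real \<Rightarrow> 'a)"
    using polynomial_function_fst[OF polynomial_function_id] .
  consider "u \<noteq> 0" | "v \<noteq> 0" | "u = 0" "v = 0" by blast
  then show ?thesis
  proof cases
    case 1
    show ?thesis
    proof (rule smooth_point_retract[of "\<lambda>y. (y, u, p y / u)" fst Y "Susp Y f"])
      have "p y / u = v" using 1 y(2) by (simp add: field_simps)
      then show "smooth_point (Susp Y f) (y, u, p y / u)" using x by simp
    qed (use 1 y fst in \<open>auto simp: X intro!: polynomial_function_Pair pd\<close>)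
  next
    case 2
    show ?thesis
    proof (rule smooth_point_retract[of "\<lambda>y. (y, p y / v, v)" fst Y "Susp Y f"])
      have "p y / v = u" using 2 y(2) by (simp add: field_simps)
      then show "smooth_point (Susp Y f) (y, p y / v, v)" using x by simp
    qed (use 2 y fst in \<open>auto simp: X intro!: polynomial_function_Pair pd\<close>)
  next
    case 3
    then show ?thesis using Susp_smooth_origin[OF p] x by simp
  qed
qed

text \<open>The gradients at \<open>y\<close> of elements of the ideal form a subspace whose
  orthogonal complement is the tangent space. A gradient orthogonal to the tangent space lies in the
  double complement, which is that subspace itself.\<close>

lemma tangent_space_frechet_zero:
  assumes p: "real_polynomial_function p"
    and "\<And>v. v \<in> tangent_space Y y \<Longrightarrow> frechet_derivative p (at y) v = 0"
  obtains g where "g \<in> vanishing_ideal Y" "\<And>v. frechet_derivative g (at y) v = frechet_derivative p (at y) v"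
proof -
  define grad where "grad = (\<lambda>p. \<Sum>i\<in>Basis. frechet_derivative p (at y) i *\<^sub>R i)"
  have grad: "grad q \<bullet> v = frechet_derivative q (at y) v" if "real_polynomial_function q" for q v
    unfolding frechet_derivative_Basis[OF that, of y v]
    by (simp add: grad_def inner_sum_left mult.commute inner_commute[of v])
  let ?W = "grad ` vanishing_ideal Y"
  have "subspace ?W"
  proof (rule subspaceI)
    have "(\<lambda>x. 0) \<in> vanishing_ideal Y" by (simp add: vanishing_ideal_def)
    moreover have "grad (\<lambda>x. 0) = 0" by (simp add: grad_def frechet_derivative_const)
    ultimately show "0 \<in> ?W" by (metis image_eqI)
  next
    fix a b assume "a \<in> ?W" "b \<in> ?W"
    then obtain p q where pq: "p \<in> vanishing_ideal Y" "q \<in> vanishing_ideal Y" "a = grad p" "b = grad q" by blast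
    have D: "((\<lambda>x. p x + q x) has_derivative (\<lambda>v. frechet_derivative p (at y) v + frechet_derivative q (at y) v)) (at y)"
      by (intro has_derivative_add real_polynomial_function_has_derivative
        vanishing_ideal_poly[OF pq(1)] vanishing_ideal_poly[OF pq(2)])
    have "grad (\<lambda>x. p x + q x) = a + b"
      by (simp add: grad_def pq frechet_derivative_at[OF D, symmetric] scaleR_left_distrib sum.distrib)
    moreover have "(\<lambda>x. p x + q x) \<in> vanishing_ideal Y"
      using pq by (auto simp: vanishing_ideal_def)
    ultimately show "a + b \<in> ?W" by (metis image_eqI)
  next
    fix a and c :: real assume "a \<in> ?W"
    then obtain p where pq: "p \<in> vanishing_ideal Y" "a = grad p" by blast
    have D: "((\<lambda>x. c * p x) has_derivative (\<lambda>v. c * frechet_derivative p (at y) v)) (at y)"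
      by (intro has_derivative_mult_right real_polynomial_function_has_derivative
        vanishing_ideal_poly[OF pq(1)])
    have "grad (\<lambda>x. c * p x) = c *\<^sub>R a"
      by (simp add: grad_def pq frechet_derivative_at[OF D, symmetric] scaleR_sum_right)
    moreover have "(\<lambda>x. c * p x) \<in> vanishing_ideal Y"
      using pq by (auto simp: vanishing_ideal_def)
    ultimately show "c *\<^sub>R a \<in> ?W" by (metis image_eqI)
  qed
  have "grad p \<in> orthogonal_comp (orthogonal_comp ?W)"
  proof -
    have "v \<in> tangent_space Y y" if "v \<in> orthogonal_comp ?W" for v
      using that by (auto simp: orthogonal_comp_def orthogonal_def tangent_space_def
          grad[OF vanishing_ideal_poly, symmetric])
    then show ?thesis
      using assms(2) grad[OF p] by (auto simp: orthogonal_comp_def orthogonal_def inner_commute)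
  qed
  then have "grad p \<in> ?W" using orthogonal_comp_self[OF \<open>subspace ?W\<close>] by simp
  then obtain g where g: "g \<in> vanishing_ideal Y" "grad g = grad p" by auto
  then have "frechet_derivative g (at y) v = frechet_derivative p (at y) v" for v
    using grad[OF p, of v] grad[OF vanishing_ideal_poly[OF g(1)], of v] by simp
  then show ?thesis using that g(1) by blast
qed

text \<open>
  If the differential of \<open>f\<close> vanished, some \<open>F = u v - p + g\<close> with \<open>g \<in> I(Y)\<close> would have zero differential
  at the origin and hence lie in \<open>\<mm> I(X)\<close>. On the diagonal \<open>(y, t, t)\<close> it equals \<open>t\<^sup>2\<close>, but
  elements of \<open>I(X)\<close> are divisible by \<open>u v\<close> on this fibre, so elements of \<open>\<mm> I(X)\<close> are \<open>o(t\<^sup>2)\<close>.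
\<close>

lemma Susp_singular_origin:
  assumes p: "real_polynomial_function p" "\<And>y. y \<in> Y \<Longrightarrow> f y = p y"
    and x: "smooth_point (Susp Y f) (y, 0, 0)"
  obtains v where "v \<in> tangent_space Y y" "frechet_derivative p (at y) v \<noteq> 0"
proof -
  let ?X = "Susp Y f" and ?x = "(y, 0, 0) :: 'a \<times> real \<times> real"
  have X: "(y, u, v) \<in> ?X \<longleftrightarrow> y \<in> Y \<and> u * v = p y" for y u v
    using p(2) by (auto simp: Susp_def)
  have y: "y \<in> Y" "p y = 0" using x X[of y 0 0] by (auto simp: smooth_point_def)
  have False if df: "\<forall>v\<in>tangent_space Y y. frechet_derivative p (at y) v = 0"
  proof -
    obtain g where g: "g \<in> vanishing_ideal Y" "\<And>v. frechet_derivative g (at y) v = frechet_derivative p (at y) v"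
      by (rule tangent_space_frechet_zero[OF p(1), of Y y]) (use df in auto)
    define F where "F = (\<lambda>x. fst (snd x) * snd (snd x) - p (fst x) + g (fst x) :: real)"
    have gp: "real_polynomial_function g" using g(1) by (rule vanishing_ideal_poly)
    have "real_polynomial_function F"
      unfolding F_def real_polynomial_function_eq
      by (intro polynomial_intros polynomial_function_comp[OF p(1)[unfolded real_polynomial_function_eq]]
        polynomial_function_comp[OF gp[unfolded real_polynomial_function_eq]])
    moreover have "F z = 0" if "z \<in> ?X" for z
      using that X[of "fst z" "fst (snd z)" "snd (snd z)"] vanishing_ideal_zero[OF g(1)] by (simp add: F_def)
    ultimately have FX: "F \<in> vanishing_ideal ?X" by (simp add: vanishing_ideal_def)
    have dF: "(F has_derivative (\<lambda>v. 0 * snd (snd v) + fst (snd v) * 0 -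
        frechet_derivative p (at y) (fst v) + frechet_derivative g (at y) (fst v))) (at ?x)"
    proof -
      have 1: "((\<lambda>x. q (fst x)) has_derivative (\<lambda>z. frechet_derivative q (at y) (fst z))) (at ?x)"
        if "real_polynomial_function q" for q
        using has_derivative_compose[OF has_derivative_fst[OF has_derivative_ident]
          real_polynomial_function_has_derivative[OF that]] by force
      show ?thesis
        unfolding F_def by (rule has_derivative_eq_rhs, (rule has_derivative_add has_derivative_diff
          has_derivative_mult 1[OF p(1)] 1[OF gp] has_derivative_fst has_derivative_snd has_derivative_ident)+) simp
    qed
    have "frechet_derivative F (at ?x) v = 0" for v
      unfolding frechet_derivative_at[OF dF, symmetric] using g(2) by simp
    then have F: "F \<in> local_ideal ?x (max_ideal_mult ?X ?x)"
      using smooth_imp_conormal_injective[OF x] FX by (simp add: conormal_injective_def)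
    have lim: "((\<lambda>t. (y, t, t)) \<longlongrightarrow> ?x) (at (0::real))" by (intro tendsto_intros)
    have "((\<lambda>t. H (y, t, t) / t\<^sup>2) \<longlongrightarrow> 0) (at 0)" if "H \<in> local_ideal ?x (max_ideal_mult ?X ?x)" for H
      using that
    proof induction
      case zero
      then show ?case by simp
    next
      case (add_mult a s H)
      obtain m r where mr: "s = (\<lambda>x. m x * r x)" "real_polynomial_function m" "m ?x = 0" "r \<in> vanishing_ideal ?X"
        using add_mult.hyps(2) by (auto simp: max_ideal_mult_def)
      have "real_polynomial_function (\<lambda>z. r (y, fst z, snd z))"
        by (intro real_polynomial_function_comp[OF vanishing_ideal_poly[OF mr(4)]] polynomial_intros)
      then obtain R where R: "real_polynomial_function R"
          "\<And>u v. (\<lambda>z. r (y, fst z, snd z)) (u, v) = (\<lambda>z. r (y, fst z, snd z)) (0, v) + u * R (u, v)"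
        by (rule real_polynomial_function_factor) (rule that)
      \<comment> \<open>Since \<open>p y = 0\<close>, the fibre over \<open>y\<close> is the cross
        \<open>u * v = 0\<close>. Its line \<open>u = 0\<close> removes the constant term here, and
        its line \<open>v = 0\<close> does so in the second division.\<close>
      have R0: "r (y, u, v) = u * R (u, v)" for u v
        using R(2)[of u v] vanishing_ideal_zero[OF mr(4), of "(y, 0, v)"] y by (simp add: X)
      have "real_polynomial_function (\<lambda>z. R (snd z, fst z))"
        by (intro real_polynomial_function_comp[OF R(1)] polynomial_intros)
      then obtain S where S: "real_polynomial_function S"
          "\<And>v u. (\<lambda>z. R (snd z, fst z)) (v, u) = (\<lambda>z. R (snd z, fst z)) (0, u) + v * S (v, u)"
        by (rule real_polynomial_function_factor) (rule that)
      have "R (u, 0) = 0" if "u \<noteq> 0" for u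
        using R0[of u 0] vanishing_ideal_zero[OF mr(4), of "(y, u, 0)"] y that by (simp add: X)
      then have rS: "r (y, t, t) = t\<^sup>2 * S (t, t)" if "t \<noteq> 0" for t
        using R0[of t t] S(2)[of t t] that by (simp add: power2_eq_square)
      have ap: "real_polynomial_function a" by fact
      have "((\<lambda>t. a (y, t, t) * (m (y, t, t) * S (t, t)) + H (y, t, t) / t\<^sup>2) \<longlongrightarrow>
          a ?x * (m ?x * S (0, 0)) + 0) (at 0)"
        by (intro tendsto_add tendsto_mult real_polynomial_function_tendsto[OF ap lim] add_mult.IH
          real_polynomial_function_tendsto[OF mr(2) lim] real_polynomial_function_tendsto[OF S(1)] tendsto_Pair tendsto_ident_at)
      moreover have "\<forall>\<^sub>F t in at 0. a (y, t, t) * (m (y, t, t) * S (t, t)) + H (y, t, t) / t\<^sup>2 =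
          (a (y, t, t) * s (y, t, t) + H (y, t, t)) / t\<^sup>2"
        by (auto simp: eventually_at_filter mr(1) rS field_simps)
      ultimately show ?case using mr(3) by (simp add: tendsto_cong)
    next
      case (cancel h H)
      have "((\<lambda>t. h (y, t, t) * H (y, t, t) / t\<^sup>2 / h (y, t, t)) \<longlongrightarrow> 0 / h ?x) (at 0)"
        using cancel by (intro tendsto_divide real_polynomial_function_tendsto[OF _ lim])
      moreover have "eventually (\<lambda>t. h (y, t, t) \<noteq> 0) (at 0)"
        using cancel.hyps tendsto_imp_eventually_ne[OF real_polynomial_function_tendsto[OF _ lim]] by blast
      then have "\<forall>\<^sub>F t in at 0. h (y, t, t) * H (y, t, t) / t\<^sup>2 / h (y, t, t) = H (y, t, t) / t\<^sup>2"
        by eventually_elim simp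
      ultimately show ?case by (simp add: tendsto_cong)
    qed
    from this[OF F] have "((\<lambda>t::real. F (y, t, t) / t\<^sup>2) \<longlongrightarrow> 0) (at 0)" .
    moreover have "((\<lambda>t::real. F (y, t, t) / t\<^sup>2) \<longlongrightarrow> 1) (at 0)"
      using y vanishing_ideal_zero[OF g(1) y(1)]
      by (intro tendsto_eventually) (auto simp: eventually_at_filter F_def power2_eq_square)
    ultimately have "(0::real) = 1" by (rule LIM_unique)
    then show False by simp
  qed
  then show ?thesis using that by blast
qed

text \<open>The two conditions are the differentials of pulled back elements of
  \<open>vanishing_ideal Y\<close> and of \<open>u * v - p\<close>. They bound the tangent space
  from above when flexibility is checked.\<close>

lemma Susp_tangent_space:
  assumes p: "real_polynomial_function p" "\<And>y. y \<in> Y \<Longrightarrow> f y = p y"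
    and w: "(w, a, b) \<in> tangent_space (Susp Y f) (y, u, v)"
  shows "w \<in> tangent_space Y y" "u * b + v * a = frechet_derivative p (at y) w"
proof -
  let ?X = "Susp Y f"
  have X: "(y, u, v) \<in> ?X \<longleftrightarrow> y \<in> Y \<and> u * v = p y" for y u v
    using p(2) by (auto simp: Susp_def)
  show "w \<in> tangent_space Y y"
    unfolding tangent_space_def
  proof (intro CollectI ballI)
    fix q assume q: "q \<in> vanishing_ideal Y"
    have "(\<lambda>x. q (fst x)) \<in> vanishing_ideal ?X"
      by (rule vanishing_ideal_compose[OF q polynomial_function_fst[OF polynomial_function_id]])
        (auto simp: X)
    then have "frechet_derivative (\<lambda>x. q (fst x)) (at (y, u, v)) (w, a, b) = 0"
      using w by (simp add: tangent_space_def)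
    moreover have D: "((\<lambda>x. q (fst x)) has_derivative (\<lambda>z. frechet_derivative q (at y) (fst z))) (at (y, u, v))"
      using has_derivative_compose[OF has_derivative_fst[OF has_derivative_ident]
        real_polynomial_function_has_derivative[OF vanishing_ideal_poly[OF q]]] by force
    ultimately show "frechet_derivative q (at y) w = 0"
      by (simp add: frechet_derivative_at[OF D, symmetric])
  qed
  define F where "F = (\<lambda>x. fst (snd x) * snd (snd x) - p (fst x) :: real)"
  have "real_polynomial_function F"
    unfolding F_def real_polynomial_function_eq
    by (intro polynomial_intros polynomial_function_comp[OF p(1)[unfolded real_polynomial_function_eq]])
  moreover have "F z = 0" if "z \<in> ?X" for z
    using that X[of "fst z" "fst (snd z)" "snd (snd z)"] by (simp add: F_def)
  ultimately have "F \<in> vanishing_ideal ?X" by (simp add: vanishing_ideal_def)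
  then have "frechet_derivative F (at (y, u, v)) (w, a, b) = 0"
    using w by (simp add: tangent_space_def)
  moreover have D: "(F has_derivative (\<lambda>z. u * snd (snd z) + fst (snd z) * v - frechet_derivative p (at y) (fst z))) (at (y, u, v))"
  proof -
    have 1: "((\<lambda>x. p (fst x)) has_derivative (\<lambda>z. frechet_derivative p (at y) (fst z))) (at (y, u, v))"
      using has_derivative_compose[OF has_derivative_fst[OF has_derivative_ident]
        real_polynomial_function_has_derivative[OF p(1)]] by force
    show ?thesis
      unfolding F_def by (rule has_derivative_eq_rhs, (rule has_derivative_diff has_derivative_mult 1
        has_derivative_fst has_derivative_snd has_derivative_ident)+) simp
  qed
  ultimately show "u * b + v * a = frechet_derivative p (at y) w"
    by (simp add: frechet_derivative_at[OF D, symmetric] algebra_simps)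
qed

subsection \<open>One-parameter subgroups as polynomial flows\<close>

text \<open>Joint polynomiality in time and point encodes local nilpotency: it bounds the degree in
  \<open>t\<close> uniformly on \<open>Y\<close>. The value outside \<open>Y\<close> follows the
  convention of \<open>variety_aut\<close>, so flows and elements of \<open>SAut Y\<close> are
  compared as maps.\<close>

definition polynomial_flow :: "'a::euclidean_space set \<Rightarrow> (real \<Rightarrow> 'a \<Rightarrow> 'a) \<Rightarrow> bool" where
  "polynomial_flow Y \<phi> \<longleftrightarrow>
     (\<forall>t x. x \<notin> Y \<longrightarrow> \<phi> t x = x) \<and>
     (\<exists>P. polynomial_function P \<and> (\<forall>t. \<forall>y\<in>Y. \<phi> t y = P (t, y))) \<and>
     (\<forall>t. \<forall>y\<in>Y. \<phi> t y \<in> Y) \<and>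
     (\<forall>y\<in>Y. \<phi> 0 y = y) \<and>
     (\<forall>s t. \<forall>y\<in>Y. \<phi> (s + t) y = \<phi> s (\<phi> t y))"

lemma coordinate_ringI:
  "real_polynomial_function p \<Longrightarrow> (\<lambda>x. if x \<in> Y then p x else 0) \<in> coordinate_ring Y"
  by (auto simp: coordinate_ring_def)

lemma coordinate_ringE:
  assumes "a \<in> coordinate_ring Y"
  obtains p where "real_polynomial_function p" "a = (\<lambda>x. if x \<in> Y then p x else 0)"
  using assms by (auto simp: coordinate_ring_def)

lemma polynomial_flow_ring_coeffs:
  assumes "polynomial_flow Y \<phi>" "a \<in> coordinate_ring Y"
  obtains c n where "\<And>k. real_polynomial_function (c k)" "\<And>k. k > n \<Longrightarrow> c k = (\<lambda>x. 0)"
    "\<And>t y. y \<in> Y \<Longrightarrow> a (\<phi> t y) = (\<Sum>k\<le>n. c k y * t ^ k)"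
proof -
  obtain p where p: "real_polynomial_function p" "a = (\<lambda>x. if x \<in> Y then p x else 0)"
    using assms(2) by (rule coordinate_ringE)
  obtain P where P: "polynomial_function P" "\<forall>t. \<forall>y\<in>Y. \<phi> t y = P (t, y)" "\<forall>t. \<forall>y\<in>Y. \<phi> t y \<in> Y"
    using assms(1) by (auto simp: polynomial_flow_def)
  obtain c n where c: "\<And>k. real_polynomial_function (c k)" "\<And>k. k > n \<Longrightarrow> c k = (\<lambda>x. 0)"
    "\<And>t x. p (P (t, x)) = (\<Sum>k\<le>n. c k x * t ^ k)"
    by (rule real_polynomial_function_coeffs[OF real_polynomial_function_comp[OF p(1) P(1)]]) (rule that)
  have "a (\<phi> t y) = (\<Sum>k\<le>n. c k y * t ^ k)" if "y \<in> Y" for t y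
    using P(2,3) that c(3)[of t y] by (auto simp: p(2))
  with c(1,2) show ?thesis by (rule that)
qed

text \<open>Because \<open>c\<close> vanishes beyond \<open>n\<close>, the derivative keeps the
  summation range of the original, and differentiation can be iterated without changing the
  shape.\<close>

lemma has_field_derivative_polynomial:
  fixes c :: "nat \<Rightarrow> real"
  assumes "\<And>k. k > n \<Longrightarrow> c k = 0"
  shows "((\<lambda>t. \<Sum>k\<le>n. c k * t ^ k) has_field_derivative (\<Sum>k\<le>n. real (Suc k) * c (Suc k) * t ^ k)) (at t)"
proof -
  have "((\<lambda>t. \<Sum>k\<le>n. c k * t ^ k) has_field_derivative (\<Sum>k\<le>n. c k * (real k * t ^ (k - 1)))) (at t)"
    by (auto intro!: derivative_eq_intros sum.cong simp: mult_ac)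
  also have "(\<Sum>k\<le>n. c k * (real k * t ^ (k - 1))) = (\<Sum>k<n. real (Suc k) * c (Suc k) * t ^ k)"
    by (subst sum.atMost_shift) (simp add: algebra_simps)
  also have "\<dots> = (\<Sum>k\<le>n. real (Suc k) * c (Suc k) * t ^ k)"
    using assms by (simp add: lessThan_Suc_atMost[symmetric])
  finally show ?thesis .
qed

definition flow_derivation ::
    "'a::euclidean_space set \<Rightarrow> (real \<Rightarrow> 'a \<Rightarrow> 'a) \<Rightarrow> ('a \<Rightarrow> real) \<Rightarrow> 'a \<Rightarrow> real" where
  "flow_derivation Y \<phi> a = (\<lambda>y. if y \<in> Y then deriv (\<lambda>t. a (\<phi> t y)) 0 else 0)"

lemma flow_derivation_coeff:
  assumes "polynomial_flow Y \<phi>" "\<And>k. k > n \<Longrightarrow> c k = (\<lambda>x. 0)"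
    and "\<And>t. a (\<phi> t y) = (\<Sum>k\<le>n. c k y * t ^ k)" "y \<in> Y"
  shows "((\<lambda>t. a (\<phi> t y)) has_field_derivative c (Suc 0) y) (at 0)"
    and "flow_derivation Y \<phi> a y = c (Suc 0) y"
proof -
  have "(\<Sum>k\<le>n. real (Suc k) * c (Suc k) y * 0 ^ k) = c (Suc 0) y"
    by (subst sum.atMost_shift) simp
  then show 1: "((\<lambda>t. a (\<phi> t y)) has_field_derivative c (Suc 0) y) (at 0)"
    unfolding assms(3) using has_field_derivative_polynomial[of n "\<lambda>k. c k y" 0] assms(2) by simp
  then show "flow_derivation Y \<phi> a y = c (Suc 0) y"
    using assms(4) by (simp add: flow_derivation_def DERIV_imp_deriv)
qed

lemma flow_derivation_closed:
  assumes "polynomial_flow Y \<phi>" "a \<in> coordinate_ring Y"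
  shows "flow_derivation Y \<phi> a \<in> coordinate_ring Y"
proof -
  obtain c n where c: "\<And>k. real_polynomial_function (c k)" "\<And>k. k > n \<Longrightarrow> c k = (\<lambda>x. 0)"
    "\<And>t y. y \<in> Y \<Longrightarrow> a (\<phi> t y) = (\<Sum>k\<le>n. c k y * t ^ k)"
    by (rule polynomial_flow_ring_coeffs[OF assms]) (rule that)
  have "flow_derivation Y \<phi> a = (\<lambda>y. if y \<in> Y then c (Suc 0) y else 0)"
  proof
    fix y show "flow_derivation Y \<phi> a y = (if y \<in> Y then c (Suc 0) y else 0)"
    proof (cases "y \<in> Y")
      case True
      then show ?thesis using flow_derivation_coeff(2)[OF assms(1) c(2) c(3)] by simp
    qed (simp add: flow_derivation_def)
  qed
  then show ?thesis using coordinate_ringI[OF c(1)] by simp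
qed

text \<open>The group law turns the derivative at time \<open>t\<close> into the derivative at time
  0 starting from \<open>\<phi> t y\<close>.\<close>

lemma flow_has_derivative:
  assumes \<phi>: "polynomial_flow Y \<phi>" and a: "a \<in> coordinate_ring Y" and y: "y \<in> Y"
  shows "((\<lambda>t. a (\<phi> t y)) has_field_derivative flow_derivation Y \<phi> a (\<phi> t y)) (at t)"
proof -
  have group: "\<forall>s t. \<forall>y\<in>Y. \<phi> (s + t) y = \<phi> s (\<phi> t y)" "\<phi> t y \<in> Y"
    using \<phi> y by (auto simp: polynomial_flow_def)
  obtain c n where c: "\<And>k. real_polynomial_function (c k)" "\<And>k. k > n \<Longrightarrow> c k = (\<lambda>x. 0)"
    "\<And>t y. y \<in> Y \<Longrightarrow> a (\<phi> t y) = (\<Sum>k\<le>n. c k y * t ^ k)"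
    by (rule polynomial_flow_ring_coeffs[OF \<phi> a]) (rule that)
  have "((\<lambda>s. a (\<phi> s (\<phi> t y))) has_field_derivative flow_derivation Y \<phi> a (\<phi> t y)) (at 0)"
    using flow_derivation_coeff[OF \<phi> c(2) c(3)[OF group(2)] group(2)] by simp
  moreover have "(\<lambda>s. a (\<phi> s (\<phi> t y))) = (\<lambda>s. a (\<phi> (s + t) y))" using group y by simp
  ultimately show ?thesis
    using DERIV_shift[of "\<lambda>s. a (\<phi> s y)" "flow_derivation Y \<phi> a (\<phi> t y)" 0 t] by simp
qed

text \<open>Along an orbit the derivation is differentiation in time, so its iterates at
  \<open>y\<close> are read off from the Taylor coefficients. The induction has to run at all times
  \<open>t\<close>, as the next derivative involves the neighbouring points of the orbit.\<close>

lemma flow_derivation_funpow: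
  assumes \<phi>: "polynomial_flow Y \<phi>" and a: "a \<in> coordinate_ring Y" and y: "y \<in> Y"
    and c: "\<And>k. k > n \<Longrightarrow> c k = 0" "\<And>t. a (\<phi> t y) = (\<Sum>k\<le>n. c k * t ^ k)"
  shows "(flow_derivation Y \<phi> ^^ k) a y = fact k * c k"
proof -
  let ?D = "flow_derivation Y \<phi>"
  have ring: "(?D ^^ k) a \<in> coordinate_ring Y" for k
    by (induction k) (auto simp: a flow_derivation_closed[OF \<phi>])
  have eq: "(?D ^^ k) a (\<phi> t y) = (\<Sum>j\<le>n. fact (j + k) / fact j * c (j + k) * t ^ j)" for k t
  proof (induction k arbitrary: t)
    case 0
    then show ?case using c(2) by simp
  next
    case (Suc k)
    have "((\<lambda>t. (?D ^^ k) a (\<phi> t y)) has_field_derivative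
        (\<Sum>j\<le>n. real (Suc j) * (fact (Suc j + k) / fact (Suc j) * c (Suc j + k)) * t ^ j)) (at t)"
      unfolding Suc.IH by (rule has_field_derivative_polynomial) (simp add: c(1))
    moreover have "real (Suc j) * (fact (Suc j + k) / fact (Suc j) * c (Suc j + k)) =
        fact (j + Suc k) / fact j * c (j + Suc k)" for j
      by (simp del: of_nat_Suc)
    ultimately have "((\<lambda>t. (?D ^^ k) a (\<phi> t y)) has_field_derivative
        (\<Sum>j\<le>n. fact (j + Suc k) / fact j * c (j + Suc k) * t ^ j)) (at t)"
      by simp
    from DERIV_unique[OF flow_has_derivative[OF \<phi> ring y] this] show ?case by simp
  qed
  have "\<phi> 0 y = y" using \<phi> y by (auto simp: polynomial_flow_def)
  then have "(?D ^^ k) a y = (\<Sum>j\<le>n. fact (j + k) / fact j * c (j + k) * 0 ^ j)"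
    using eq[of k 0] by simp
  also have "\<dots> = fact k * c k" by (subst sum.atMost_shift) simp
  finally show ?thesis .
qed

lemma polynomial_flow_variety_aut:
  assumes "polynomial_flow Y \<phi>"
  shows "\<phi> t \<in> variety_aut Y"
proof -
  obtain P where P: "polynomial_function P" "\<forall>t. \<forall>y\<in>Y. \<phi> t y = P (t, y)" "\<forall>t. \<forall>y\<in>Y. \<phi> t y \<in> Y"
    "\<forall>y\<in>Y. \<phi> 0 y = y" "\<forall>s t. \<forall>y\<in>Y. \<phi> (s + t) y = \<phi> s (\<phi> t y)" "\<forall>t x. x \<notin> Y \<longrightarrow> \<phi> t x = x"
    using assms by (auto simp: polynomial_flow_def)
  have "polynomial_function (\<lambda>y. P (t, y))" for t
    by (rule polynomial_function_comp[OF P(1)]) (intro polynomial_intros)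
  moreover have "P (t, y) \<in> Y \<and> P (- t, P (t, y)) = y" if "y \<in> Y" for t y
  proof -
    have "\<phi> (- t + t) y = \<phi> (- t) (\<phi> t y)" using P(5) that by blast
    then show ?thesis using P(2,3,4) that by auto
  qed
  from this[of _ t] this[of _ "- t"]
  have "\<forall>y\<in>Y. \<phi> t y = P (t, y) \<and> P (t, y) \<in> Y \<and> P (- t, y) \<in> Y \<and>
      P (- t, P (t, y)) = y \<and> P (t, P (- t, y)) = y" using P(2) by simp
  ultimately show ?thesis using P(6) unfolding variety_aut_def by blast
qed

text \<open>Local nilpotency is the finite degree in \<open>t\<close> of
  \<open>a (\<phi> t y)\<close>, and the exponential series is the finite Taylor expansion of this
  function at time 0.\<close>

lemma polynomial_flow_one_parameter:
  assumes \<phi>: "polynomial_flow Y \<phi>"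
  shows "one_parameter_subgroup Y \<phi>"
  unfolding one_parameter_subgroup_def
proof (intro exI[of _ "flow_derivation Y \<phi>"] conjI allI ballI)
  let ?D = "flow_derivation Y \<phi>"
  have \<phi>0: "\<phi> 0 y = y" if "y \<in> Y" for y using \<phi> that by (auto simp: polynomial_flow_def)
  have D0: "?D a y = d" if "((\<lambda>t. a (\<phi> t y)) has_field_derivative d) (at 0)" "y \<in> Y" for a y d
    using that by (simp add: flow_derivation_def DERIV_imp_deriv)
  have der: "((\<lambda>t. a (\<phi> t y)) has_field_derivative ?D a y) (at 0)"
    if "a \<in> coordinate_ring Y" "y \<in> Y" for a y
    using flow_has_derivative[OF \<phi> that, of 0] \<phi>0 that by simp
  show "locally_nilpotent_derivation Y ?D"
    unfolding locally_nilpotent_derivation_def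
  proof (intro conjI ballI allI ext)
    fix a b y assume a: "a \<in> coordinate_ring Y" and b: "b \<in> coordinate_ring Y"
    show "?D (\<lambda>x. a x + b x) y = ?D a y + ?D b y"
    proof (cases "y \<in> Y")
      case True
      show ?thesis by (rule D0[OF DERIV_add[OF der[OF a True] der[OF b True]] True])
    qed (simp add: flow_derivation_def)
    show "?D (\<lambda>x. a x * b x) y = ?D a y * b y + a y * ?D b y"
    proof (cases "y \<in> Y")
      case True
      show ?thesis
        using D0[OF DERIV_mult[OF der[OF a True] der[OF b True]] True] \<phi>0[OF True] by (simp add: algebra_simps)
    qed (simp add: flow_derivation_def)
  next
    fix r a y assume a: "a \<in> coordinate_ring Y"
    show "?D (\<lambda>x. r * a x) y = r * ?D a y"
    proof (cases "y \<in> Y")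
      case True
      show ?thesis by (rule D0[OF DERIV_cmult[OF der[OF a True]] True])
    qed (simp add: flow_derivation_def)
  next
    fix a assume a: "a \<in> coordinate_ring Y"
    obtain c n where c: "\<And>k. real_polynomial_function (c k)" "\<And>k. k > n \<Longrightarrow> c k = (\<lambda>x. 0)"
      "\<And>t y. y \<in> Y \<Longrightarrow> a (\<phi> t y) = (\<Sum>k\<le>n. c k y * t ^ k)"
      by (rule polynomial_flow_ring_coeffs[OF \<phi> a]) (rule that)
    have "(?D ^^ Suc n) a y = 0" for y
    proof (cases "y \<in> Y")
      case True
      show ?thesis
        using flow_derivation_funpow[OF \<phi> a True, of n "\<lambda>k. c k y" "Suc n"] c(2,3) True by simp
    qed (simp add: flow_derivation_def)
    then show "\<exists>n. (?D ^^ n) a = (\<lambda>x. 0)" by (intro exI[of _ "Suc n"]) auto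
  qed (rule flow_derivation_closed[OF \<phi>])
  fix t show "\<phi> t \<in> variety_aut Y" by (rule polynomial_flow_variety_aut[OF \<phi>])
  fix a y assume a: "a \<in> coordinate_ring Y" and y: "y \<in> Y"
  obtain c n where c: "\<And>k. real_polynomial_function (c k)" "\<And>k. k > n \<Longrightarrow> c k = (\<lambda>x. 0)"
    "\<And>t y. y \<in> Y \<Longrightarrow> a (\<phi> t y) = (\<Sum>k\<le>n. c k y * t ^ k)"
    by (rule polynomial_flow_ring_coeffs[OF \<phi> a]) (rule that)
  have D: "(?D ^^ k) a y = fact k * c k y" for k
    using flow_derivation_funpow[OF \<phi> a y, of n "\<lambda>k. c k y" k] c(2,3) y by simp
  have "(\<Sum>k. t ^ k / fact k * (?D ^^ k) a y) = (\<Sum>k\<le>n. t ^ k / fact k * (?D ^^ k) a y)"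
    by (rule suminf_finite) (auto simp: D c(2))
  also have "\<dots> = a (\<phi> t y)" unfolding D c(3)[OF y] by (simp add: mult.commute)
  finally show "a (\<phi> t y) = (\<Sum>k. t ^ k / fact k * (?D ^^ k) a y)" by simp
qed

text \<open>This is \<open>exp (s D) exp (t D) = exp ((s + t) D)\<close> with \<open>e m\<close> in
  the role of \<open>(D ^^ m) a y\<close>. Nilpotency cuts the square of indices down to the
  triangle \<open>k + l < N\<close>, where the binomial theorem applies.\<close>

lemma exp_sum_add:
  fixes e :: "nat \<Rightarrow> real"
  assumes "\<And>m. m \<ge> N \<Longrightarrow> e m = 0"
  shows "(\<Sum>k<N. s ^ k / fact k * (\<Sum>l<N. t ^ l / fact l * e (l + k))) = (\<Sum>m<N. (s + t) ^ m / fact m * e m)"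
proof -
  let ?g = "\<lambda>k l. s ^ k / fact k * (t ^ l / fact l * e (l + k))"
  have "(\<Sum>k<N. s ^ k / fact k * (\<Sum>l<N. t ^ l / fact l * e (l + k))) = (\<Sum>(k, l)\<in>{..<N} \<times> {..<N}. ?g k l)"
    by (simp add: sum.cartesian_product sum_distrib_left)
  also have "\<dots> = (\<Sum>(k, l)\<in>{(k, l). k + l < N}. ?g k l)"
  proof (rule sum.mono_neutral_right)
    have "k + l < N" if "e (l + k) \<noteq> 0" for k l
      using assms[of "l + k"] that by (metis add.commute not_le)
    then show "\<forall>i\<in>{..<N} \<times> {..<N} - {(k, l). k + l < N}. (case i of (k, l) \<Rightarrow> ?g k l) = 0"
      by auto
  qed auto
  also have "\<dots> = (\<Sum>m<N. \<Sum>k\<le>m. ?g k (m - k))"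
    by (rule sum.triangle_reindex)
  also have "\<dots> = (\<Sum>m<N. (s + t) ^ m / fact m * e m)"
  proof (rule sum.cong[OF refl])
    fix m
    have "(s + t) ^ m / fact m = (\<Sum>k\<le>m. s ^ k / fact k * (t ^ (m - k) / fact (m - k)))"
      unfolding binomial_ring sum_divide_distrib
      by (intro sum.cong) (auto simp: binomial_fact field_simps)
    then show "(\<Sum>k\<le>m. ?g k (m - k)) = (s + t) ^ m / fact m * e m"
      by (simp add: sum_distrib_right mult.assoc)
  qed
  finally show ?thesis .
qed

text \<open>Applying \<open>exp (t D)\<close> to the coordinate functions yields polynomials in
  \<open>t\<close> and \<open>y\<close>; a common \<open>N\<close> exists because there are finitely
  many coordinates.\<close>

lemma one_parameter_polynomial_flow:
  assumes "one_parameter_subgroup Y \<phi>"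
  shows "polynomial_flow Y \<phi>"
proof -
  obtain D where D: "locally_nilpotent_derivation Y D"
    and aut: "\<And>t. \<phi> t \<in> variety_aut Y"
    and exp: "\<And>t a y. a \<in> coordinate_ring Y \<Longrightarrow> y \<in> Y \<Longrightarrow> a (\<phi> t y) = (\<Sum>k. t ^ k / fact k * (D ^^ k) a y)"
    using assms unfolding one_parameter_subgroup_def by metis
  have Y: "\<phi> t y \<in> Y" if "y \<in> Y" for t y using aut[of t] that by (auto simp: variety_aut_def)
  have ring: "(D ^^ k) a \<in> coordinate_ring Y" if "a \<in> coordinate_ring Y" for a k
    using D that by (induction k) (auto simp: locally_nilpotent_derivation_def)
  define x where "x = (\<lambda>i z. if z \<in> Y then z \<bullet> i else 0)"
  have x: "x i \<in> coordinate_ring Y" for i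
    unfolding x_def by (intro coordinate_ringI real_polynomial_function.intros(1) bounded_linear_inner_left)
  have D0: "D (\<lambda>x. 0) = (\<lambda>x. 0)"
  proof -
    have "D (\<lambda>z. 0 * x 0 z) = (\<lambda>z. 0 * D (x 0) z)"
      using D x unfolding locally_nilpotent_derivation_def by blast
    then show ?thesis by simp
  qed
  have "\<forall>i. \<exists>n. (D ^^ n) (x i) = (\<lambda>x. 0)"
    using D x by (simp add: locally_nilpotent_derivation_def)
  then obtain n where n: "\<And>i. (D ^^ n i) (x i) = (\<lambda>x. 0)" by metis
  define N where "N = Max (n ` Basis)"
  have N: "(D ^^ m) (x i) = (\<lambda>x. 0)" if "i \<in> Basis" "N \<le> m" for i m
  proof -
    have "n i \<le> m" using that by (auto simp: N_def)
    then obtain l where "m = l + n i" by (metis add.commute le_Suc_ex)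
    moreover have "(D ^^ l) (\<lambda>x. 0) = (\<lambda>x. 0)" by (induction l) (auto simp: D0)
    ultimately show ?thesis by (simp add: funpow_add n)
  qed
  have exp': "a (\<phi> t y) = (\<Sum>k<N. t ^ k / fact k * (D ^^ k) a y)"
    if "a \<in> coordinate_ring Y" "y \<in> Y" "\<And>m. N \<le> m \<Longrightarrow> (D ^^ m) a = (\<lambda>x. 0)" for a t y
    unfolding exp[OF that(1,2)] by (rule suminf_finite) (auto simp: that(3))
  have coord: "\<phi> t y \<bullet> i = (\<Sum>k<N. t ^ k / fact k * (D ^^ k) (x i) y)" if "y \<in> Y" "i \<in> Basis" for t y i
    using exp'[OF x that(1) N[OF that(2)], of t] Y that by (simp add: x_def)
  have "\<forall>i k. \<exists>p. real_polynomial_function p \<and> (D ^^ k) (x i) = (\<lambda>z. if z \<in> Y then p z else 0)"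
    using ring[OF x] coordinate_ringE by metis
  then obtain p where p: "\<And>i k. real_polynomial_function (p i k)"
    "\<And>i k. (D ^^ k) (x i) = (\<lambda>z. if z \<in> Y then p i k z else 0)" by metis
  define P where "P = (\<lambda>z. \<Sum>i\<in>Basis. (\<Sum>k<N. fst z ^ k / fact k * p i k (snd z)) *\<^sub>R i)"
  have S: "polynomial_function (\<lambda>z. \<Sum>k<N. fst z ^ k / fact k * p i k (snd z))" for i
    unfolding real_polynomial_function_eq[symmetric]
    by (intro real_polynomial_function_sum real_polynomial_function.intros(4) finite_lessThan
      real_polynomial_function_divide real_polynomial_function_power
      real_polynomial_function.intros(1)[OF bounded_linear_fst]
      real_polynomial_function_comp[OF p(1)] polynomial_intros)
  have "polynomial_function P"
    unfolding P_def
    by (intro polynomial_function_sum[OF finite_Basis] polynomial_function_mult[OF S] polynomial_function_const)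
  moreover have "\<phi> t y = P (t, y)" if "y \<in> Y" for t y
    using that by (auto intro!: euclidean_eqI[of "\<phi> t y"] simp: P_def coord p(2))
  moreover have "\<phi> 0 y = y" if y: "y \<in> Y" for y
  proof (rule euclidean_eqI)
    fix i :: 'a assume i: "i \<in> Basis"
    have "x i (\<phi> 0 y) = x i y"
      unfolding exp[OF x y] using powser_zero[of "\<lambda>k. 1 / fact k * (D ^^ k) (x i) y"] by (simp add: mult.commute)
    then show "\<phi> 0 y \<bullet> i = y \<bullet> i" using y Y by (simp add: x_def)
  qed
  moreover have "\<phi> (s + t) y = \<phi> s (\<phi> t y)" if y: "y \<in> Y" for s t y
  proof (rule euclidean_eqI)
    fix i :: 'a assume i: "i \<in> Basis"
    have "(D ^^ k) (x i) (\<phi> t y) = (\<Sum>l<N. t ^ l / fact l * (D ^^ (l + k)) (x i) y)" for k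
    proof -
      have comp: "(D ^^ l) ((D ^^ k) (x i)) = (D ^^ (l + k)) (x i)" for l by (simp add: funpow_add)
      show ?thesis using exp'[OF ring[OF x] y, of k i t] by (simp add: comp N[OF i])
    qed
    then have "\<phi> s (\<phi> t y) \<bullet> i = (\<Sum>k<N. s ^ k / fact k * (\<Sum>l<N. t ^ l / fact l * (D ^^ (l + k)) (x i) y))"
      using coord[OF Y[OF y] i] by simp
    also have "\<dots> = (\<Sum>m<N. (s + t) ^ m / fact m * (D ^^ m) (x i) y)"
      by (rule exp_sum_add) (simp add: N[OF i])
    also have "\<dots> = \<phi> (s + t) y \<bullet> i" using coord[OF y i] by simp
    finally show "\<phi> (s + t) y \<bullet> i = \<phi> s (\<phi> t y) \<bullet> i" by simp
  qed
  moreover have "\<phi> t z = z" if "z \<notin> Y" for t z using aut[of t] that by (auto simp: variety_aut_def)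
  ultimately show ?thesis using Y unfolding polynomial_flow_def by blast
qed

lemma one_parameter_subgroup_iff: "one_parameter_subgroup Y \<phi> \<longleftrightarrow> polynomial_flow Y \<phi>"
  using polynomial_flow_one_parameter one_parameter_polynomial_flow by blast

section \<open>The group generated by the flows\<close>

lemma polynomial_flow_inverse:
  assumes "polynomial_flow Y \<phi>"
  shows "\<phi> (- t) (\<phi> t x) = x"
proof (cases "x \<in> Y")
  case True
  then have "\<phi> (- t + t) x = \<phi> (- t) (\<phi> t x)" "\<phi> 0 x = x"
    using assms unfolding polynomial_flow_def by blast+
  then show ?thesis by simp
qed (use assms in \<open>auto simp: polynomial_flow_def\<close>)

lemma SAut_id: "id \<in> SAut Y"
  using generate.one[of "aut_group Y"] by (auto simp: SAut_def aut_group_def)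

lemma SAut_flow: "polynomial_flow Y \<phi> \<Longrightarrow> \<phi> t \<in> SAut Y"
  unfolding SAut_def one_parameter_subgroup_iff by (rule generate.incl) blast

lemma SAut_comp: "g \<in> SAut Y \<Longrightarrow> h \<in> SAut Y \<Longrightarrow> g \<circ> h \<in> SAut Y"
  using generate.eng[of g "aut_group Y" _ h] by (simp add: SAut_def aut_group_def)

text \<open>The inverse of a flow at time \<open>t\<close> is the flow at time \<open>- t\<close>,
  so flows generate the group by composition alone. The inner claim is about
  \<open>g \<circ> h\<close> for all \<open>h\<close> with \<open>P h\<close>, since the products in
  \<open>generate\<close> need not have a single generator on the left.\<close>

lemma SAut_induct [consumes 1, case_names id flow]:
  assumes "g \<in> SAut Y" "P id"
    and step: "\<And>\<phi> t g. polynomial_flow Y \<phi> \<Longrightarrow> g \<in> SAut Y \<Longrightarrow> P g \<Longrightarrow> P (\<phi> t \<circ> g)"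
  shows "P g"
proof -
  have "g \<in> generate (aut_group Y) {\<phi> t | \<phi> t. one_parameter_subgroup Y \<phi>}"
    using assms(1) by (simp add: SAut_def)
  then have "\<forall>h\<in>SAut Y. P h \<longrightarrow> P (g \<circ> h)"
  proof (induction g rule: generate.induct)
    case one
    then show ?case by (simp add: aut_group_def)
  next
    case (incl k)
    then obtain \<phi> t where k: "k = \<phi> t" "polynomial_flow Y \<phi>"
      by (auto simp: one_parameter_subgroup_iff)
    show ?case unfolding k(1) using step[OF k(2)] by blast
  next
    case (inv k)
    then obtain \<phi> t where k: "k = \<phi> t" "polynomial_flow Y \<phi>"
      by (auto simp: one_parameter_subgroup_iff)
    have comp: "\<phi> t \<circ> \<phi> (- t) = id" "\<phi> (- t) \<circ> \<phi> t = id"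
      using polynomial_flow_inverse[OF k(2), of t] polynomial_flow_inverse[OF k(2), of "- t"] by auto
    have inv: "inv\<^bsub>aut_group Y\<^esub> k = \<phi> (- t)"
      unfolding m_inv_def
    proof (rule the_equality)
      show "\<phi> (- t) \<in> carrier (aut_group Y) \<and> k \<otimes>\<^bsub>aut_group Y\<^esub> \<phi> (- t) = \<one>\<^bsub>aut_group Y\<^esub> \<and>
          \<phi> (- t) \<otimes>\<^bsub>aut_group Y\<^esub> k = \<one>\<^bsub>aut_group Y\<^esub>"
        using polynomial_flow_variety_aut[OF k(2)] comp by (simp add: aut_group_def k(1))
      fix g assume "g \<in> carrier (aut_group Y) \<and> k \<otimes>\<^bsub>aut_group Y\<^esub> g = \<one>\<^bsub>aut_group Y\<^esub> \<and>
          g \<otimes>\<^bsub>aut_group Y\<^esub> k = \<one>\<^bsub>aut_group Y\<^esub>"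
      then have "g \<circ> \<phi> t = id" by (simp add: aut_group_def k(1))
      then have "g \<circ> (\<phi> t \<circ> \<phi> (- t)) = \<phi> (- t)" by (simp flip: comp_assoc)
      then show "g = \<phi> (- t)" by (simp add: comp)
    qed
    show ?case unfolding inv using step[OF k(2)] by blast
  next
    case (eng g k)
    have "k \<circ> h \<in> SAut Y" if "h \<in> SAut Y" for h
      by (rule SAut_comp[OF _ that]) (unfold SAut_def, rule eng.hyps(2))
    then have "P (g \<circ> (k \<circ> h))" if "h \<in> SAut Y" "P h" for h
      using eng.IH that by blast
    then show ?case by (simp add: aut_group_def o_def)
  qed
  then show ?thesis using assms(2) SAut_id by force
qed

lemma SAut_inverse:
  assumes "g \<in> SAut Y"
  obtains h where "h \<in> SAut Y" "\<And>x. h (g x) = x" "\<And>x. g (h x) = x"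
proof -
  have "\<exists>h\<in>SAut Y. (\<forall>x. h (g x) = x) \<and> (\<forall>x. g (h x) = x)"
    using assms
  proof (induction rule: SAut_induct)
    case id
    show ?case by (rule bexI[of _ id]) (simp_all add: SAut_id)
  next
    case (flow \<phi> t g)
    then obtain h where h: "h \<in> SAut Y" "\<forall>x. h (g x) = x" "\<forall>x. g (h x) = x" by blast
    show ?case
      by (rule bexI[of _ "h \<circ> \<phi> (- t)"])
        (use h polynomial_flow_inverse[OF flow(1), of t] polynomial_flow_inverse[OF flow(1), of "- t"]
          SAut_comp[OF h(1) SAut_flow[OF flow(1)]] in auto)
  qed
  then show ?thesis using that by blast
qed

lemma polynomial_flow_closed: "polynomial_flow Y \<phi> \<Longrightarrow> y \<in> Y \<Longrightarrow> \<phi> t y \<in> Y"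
  by (simp add: polynomial_flow_def)

lemma SAut_closed:
  assumes "g \<in> SAut Y" "y \<in> Y"
  shows "g y \<in> Y"
  using assms by (induction rule: SAut_induct) (auto intro: polynomial_flow_closed)

text \<open>Along \<open>\<phi>\<close>, the value \<open>f\<close> changes by
  \<open>s * R (s, y)\<close> with \<open>R\<close> polynomial. The factor \<open>u\<close> in the
  running time \<open>s = t * (u * q u)\<close> makes this change divisible by \<open>u\<close>, so
  \<open>v\<close> changes by the polynomial \<open>t * q u * R (s, y)\<close>. At
  \<open>u = 0\<close> the point \<open>y\<close> rests, and \<open>R (0, y)\<close> is the
  derivative of \<open>f\<close> along \<open>\<phi>\<close>.\<close>

lemma Susp_lift_flow:
  assumes \<phi>: "polynomial_flow Y \<phi>" and f: "f \<in> coordinate_ring Y" and q: "real_polynomial_function q"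
  obtains \<Phi> where "polynomial_flow (Susp Y f) \<Phi>"
    "\<And>t y u v. (y, u, v) \<in> Susp Y f \<Longrightarrow> u \<noteq> 0 \<Longrightarrow>
      \<Phi> t (y, u, v) = (\<phi> (t * (u * q u)) y, u, f (\<phi> (t * (u * q u)) y) / u)"
    "\<And>t y v. (y, 0, v) \<in> Susp Y f \<Longrightarrow> \<Phi> t (y, 0, v) = (y, 0, v + t * q 0 * flow_derivation Y \<phi> f y)"
proof -
  let ?X = "Susp Y f"
  have X: "(y, u, v) \<in> ?X \<longleftrightarrow> y \<in> Y \<and> u * v = f y" for y u v
    by (auto simp: Susp_def)
  obtain p where p: "real_polynomial_function p" "f = (\<lambda>x. if x \<in> Y then p x else 0)"
    using f by (rule coordinate_ringE)
  obtain P where P: "polynomial_function P" "\<And>t y. y \<in> Y \<Longrightarrow> \<phi> t y = P (t, y)"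
    using \<phi> by (auto simp: polynomial_flow_def)
  have \<phi>Y: "\<phi> t y \<in> Y" and \<phi>0: "\<phi> 0 y = y" and \<phi>_add: "\<phi> (s + t) y = \<phi> s (\<phi> t y)" if "y \<in> Y" for s t y
    using \<phi> that by (auto simp: polynomial_flow_def)
  obtain R where R: "real_polynomial_function R"
      "\<And>t y. p (P (t, y)) = p (P (0, y)) + t * R (t, y)"
    by (rule real_polynomial_function_factor[OF real_polynomial_function_comp[OF p(1) P(1)]]) (rule that)
  have fR: "f (\<phi> t y) = f y + t * R (t, y)" if "y \<in> Y" for t y
  proof -
    have "f (\<phi> t y) = p (P (t, y))" using P(2)[OF that, of t] \<phi>Y[OF that, of t] p(2) by simp
    moreover have "f y = p (P (0, y))" using P(2)[OF that, of 0] \<phi>0[OF that] that p(2) by simp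
    ultimately show ?thesis using R(2)[of t y] by simp
  qed
  have R0: "R (0, y) = flow_derivation Y \<phi> f y" if y: "y \<in> Y" for y
  proof -
    have "((\<lambda>t. R (t, y)) \<longlongrightarrow> R (0, y)) (at 0)"
      by (intro real_polynomial_function_tendsto[OF R(1)] tendsto_intros)
    then have "((\<lambda>t. (f (\<phi> (0 + t) y) - f (\<phi> 0 y)) / t) \<longlongrightarrow> R (0, y)) (at 0)"
      by (rule Lim_transform_eventually) (auto simp: eventually_at_filter fR[OF y])
    then have "((\<lambda>t. f (\<phi> t y)) has_field_derivative R (0, y)) (at 0)"
      unfolding DERIV_def .
    then show ?thesis
      using y by (simp add: flow_derivation_def DERIV_imp_deriv)
  qed
  define Q where "Q = (\<lambda>z :: real \<times> 'a \<times> real \<times> real. case z of (t, y, u, v) \<Rightarrow>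
    (P (t * (u * q u), y), u, v + t * q u * R (t * (u * q u), y)))"
  define \<Phi> where "\<Phi> = (\<lambda>t x. if x \<in> ?X then Q (t, x) else x)"
  have Q: "polynomial_function Q"
  proof -
    have q': "polynomial_function (\<lambda>z :: real \<times> 'a \<times> real \<times> real. q (fst (snd (snd z))))"
      by (rule polynomial_function_comp[OF q[unfolded real_polynomial_function_eq]]) (intro polynomial_intros)
    have T: "polynomial_function (\<lambda>z :: real \<times> 'a \<times> real \<times> real.
        (fst z * (fst (snd (snd z)) * q (fst (snd (snd z)))), fst (snd z)))"
      by (intro polynomial_function_Pair polynomial_function_times q' polynomial_function_fst
        polynomial_function_snd polynomial_function_id)
    have "polynomial_function (\<lambda>z :: real \<times> 'a \<times> real \<times> real.
      (P (fst z * (fst (snd (snd z)) * q (fst (snd (snd z)))), fst (snd z)), fst (snd (snd z)),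
       snd (snd (snd z)) + fst z * q (fst (snd (snd z))) *
         R (fst z * (fst (snd (snd z)) * q (fst (snd (snd z)))), fst (snd z))))"
      by (intro polynomial_function_Pair polynomial_function_add polynomial_function_times q'
        polynomial_function_comp[OF P(1) T]
        polynomial_function_comp[OF R(1)[unfolded real_polynomial_function_eq] T]
        polynomial_function_fst polynomial_function_snd polynomial_function_id)
    then show ?thesis by (simp add: Q_def case_prod_unfold)
  qed
  have QX: "Q (t, y, u, v) \<in> ?X" if "(y, u, v) \<in> ?X" for t y u v
    using that \<phi>Y[of y "t * (u * q u)"] P(2)[of y "t * (u * q u)"] fR[of y "t * (u * q u)"]
    by (auto simp: Q_def X algebra_simps)
  have \<Phi>_nonzero: "\<Phi> t (y, u, v) = (\<phi> (t * (u * q u)) y, u, f (\<phi> (t * (u * q u)) y) / u)"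
    if x: "(y, u, v) \<in> ?X" and "u \<noteq> 0" for t y u v
  proof -
    have "u * (v + t * q u * R (t * (u * q u), y)) = f (\<phi> (t * (u * q u)) y)"
      using x fR[of y "t * (u * q u)"] by (simp add: X algebra_simps)
    then have "v + t * q u * R (t * (u * q u), y) = f (\<phi> (t * (u * q u)) y) / u"
      using \<open>u \<noteq> 0\<close> by (simp add: field_simps)
    then show ?thesis using x P(2) by (simp add: \<Phi>_def Q_def X)
  qed
  have \<Phi>_zero: "\<Phi> t (y, 0, v) = (y, 0, v + t * q 0 * flow_derivation Y \<phi> f y)"
    if x: "(y, 0, v) \<in> ?X" for t y v
    using x P(2)[of y 0] \<phi>0 R0 by (simp add: \<Phi>_def Q_def X)
  have "polynomial_flow ?X \<Phi>"
    unfolding polynomial_flow_def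
  proof (intro conjI allI ballI impI exI[of _ Q] Q)
    show "\<Phi> t x = x" if "x \<notin> ?X" for t x using that by (simp add: \<Phi>_def)
    show "\<Phi> t x = Q (t, x)" if "x \<in> ?X" for t x using that by (simp add: \<Phi>_def)
    show "\<Phi> t x \<in> ?X" if "x \<in> ?X" for t x using that QX by (cases x) (simp add: \<Phi>_def)
    show "\<Phi> 0 x = x" if "x \<in> ?X" for x
    proof -
      obtain y u v where x: "x = (y, u, v)" by (cases x)
      show ?thesis
      proof (cases "u = 0")
        case True
        then show ?thesis using that \<Phi>_zero x by simp
      next
        case False
        then show ?thesis using that \<Phi>_nonzero x \<phi>0 by (auto simp: X field_simps)
      qed
    qed
    show "\<Phi> (s + t) x = \<Phi> s (\<Phi> t x)" if xX: "x \<in> ?X" for s t x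
    proof -
      obtain y u v where x: "x = (y, u, v)" by (cases x)
      have mem: "\<Phi> t x \<in> ?X" using xX QX x by (simp add: \<Phi>_def)
      show ?thesis
      proof (cases "u = 0")
        case True
        then have "\<Phi> t x = (y, 0, v + t * q 0 * flow_derivation Y \<phi> f y)" using \<Phi>_zero xX x by simp
        then show ?thesis using \<Phi>_zero xX x mem True by (simp add: algebra_simps)
      next
        case False
        then have "\<Phi> t x = (\<phi> (t * (u * q u)) y, u, f (\<phi> (t * (u * q u)) y) / u)"
          using \<Phi>_nonzero xX x by simp
        then show ?thesis using \<Phi>_nonzero xX x mem False \<phi>_add by (simp add: X algebra_simps)
      qed
    qed
  qed
  then show ?thesis using \<Phi>_nonzero \<Phi>_zero by (rule that)
qed

section \<open>The symmetry exchanging \<open>u\<close> and \<open>v\<close>\<close>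

definition swap_uv :: "'a \<times> real \<times> real \<Rightarrow> 'a \<times> real \<times> real" where
  "swap_uv x = (fst x, snd (snd x), fst (snd x))"

lemma swap_uv_simps [simp]:
  "swap_uv (y, u, v) = (y, v, u)" "swap_uv (swap_uv x) = x"
  by (simp_all add: swap_uv_def)

lemma swap_uv_Susp [simp]: "swap_uv x \<in> Susp A f \<longleftrightarrow> x \<in> Susp A f"
  by (cases x) (simp add: Susp_def mult.commute)

lemma polynomial_flow_swap:
  assumes "polynomial_flow (Susp Y f) \<Phi>"
  shows "polynomial_flow (Susp Y f) (\<lambda>t x. swap_uv (\<Phi> t (swap_uv x)))"
proof -
  obtain P where P: "polynomial_function P" "\<forall>t. \<forall>y\<in>Susp Y f. \<Phi> t y = P (t, y)"
    using assms by (auto simp: polynomial_flow_def)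
  have Q: "polynomial_function (\<lambda>z. P (fst z, swap_uv (snd z)))"
    unfolding swap_uv_def by (rule polynomial_function_comp[OF P(1)]) (intro polynomial_intros)
  have "polynomial_function (\<lambda>z. swap_uv (P (fst z, swap_uv (snd z))))"
    unfolding swap_uv_def[of "P _"] by (intro polynomial_intros Q)
  then show ?thesis
    using assms P(2) unfolding polynomial_flow_def
    by (intro conjI exI[of _ "\<lambda>z. swap_uv (P (fst z, swap_uv (snd z)))"]) (simp_all del: split_paired_All)
qed

lemma SAut_swap:
  assumes "g \<in> SAut (Susp Y f)"
  shows "(\<lambda>x. swap_uv (g (swap_uv x))) \<in> SAut (Susp Y f)"
  using assms
proof (induction rule: SAut_induct)
  case id
  then show ?case using SAut_id by (simp add: id_def)
next
  case (flow \<phi> t g)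
  from SAut_comp[OF SAut_flow[OF polynomial_flow_swap[OF flow(1)], of t] flow(3)]
  show ?case by (simp add: o_def)
qed

text \<open>
  For \<open>q u = 0\<close> the lift fixes the level \<open>u\<close> pointwise, so an interpolation
  polynomial makes \<open>SAut Y\<close> act on one level while the other given levels stay fixed.
\<close>

lemma Susp_level_move:
  assumes "g \<in> SAut Y" and f: "f \<in> coordinate_ring Y" and c: "c \<noteq> 0" and L: "finite L"
  shows "\<exists>G\<in>SAut (Susp Y f). (\<forall>y v. (y, c, v) \<in> Susp Y f \<longrightarrow> G (y, c, v) = (g y, c, f (g y) / c)) \<and>
    (\<forall>y u v. (y, u, v) \<in> Susp Y f \<longrightarrow> u \<in> L \<longrightarrow> u \<noteq> c \<longrightarrow> G (y, u, v) = (y, u, v))"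
  using assms(1)
proof (induction rule: SAut_induct)
  case id
  show ?case
    by (rule bexI[of _ id]) (use c in \<open>auto simp: Susp_def SAut_id field_simps\<close>)
next
  case (flow \<phi> t g)
  then obtain G where G: "G \<in> SAut (Susp Y f)"
    "\<And>y v. (y, c, v) \<in> Susp Y f \<Longrightarrow> G (y, c, v) = (g y, c, f (g y) / c)"
    "\<And>y u v. (y, u, v) \<in> Susp Y f \<Longrightarrow> u \<in> L \<Longrightarrow> u \<noteq> c \<Longrightarrow> G (y, u, v) = (y, u, v)"
    by blast
  \<comment> \<open>The factor \<open>t / c\<close> makes the lift at time 1 run
    \<open>\<phi>\<close> for time \<open>c * q c = t\<close> on the level \<open>c\<close>. The
    node 0 is included because the level \<open>u = 0\<close> would otherwise be translated in
    \<open>v\<close>.\<close>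
  define q where "q = (\<lambda>u. (t / c) * (\<Prod>l\<in>insert 0 L - {c}. (u - l) / (c - l)))"
  have q_poly: "real_polynomial_function q"
    unfolding q_def using L
    by (intro real_polynomial_function.intros(4) real_polynomial_function.intros(2)
      real_polynomial_function_prod real_polynomial_function_divide real_polynomial_function_diff
      real_polynomial_function.intros(1)[OF bounded_linear_ident]) auto
  have qc: "c * q c = t" using c by (auto simp: q_def)
  have q0: "q u = 0" if "u \<in> insert 0 L" "u \<noteq> c" for u
    unfolding q_def using that L by (auto simp: prod_zero_iff)
  obtain \<Phi> where \<Phi>: "polynomial_flow (Susp Y f) \<Phi>"
    "\<And>t y u v. (y, u, v) \<in> Susp Y f \<Longrightarrow> u \<noteq> 0 \<Longrightarrow>
      \<Phi> t (y, u, v) = (\<phi> (t * (u * q u)) y, u, f (\<phi> (t * (u * q u)) y) / u)"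
    "\<And>t y v. (y, 0, v) \<in> Susp Y f \<Longrightarrow> \<Phi> t (y, 0, v) = (y, 0, v + t * q 0 * flow_derivation Y \<phi> f y)"
    by (rule Susp_lift_flow[OF flow(1) f q_poly]) (rule that)
  have \<phi>0: "\<phi> 0 y = y" if "y \<in> Y" for y using flow(1) that by (simp add: polynomial_flow_def)
  show ?case
  proof (intro bexI[of _ "\<Phi> 1 \<circ> G"] conjI allI impI)
    fix y v assume x: "(y, c, v) \<in> Susp Y f"
    have "G (y, c, v) \<in> Susp Y f" using SAut_closed[OF G(1) x] .
    then show "(\<Phi> 1 \<circ> G) (y, c, v) = ((\<phi> t \<circ> g) y, c, f ((\<phi> t \<circ> g) y) / c)"
      using G(2)[OF x] \<Phi>(2)[OF _ c, of "g y" "f (g y) / c" 1] qc by simp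
  next
    fix y u v assume x: "(y, u, v) \<in> Susp Y f" and u: "u \<in> L" "u \<noteq> c"
    have y: "y \<in> Y" "u * v = f y" using x by (auto simp: Susp_def)
    show "(\<Phi> 1 \<circ> G) (y, u, v) = (y, u, v)"
    proof (cases "u = 0")
      case True
      then show ?thesis using G(3)[OF x u] \<Phi>(3)[of y v 1] x q0[of 0] c by simp
    next
      case False
      then show ?thesis using G(3)[OF x u] \<Phi>(2)[OF x False, of 1] q0[of u] u y \<phi>0[of y]
        by (simp add: field_simps)
    qed
  qed (rule SAut_comp[OF SAut_flow[OF \<Phi>(1)] G(1)])
qed

section \<open>Simultaneous moves of finitely many points along levels\<close>

lemma infinitely_transitive_on_family:
  assumes "infinitely_transitive_on G Z" "finite I" "I \<noteq> {}" "inj_on s I" "inj_on s' I"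
    "s ` I \<subseteq> Z" "s' ` I \<subseteq> Z"
  obtains g where "g \<in> G" "\<And>i. i \<in> I \<Longrightarrow> g (s i) = s' i"
proof -
  obtain xs where xs: "set xs = I" "distinct xs"
    using finite_distinct_list[OF assms(2)] by blast
  have "length xs \<ge> 1" using assms(3) xs(1) by (cases xs) auto
  moreover have "distinct (map s xs)" "distinct (map s' xs)"
    using xs assms(4,5) by (auto simp: distinct_map)
  ultimately obtain g where "g \<in> G" "map g (map s xs) = map s' xs"
    using assms(1,6,7) xs(1) unfolding infinitely_transitive_on_def
    by (metis length_map list.set_map)
  then show ?thesis using that xs(1) by (auto simp: map_eq_conv)
qed

text \<open>On a level \<open>u = c\<close> with \<open>c \<noteq> 0\<close>, the coordinate
  \<open>v\<close> is determined by \<open>y\<close>, so distinct points have distinct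
  \<open>y\<close> and one element of \<open>SAut Y\<close> moves them all to their targets.
  Different levels are treated one after another, hence targets have to be distinct only within a
  level.\<close>

lemma Susp_u_move:
  fixes y z :: "'i \<Rightarrow> 'a::euclidean_space"
  assumes f: "f \<in> coordinate_ring Y" and trans: "infinitely_transitive_on (SAut Y) Y1"
    and I: "finite I"
    and x: "\<And>i. i \<in> I \<Longrightarrow> (y i, u i, v i) \<in> Susp Y f" "\<And>i. i \<in> I \<Longrightarrow> y i \<in> Y1"
      "inj_on (\<lambda>i. (y i, u i, v i)) I"
    and z: "\<And>i. i \<in> I \<Longrightarrow> z i \<in> Y1"
      "\<And>i j. i \<in> I \<Longrightarrow> j \<in> I \<Longrightarrow> u i \<noteq> 0 \<Longrightarrow> u i = u j \<Longrightarrow> z i = z j \<Longrightarrow> i = j"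
  obtains G where "G \<in> SAut (Susp Y f)"
    "\<And>i. i \<in> I \<Longrightarrow> u i \<noteq> 0 \<Longrightarrow> G (y i, u i, v i) = (z i, u i, f (z i) / u i)"
    "\<And>i. i \<in> I \<Longrightarrow> u i = 0 \<Longrightarrow> G (y i, u i, v i) = (y i, u i, v i)"
proof -
  have "\<exists>G\<in>SAut (Susp Y f). \<forall>i\<in>I. G (y i, u i, v i) =
      (if u i \<in> C then (z i, u i, f (z i) / u i) else (y i, u i, v i))"
    if "finite C" "C \<subseteq> u ` I - {0}" for C
    using that
  proof (induction C rule: finite_induct)
    case empty
    then show ?case by (intro bexI[of _ id]) (auto simp: SAut_id)
  next
    case (insert c C)
    then obtain G where G: "G \<in> SAut (Susp Y f)" "\<And>i. i \<in> I \<Longrightarrow> G (y i, u i, v i) =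
      (if u i \<in> C then (z i, u i, f (z i) / u i) else (y i, u i, v i))" by auto
    have c: "c \<noteq> 0" using insert.prems by auto
    let ?J = "{i \<in> I. u i = c}"
    have "inj_on y ?J"
    proof (rule inj_onI)
      fix i j assume ij: "i \<in> ?J" "j \<in> ?J" "y i = y j"
      then have "c * v i = c * v j" using x(1)[of i] x(1)[of j] by (simp add: Susp_def)
      then have "v i = v j" using c by simp
      then show "i = j" using x(3) ij by (auto dest: inj_onD)
    qed
    moreover have "inj_on z ?J" using z(2) c by (intro inj_onI) auto
    ultimately obtain g where g: "g \<in> SAut Y" "\<And>i. i \<in> ?J \<Longrightarrow> g (y i) = z i"
      using infinitely_transitive_on_family[OF trans, of ?J y z] I insert.prems x(2) z(1) by auto
    obtain H where H: "H \<in> SAut (Susp Y f)"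
      "\<And>y v. (y, c, v) \<in> Susp Y f \<Longrightarrow> H (y, c, v) = (g y, c, f (g y) / c)"
      "\<And>y u' v. (y, u', v) \<in> Susp Y f \<Longrightarrow> u' \<in> u ` I \<Longrightarrow> u' \<noteq> c \<Longrightarrow> H (y, u', v) = (y, u', v)"
      using Susp_level_move[OF g(1) f c, of "u ` I"] I by blast
    show ?case
    proof (intro bexI[of _ "H \<circ> G"] ballI)
      fix i assume i: "i \<in> I"
      have mem: "G (y i, u i, v i) \<in> Susp Y f" using SAut_closed[OF G(1) x(1)[OF i]] .
      show "(H \<circ> G) (y i, u i, v i) =
          (if u i \<in> insert c C then (z i, u i, f (z i) / u i) else (y i, u i, v i))"
      proof (cases "u i = c")
        case True
        then have "G (y i, u i, v i) = (y i, c, v i)" using G(2)[OF i] insert.hyps by simp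
        then show ?thesis using H(2)[of "y i" "v i"] mem True g(2)[of i] i by simp
      next
        case False
        then show ?thesis
          using G(2)[OF i] mem i H(3)[of "y i" "u i" "v i"] H(3)[of "z i" "u i" "f (z i) / u i"] by auto
      qed
    qed (rule SAut_comp[OF H(1) G(1)])
  qed
  from this[of "u ` I - {0}"] I obtain G where "G \<in> SAut (Susp Y f)"
    "\<forall>i\<in>I. G (y i, u i, v i) = (if u i \<in> u ` I - {0} then (z i, u i, f (z i) / u i) else (y i, u i, v i))"
    by auto
  then show ?thesis by (intro that[of G]) auto
qed

lemma Susp_v_move:
  fixes y z :: "'i \<Rightarrow> 'a::euclidean_space"
  assumes f: "f \<in> coordinate_ring Y" and trans: "infinitely_transitive_on (SAut Y) Y1"
    and I: "finite I"
    and x: "\<And>i. i \<in> I \<Longrightarrow> (y i, u i, v i) \<in> Susp Y f" "\<And>i. i \<in> I \<Longrightarrow> y i \<in> Y1"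
      "inj_on (\<lambda>i. (y i, u i, v i)) I"
    and z: "\<And>i. i \<in> I \<Longrightarrow> z i \<in> Y1"
      "\<And>i j. i \<in> I \<Longrightarrow> j \<in> I \<Longrightarrow> v i \<noteq> 0 \<Longrightarrow> v i = v j \<Longrightarrow> z i = z j \<Longrightarrow> i = j"
  obtains G where "G \<in> SAut (Susp Y f)"
    "\<And>i. i \<in> I \<Longrightarrow> v i \<noteq> 0 \<Longrightarrow> G (y i, u i, v i) = (z i, f (z i) / v i, v i)"
    "\<And>i. i \<in> I \<Longrightarrow> v i = 0 \<Longrightarrow> G (y i, u i, v i) = (y i, u i, v i)"
proof -
  have 1: "(y i, v i, u i) \<in> Susp Y f" if "i \<in> I" for i
    using x(1)[OF that] by (simp add: Susp_def mult.commute)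
  have 2: "inj_on (\<lambda>i. (y i, v i, u i)) I"
    using x(3) by (auto simp: inj_on_def)
  show ?thesis
  proof (rule Susp_u_move[of f Y Y1 I y v u z, OF f trans I])
    fix G assume G: "G \<in> SAut (Susp Y f)"
      "\<And>i. i \<in> I \<Longrightarrow> v i \<noteq> 0 \<Longrightarrow> G (y i, v i, u i) = (z i, v i, f (z i) / v i)"
      "\<And>i. i \<in> I \<Longrightarrow> v i = 0 \<Longrightarrow> G (y i, v i, u i) = (y i, v i, u i)"
    show ?thesis
      by (rule that[OF SAut_swap[OF G(1)]]) (use G(2,3) in simp_all)
  qed (use 1 2 x(2) z in blast)+
qed

subsection \<open>Tangent vectors of orbits\<close>

definition orbit_tangents :: "'a::euclidean_space set \<Rightarrow> 'a \<Rightarrow> 'a set" where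
  "orbit_tangents Y y = {v. \<exists>\<phi>. polynomial_flow Y \<phi> \<and> ((\<lambda>t. \<phi> t y) has_vector_derivative v) (at 0)}"

lemma flexible_point_iff:
  "flexible_point Y y \<longleftrightarrow> y \<in> Y \<and> span (orbit_tangents Y y) = tangent_space Y y"
  by (simp add: flexible_point_def orbit_tangents_def one_parameter_subgroup_iff)

lemma polynomial_flow_tangent:
  assumes "polynomial_flow Y \<phi>" "y \<in> Y"
  obtains w where "((\<lambda>t. \<phi> t y) has_vector_derivative w) (at 0)"
proof -
  obtain P where P: "polynomial_function P" "\<And>t. \<phi> t y = P (t, y)"
    using assms by (auto simp: polynomial_flow_def)
  have "polynomial_function (\<lambda>t. \<phi> t y)"
    unfolding P(2) by (rule polynomial_function_comp[OF P(1)]) (intro polynomial_intros)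
  then obtain p' where "\<And>x. ((\<lambda>t. \<phi> t y) has_vector_derivative p' x) (at x)"
    using has_vector_derivative_polynomial_function by blast
  then show ?thesis using that by blast
qed

lemma polynomial_flow_continuous:
  assumes "polynomial_flow Y \<phi>" "y \<in> Y"
  shows "continuous_on S (\<lambda>t. \<phi> t y)"
proof -
  obtain P where P: "polynomial_function P" "\<And>t. \<phi> t y = P (t, y)"
    using assms by (auto simp: polynomial_flow_def)
  show ?thesis
    unfolding P(2) by (rule polynomial_function_continuous, rule polynomial_function_comp[OF P(1)])
      (intro polynomial_intros)
qed

lemma has_vector_derivative_polynomial_comp:
  fixes p :: "'a::euclidean_space \<Rightarrow> 'b::euclidean_space"
  assumes "polynomial_function p" "(g has_vector_derivative w) (at t)"
  shows "((\<lambda>s. p (g s)) has_vector_derivative frechet_derivative p (at (g t)) w) (at t)"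
proof -
  interpret bounded_linear "frechet_derivative p (at (g t))"
    by (rule has_derivative_bounded_linear[OF polynomial_function_has_derivative[OF assms(1)]])
  show ?thesis
    using has_derivative_compose[OF assms(2)[unfolded has_vector_derivative_def]
      polynomial_function_has_derivative[OF assms(1)]]
    by (simp add: has_vector_derivative_def scale)
qed

lemma tangent_space_subspace: "subspace (tangent_space Y y)"
proof -
  have lin: "linear (frechet_derivative p (at y))" if "p \<in> vanishing_ideal Y" for p
    using has_derivative_linear[OF real_polynomial_function_has_derivative[OF vanishing_ideal_poly[OF that]]] .
  show ?thesis
    unfolding subspace_def tangent_space_def
    using lin by (auto simp: linear_0 linear_add linear_cmul)
qed

lemma orbit_tangents_tangent:
  assumes "y \<in> Y"
  shows "orbit_tangents Y y \<subseteq> tangent_space Y y"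
proof
  fix w assume "w \<in> orbit_tangents Y y"
  then obtain \<phi> where \<phi>: "polynomial_flow Y \<phi>" "((\<lambda>t. \<phi> t y) has_vector_derivative w) (at 0)"
    by (auto simp: orbit_tangents_def)
  have \<phi>0: "\<phi> 0 y = y" using \<phi>(1) assms by (simp add: polynomial_flow_def)
  show "w \<in> tangent_space Y y"
    unfolding tangent_space_def
  proof (intro CollectI ballI)
    fix p assume p: "p \<in> vanishing_ideal Y"
    have "((\<lambda>t. p (\<phi> t y)) has_vector_derivative frechet_derivative p (at y) w) (at 0)"
      using has_vector_derivative_polynomial_comp[OF _ \<phi>(2), of p] vanishing_ideal_poly[OF p] \<phi>0
      by (simp add: real_polynomial_function_eq)
    moreover have "(\<lambda>t. p (\<phi> t y)) = (\<lambda>t. 0)"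
      using vanishing_ideal_zero[OF p polynomial_flow_closed[OF \<phi>(1) assms]] by simp
    ultimately show "frechet_derivative p (at y) w = 0"
      using vector_derivative_unique_at[OF _ has_vector_derivative_const] by metis
  qed
qed

lemma flexible_pointI:
  assumes "y \<in> Y" "tangent_space Y y \<subseteq> span (orbit_tangents Y y)"
  shows "flexible_point Y y"
  using assms span_minimal[OF orbit_tangents_tangent[OF assms(1)] tangent_space_subspace]
  by (auto simp: flexible_point_iff)

lemma flow_derivation_tangent:
  assumes \<phi>: "polynomial_flow Y \<phi>" and y: "y \<in> Y"
    and w: "((\<lambda>t. \<phi> t y) has_vector_derivative w) (at 0)"
    and p: "real_polynomial_function p" "\<And>y. y \<in> Y \<Longrightarrow> f y = p y"
  shows "flow_derivation Y \<phi> f y = frechet_derivative p (at y) w"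
    and "((\<lambda>t. f (\<phi> t y)) has_vector_derivative frechet_derivative p (at y) w) (at 0)"
proof -
  have "\<phi> 0 y = y" using \<phi> y by (simp add: polynomial_flow_def)
  moreover have "(\<lambda>t. f (\<phi> t y)) = (\<lambda>t. p (\<phi> t y))"
    using p(2) polynomial_flow_closed[OF \<phi> y] by simp
  ultimately show *: "((\<lambda>t. f (\<phi> t y)) has_vector_derivative frechet_derivative p (at y) w) (at 0)"
    using has_vector_derivative_polynomial_comp[OF _ w, of p] p(1) by (simp add: real_polynomial_function_eq)
  then have "((\<lambda>t. f (\<phi> t y)) has_field_derivative frechet_derivative p (at y) w) (at 0)"
    by (simp add: has_real_derivative_iff_has_vector_derivative)
  then show "flow_derivation Y \<phi> f y = frechet_derivative p (at y) w"
    using y by (simp add: flow_derivation_def DERIV_imp_deriv)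
qed

lemma polynomial_flow_conjugate:
  assumes \<psi>: "polynomial_flow Y \<psi>" and \<phi>: "polynomial_flow Y \<phi>"
  shows "polynomial_flow Y (\<lambda>s x. \<psi> t (\<phi> s (\<psi> (- t) x)))"
proof -
  obtain P Q where P: "polynomial_function P" "\<And>t y. y \<in> Y \<Longrightarrow> \<psi> t y = P (t, y)"
    and Q: "polynomial_function Q" "\<And>t y. y \<in> Y \<Longrightarrow> \<phi> t y = Q (t, y)"
    using assms by (auto simp: polynomial_flow_def)
  have inv: "\<psi> (- t) (\<psi> t x) = x" "\<psi> t (\<psi> (- t) x) = x" for x
    using polynomial_flow_inverse[OF \<psi>, of t x] polynomial_flow_inverse[OF \<psi>, of "- t" x] by simp_all
  have 1: "polynomial_function (\<lambda>z :: real \<times> 'a. P (- t, snd z))"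
    by (rule polynomial_function_comp[OF P(1)]) (intro polynomial_intros)
  have 2: "polynomial_function (\<lambda>z. Q (fst z, P (- t, snd z)))"
    by (rule polynomial_function_comp[OF Q(1)]) (intro polynomial_intros 1)
  have 3: "polynomial_function (\<lambda>z. P (t, Q (fst z, P (- t, snd z))))"
    by (rule polynomial_function_comp[OF P(1)]) (intro polynomial_intros 2)
  have eq: "\<psi> t (\<phi> s (\<psi> (- t) x)) = P (t, Q (s, P (- t, x)))" if "x \<in> Y" for s x
    using P(2) Q(2) polynomial_flow_closed[OF \<psi>] polynomial_flow_closed[OF \<phi>] that by metis
  show ?thesis
    unfolding polynomial_flow_def
  proof (intro conjI allI impI ballI)
    show "\<psi> t (\<phi> s (\<psi> (- t) x)) = x" if "x \<notin> Y" for s x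
      using \<psi> \<phi> that by (simp add: polynomial_flow_def)
    show "\<exists>R. polynomial_function R \<and> (\<forall>s. \<forall>x\<in>Y. \<psi> t (\<phi> s (\<psi> (- t) x)) = R (s, x))"
      using 3 eq by (intro exI[of _ "\<lambda>z. P (t, Q (fst z, P (- t, snd z)))"]) simp
    show "\<psi> t (\<phi> s (\<psi> (- t) x)) \<in> Y" if "x \<in> Y" for s x
      using polynomial_flow_closed[OF \<psi>] polynomial_flow_closed[OF \<phi>] that by blast
    fix x assume x: "x \<in> Y"
    have x': "\<psi> (- t) x \<in> Y" using polynomial_flow_closed[OF \<psi> x] .
    have \<phi>0: "\<phi> 0 (\<psi> (- t) x) = \<psi> (- t) x" using \<phi> x' unfolding polynomial_flow_def by blast
    show "\<psi> t (\<phi> 0 (\<psi> (- t) x)) = x" by (simp add: \<phi>0 inv)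
    fix s r
    have "\<phi> (s + r) (\<psi> (- t) x) = \<phi> s (\<phi> r (\<psi> (- t) x))"
      using \<phi> x' unfolding polynomial_flow_def by blast
    then show "\<psi> t (\<phi> (s + r) (\<psi> (- t) x)) = \<psi> t (\<phi> s (\<psi> (- t) (\<psi> t (\<phi> r (\<psi> (- t) x)))))"
      by (simp add: inv)
  qed
qed

text \<open>Conjugating a flow by \<open>\<psi> t\<close> transports its orbit through
  \<open>y\<close> to an orbit through \<open>\<psi> t y\<close>, so the differential of
  \<open>\<psi> t\<close> maps orbit tangents to orbit tangents. The inverse polynomial
  \<open>q\<close> brings tangent vectors back to \<open>y\<close>, where they are already
  spanned.\<close>

lemma flexible_point_flow:
  assumes \<psi>: "polynomial_flow Y \<psi>" and y: "flexible_point Y y"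
  shows "flexible_point Y (\<psi> t y)"
proof (rule flexible_pointI)
  have yY: "y \<in> Y" using y by (simp add: flexible_point_iff)
  then show y'Y: "\<psi> t y \<in> Y" by (rule polynomial_flow_closed[OF \<psi>])
  obtain P where P: "polynomial_function P" "\<And>t y. y \<in> Y \<Longrightarrow> \<psi> t y = P (t, y)"
    using \<psi> by (auto simp: polynomial_flow_def)
  define p where "p = (\<lambda>y. P (t, y))"
  define q where "q = (\<lambda>y. P (- t, y))"
  have pq: "polynomial_function p" "polynomial_function q"
    unfolding p_def q_def by (rule polynomial_function_comp[OF P(1)], intro polynomial_intros)+
  have inv: "\<psi> (- t) (\<psi> t x) = x" "\<psi> t (\<psi> (- t) x) = x" for x
    using polynomial_flow_inverse[OF \<psi>, of t x] polynomial_flow_inverse[OF \<psi>, of "- t" x] by simp_all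
  have p: "p z = \<psi> t z" and q: "q z = \<psi> (- t) z" if "z \<in> Y" for z
    using P(2)[OF that] by (simp_all add: p_def q_def)
  have qY: "q ` Y \<subseteq> Y" using q polynomial_flow_closed[OF \<psi>] by auto
  have qy: "q (\<psi> t y) = y" using q[OF y'Y] inv by simp
  let ?dp = "frechet_derivative p (at y)" and ?dq = "frechet_derivative q (at (\<psi> t y))"
  have dp_lin: "linear ?dp" using has_derivative_linear[OF polynomial_function_has_derivative[OF pq(1)]] .
  have dp: "?dp v \<in> orbit_tangents Y (\<psi> t y)" if "v \<in> orbit_tangents Y y" for v
  proof -
    obtain \<phi> where \<phi>: "polynomial_flow Y \<phi>" "((\<lambda>t. \<phi> t y) has_vector_derivative v) (at 0)"
      using \<open>v \<in> orbit_tangents Y y\<close> by (auto simp: orbit_tangents_def)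
    have "\<phi> 0 y = y" using \<phi>(1) yY by (simp add: polynomial_flow_def)
    then have "((\<lambda>s. p (\<phi> s y)) has_vector_derivative ?dp v) (at 0)"
      using has_vector_derivative_polynomial_comp[OF pq(1) \<phi>(2)] by simp
    moreover have "(\<lambda>s. p (\<phi> s y)) = (\<lambda>s. \<psi> t (\<phi> s (\<psi> (- t) (\<psi> t y))))"
      using p polynomial_flow_closed[OF \<phi>(1) yY] inv by simp
    ultimately show ?thesis
      using polynomial_flow_conjugate[OF \<psi> \<phi>(1), of t] unfolding orbit_tangents_def by auto
  qed
  show "tangent_space Y (\<psi> t y) \<subseteq> span (orbit_tangents Y (\<psi> t y))"
  proof
    fix w assume w: "w \<in> tangent_space Y (\<psi> t y)"
    have "?dq w \<in> tangent_space Y y"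
      unfolding tangent_space_def
    proof (intro CollectI ballI)
      fix F assume F: "F \<in> vanishing_ideal Y"
      then have "(\<lambda>x. F (q x)) \<in> vanishing_ideal Y"
        by (rule vanishing_ideal_compose[OF _ pq(2) qY])
      then have "frechet_derivative (\<lambda>x. F (q x)) (at (\<psi> t y)) w = 0"
        using w by (simp add: tangent_space_def)
      then show "frechet_derivative F (at y) (?dq w) = 0"
        using frechet_derivative_comp[OF vanishing_ideal_poly[OF F] pq(2), of "\<psi> t y" w] qy by simp
    qed
    then have "?dq w \<in> span (orbit_tangents Y y)" using y by (simp add: flexible_point_iff)
    then have "?dp (?dq w) \<in> span (?dp ` orbit_tangents Y y)"
      using linear_span_image[OF dp_lin] by blast
    moreover have "span (?dp ` orbit_tangents Y y) \<subseteq> span (orbit_tangents Y (\<psi> t y))"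
      using dp by (intro span_mono) auto
    \<comment> \<open>The polynomials \<open>p\<close> and \<open>q\<close> are inverse on
      \<open>Y\<close> only, so their differentials are inverse only on tangent vectors. This is
      tested on the coordinates of \<open>z - p (q z)\<close>, which vanish on
      \<open>Y\<close>.\<close>
    moreover have "?dp (?dq w) = w"
    proof (rule euclidean_eqI)
      fix i :: 'a assume "i \<in> Basis"
      define e where "e = (\<lambda>z. (z - p (q z)) \<bullet> i)"
      have "polynomial_function e"
        unfolding e_def
        by (intro polynomial_function_inner polynomial_function_diff polynomial_function_id
          polynomial_function_comp[OF pq])
      moreover have "e z = 0" if "z \<in> Y" for z
      proof -
        have "q z \<in> Y" using qY that by blast
        then show ?thesis using p[of "q z"] q[OF that] inv by (simp add: e_def)
      qed
      ultimately have "e \<in> vanishing_ideal Y" by (simp add: vanishing_ideal_def real_polynomial_function_eq)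
      then have "frechet_derivative e (at (\<psi> t y)) w = 0" using w by (simp add: tangent_space_def)
      moreover have D: "(e has_derivative (\<lambda>v. (v - ?dp (?dq v)) \<bullet> i)) (at (\<psi> t y))"
      proof -
        have "((\<lambda>z. p (q z)) has_derivative (\<lambda>v. ?dp (?dq v))) (at (\<psi> t y))"
          using has_derivative_compose[OF polynomial_function_has_derivative[OF pq(2)]
            polynomial_function_has_derivative[OF pq(1)]] qy by metis
        then show ?thesis
          unfolding e_def by (intro has_derivative_inner_left has_derivative_diff has_derivative_ident)
      qed
      ultimately show "?dp (?dq w) \<bullet> i = w \<bullet> i"
        by (simp add: frechet_derivative_at[OF D, symmetric] inner_diff_left)
    qed
    ultimately show "w \<in> span (orbit_tangents Y (\<psi> t y))" by auto
  qed
qed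

lemma flexible_point_SAut:
  assumes "g \<in> SAut Y" "flexible_point Y y"
  shows "flexible_point Y (g y)"
  using assms by (induction rule: SAut_induct) (auto intro: flexible_point_flow)

text \<open>The lift with constant \<open>q = 1\<close> moves \<open>y\<close> with velocity
  \<open>u *\<^sub>R w\<close> and \<open>v\<close> with the derivative of \<open>f\<close> along
  \<open>w\<close>. The formula stays valid at \<open>u = 0\<close>, where the lift is the
  translation of \<open>v\<close>.\<close>

lemma Susp_orbit_tangent_u:
  assumes \<phi>: "polynomial_flow Y \<phi>" and f: "f \<in> coordinate_ring Y"
    and p: "real_polynomial_function p" "\<And>y. y \<in> Y \<Longrightarrow> f y = p y"
    and x: "(y, u, v) \<in> Susp Y f" and w: "((\<lambda>t. \<phi> t y) has_vector_derivative w) (at 0)"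
  shows "(u *\<^sub>R w, 0, frechet_derivative p (at y) w) \<in> orbit_tangents (Susp Y f) (y, u, v)"
proof -
  have y: "y \<in> Y" "u * v = f y" using x by (auto simp: Susp_def)
  let ?d = "frechet_derivative p (at y) w"
  obtain \<Phi> where \<Phi>: "polynomial_flow (Susp Y f) \<Phi>"
    "\<And>t y u v. (y, u, v) \<in> Susp Y f \<Longrightarrow> u \<noteq> 0 \<Longrightarrow>
      \<Phi> t (y, u, v) = (\<phi> (t * (u * 1)) y, u, f (\<phi> (t * (u * 1)) y) / u)"
    "\<And>t y v. (y, 0, v) \<in> Susp Y f \<Longrightarrow> \<Phi> t (y, 0, v) = (y, 0, v + t * 1 * flow_derivation Y \<phi> f y)"
    by (rule Susp_lift_flow[OF \<phi> f, of "\<lambda>u. 1"]) (simp, rule that)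
  note fd = flow_derivation_tangent[OF \<phi> y(1) w p]
  have pair: "((\<lambda>t. (a t, b t, c t)) has_vector_derivative (a', b', c')) (at 0)"
    if "(a has_vector_derivative a') (at 0)" "(b has_vector_derivative b') (at 0)" "(c has_vector_derivative c') (at 0)"
    for a :: "real \<Rightarrow> 'a" and b c :: "real \<Rightarrow> real" and a' b' c'
    using that unfolding has_vector_derivative_def
    by (simp add: has_derivative_Pair)
  have "((\<lambda>t. \<Phi> t (y, u, v)) has_vector_derivative (u *\<^sub>R w, 0, ?d)) (at 0)"
  proof (cases "u = 0")
    case True
    have "((\<lambda>t. v + t * ?d) has_vector_derivative ?d) (at 0)"
      by (auto intro!: derivative_eq_intros simp: has_real_derivative_iff_has_vector_derivative[symmetric])
    then have "((\<lambda>t. (y, 0::real, v + t * ?d)) has_vector_derivative (0, 0, ?d)) (at 0)"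
      by (intro pair has_vector_derivative_const)
    then show ?thesis using \<Phi>(3)[of y v] x True fd(1) by simp
  next
    case False
    have lin: "((\<lambda>t. t * u) has_vector_derivative u) (at 0)"
      by (auto intro!: derivative_eq_intros simp: has_real_derivative_iff_has_vector_derivative[symmetric])
    have 1: "((\<lambda>t. \<phi> (t * u) y) has_vector_derivative u *\<^sub>R w) (at 0)"
      using vector_diff_chain_at[OF lin, of "\<lambda>t. \<phi> t y" w] w by (simp add: o_def)
    have "((\<lambda>t. f (\<phi> (t * u) y)) has_vector_derivative u *\<^sub>R ?d) (at 0)"
      using vector_diff_chain_at[OF lin, of "\<lambda>t. f (\<phi> t y)" ?d] fd(2) by (simp add: o_def)
    then have "((\<lambda>t. f (\<phi> (t * u) y) / u) has_vector_derivative u *\<^sub>R ?d / u) (at 0)"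
      by (rule has_vector_derivative_divide)
    then have 2: "((\<lambda>t. f (\<phi> (t * u) y) / u) has_vector_derivative ?d) (at 0)" using False by simp
    have "((\<lambda>t. (\<phi> (t * u) y, u, f (\<phi> (t * u) y) / u)) has_vector_derivative (u *\<^sub>R w, 0, ?d)) (at 0)"
      by (intro pair 1 2 has_vector_derivative_const)
    then show ?thesis using \<Phi>(2)[OF x False] by simp
  qed
  then show ?thesis using \<Phi>(1) by (auto simp: orbit_tangents_def)
qed

lemma orbit_tangents_swap:
  assumes "w \<in> orbit_tangents (Susp Y f) x"
  shows "swap_uv w \<in> orbit_tangents (Susp Y f) (swap_uv x)"
proof -
  obtain \<phi> where \<phi>: "polynomial_flow (Susp Y f) \<phi>" "((\<lambda>t. \<phi> t x) has_vector_derivative w) (at 0)"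
    using assms by (auto simp: orbit_tangents_def)
  have "bounded_linear (swap_uv :: 'a \<times> real \<times> real \<Rightarrow> _)"
    unfolding swap_uv_def
    by (intro bounded_linear_Pair bounded_linear_fst bounded_linear_compose[OF bounded_linear_fst bounded_linear_snd]
      bounded_linear_compose[OF bounded_linear_snd bounded_linear_snd])
  then have "((\<lambda>t. swap_uv (\<phi> t (swap_uv (swap_uv x)))) has_vector_derivative swap_uv w) (at 0)"
    using bounded_linear.has_vector_derivative \<phi>(2) by force
  then show ?thesis
    unfolding orbit_tangents_def using polynomial_flow_swap[OF \<phi>(1)] by auto
qed

text \<open>A multiple of the velocity \<open>(v *\<^sub>R w0, ?dp w0, 0)\<close> of a lift along a
  level of \<open>v\<close> cancels the \<open>u\<close>-component of a tangent vector. The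
  remaining vector satisfies the equation \<open>u * b = ?dp w\<close>, so it comes from
  \<open>w / u\<close> by the linear map \<open>l\<close>, which sends velocities of flows on
  \<open>Y\<close> to velocities of their lifts.\<close>

lemma Susp_flexible_point:
  assumes f: "f \<in> coordinate_ring Y"
    and p: "real_polynomial_function p" "\<And>y. y \<in> Y \<Longrightarrow> f y = p y"
    and x: "(y, u, v) \<in> Susp Y f" and u: "u \<noteq> 0" and y: "flexible_point Y y"
    and \<phi>: "polynomial_flow Y \<phi>" "flow_derivation Y \<phi> f y \<noteq> 0"
  shows "flexible_point (Susp Y f) (y, u, v)"
proof (rule flexible_pointI[OF x])
  have yY: "y \<in> Y" using x by (auto simp: Susp_def)
  let ?S = "orbit_tangents (Susp Y f) (y, u, v)" and ?dp = "frechet_derivative p (at y)"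
  have dp: "linear ?dp" using has_derivative_linear[OF real_polynomial_function_has_derivative[OF p(1)]] .
  obtain w0 where w0: "((\<lambda>t. \<phi> t y) has_vector_derivative w0) (at 0)"
    by (rule polynomial_flow_tangent[OF \<phi>(1) yY])
  have d0: "?dp w0 \<noteq> 0" using flow_derivation_tangent(1)[OF \<phi>(1) yY w0 p] \<phi>(2) by simp
  have "(y, v, u) \<in> Susp Y f" using x by (simp add: Susp_def mult.commute)
  from orbit_tangents_swap[OF Susp_orbit_tangent_u[OF \<phi>(1) f p this w0]]
  have V: "(v *\<^sub>R w0, ?dp w0, 0) \<in> ?S" by simp
  define l where "l = (\<lambda>w. (u *\<^sub>R w, 0 :: real, ?dp w))"
  have l: "linear l"
    unfolding l_def by (rule linearI) (auto simp: linear_add[OF dp] linear_cmul[OF dp] algebra_simps)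
  have "l ` orbit_tangents Y y \<subseteq> ?S"
    using Susp_orbit_tangent_u[OF _ f p x] by (auto simp: orbit_tangents_def[of Y] l_def)
  then have U: "l w \<in> span ?S" if "w \<in> tangent_space Y y" for w
    using that y linear_span_image[OF l, of "orbit_tangents Y y"] span_mono[of "l ` orbit_tangents Y y" ?S]
    by (auto simp: flexible_point_iff)
  show "tangent_space (Susp Y f) (y, u, v) \<subseteq> span ?S"
  proof
    fix x' assume x': "x' \<in> tangent_space (Susp Y f) (y, u, v)"
    obtain w a b where abw: "x' = (w, a, b)" by (cases x')
    define z where "z = x' - (a / ?dp w0) *\<^sub>R (v *\<^sub>R w0, ?dp w0, 0)"
    have VT: "(v *\<^sub>R w0, ?dp w0, 0) \<in> tangent_space (Susp Y f) (y, u, v)"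
      using V orbit_tangents_tangent[OF x] by blast
    have "z \<in> tangent_space (Susp Y f) (y, u, v)"
      unfolding z_def by (intro subspace_diff subspace_scale tangent_space_subspace VT x')
    moreover have z: "z = (w - (a / ?dp w0 * v) *\<^sub>R w0, 0, b)" (is "z = (?w, _, _)")
      using d0 by (simp add: z_def abw)
    ultimately have T: "?w \<in> tangent_space Y y" "u * b + v * 0 = ?dp ?w"
      using Susp_tangent_space[OF p, where w = ?w and a = 0 and b = b and y = y and u = u and v = v] by simp_all
    have "z = l ((1 / u) *\<^sub>R ?w)"
      using u T(2) by (simp add: z l_def linear_cmul[OF dp] del: scaleR_scaleR) (simp add: field_simps)
    moreover have "(1 / u) *\<^sub>R ?w \<in> tangent_space Y y"
      by (intro subspace_scale tangent_space_subspace T(1))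
    ultimately have "z \<in> span ?S" using U by simp
    then have "z + (a / ?dp w0) *\<^sub>R (v *\<^sub>R w0, ?dp w0, 0) \<in> span ?S"
      by (intro span_add span_scale[OF span_base[OF V]])
    then show "x' \<in> span ?S" by (simp add: z_def)
  qed
qed

subsection \<open>Transitivity\<close>

text \<open>Greedy choice: the earlier elements and their keys exclude only finitely many
  candidates, as \<open>k j\<close> is injective on \<open>A j\<close>. In the application the
  elements are values of \<open>f\<close> and the keys are levels of \<open>v\<close>.\<close>

lemma infinite_choice_inj:
  assumes "finite I" "\<And>i. i \<in> I \<Longrightarrow> infinite (A i)" "\<And>i. i \<in> I \<Longrightarrow> inj_on (k i) (A i)"
  shows "\<exists>s. (\<forall>i\<in>I. s i \<in> A i) \<and> inj_on s I \<and> inj_on (\<lambda>i. k i (s i)) I"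
  using assms
proof (induction I rule: finite_induct)
  case empty
  then show ?case by simp
next
  case (insert j I)
  then obtain s where s: "\<forall>i\<in>I. s i \<in> A i" "inj_on s I" "inj_on (\<lambda>i. k i (s i)) I" by auto
  define F where "F = s ` I \<union> (k j -` (\<lambda>i. k i (s i)) ` I \<inter> A j)"
  have "finite F"
    unfolding F_def using insert.hyps(1) insert.prems(2)[of j] by (intro finite_UnI finite_imageI finite_vimage_IntI) auto
  then have "infinite (A j - F)" using insert.prems(1)[of j] by (intro Diff_infinite_finite) auto
  then have "A j - F \<noteq> {}" by (rule infinite_imp_nonempty)
  then obtain a where a: "a \<in> A j" "a \<notin> s ` I" "k j a \<notin> (\<lambda>i. k i (s i)) ` I"
    unfolding F_def by blast
  define t where "t = s(j := a)"
  have t: "t j = a" "\<And>i. i \<in> I \<Longrightarrow> t i = s i"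
    using insert.hyps(2) by (auto simp: t_def)
  have "inj_on t I \<longleftrightarrow> inj_on s I" "inj_on (\<lambda>i. k i (t i)) I \<longleftrightarrow> inj_on (\<lambda>i. k i (s i)) I"
    by (rule inj_on_cong, simp add: t)+
  moreover have "t ` (I - {j}) \<subseteq> s ` I" "(\<lambda>i. k i (t i)) ` (I - {j}) \<subseteq> (\<lambda>i. k i (s i)) ` I"
    by (auto simp: t(2))
  ultimately have "inj_on t (insert j I)" "inj_on (\<lambda>i. k i (t i)) (insert j I)"
    unfolding inj_on_insert t(1) using a(2,3) s(2,3) by blast+
  moreover have "\<forall>i\<in>insert j I. t i \<in> A i" using a(1) s(1) t by simp
  ultimately show ?case by blast
qed

text \<open>The function \<open>f\<close> is extended by 0 outside \<open>Y\<close>; the polynomial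
  representative \<open>p\<close> is carried along so that differentials make sense.\<close>

locale flexible_suspension =
  fixes Y Y1 :: "'a::euclidean_space set" and f p :: "'a \<Rightarrow> real" and X1 :: "('a \<times> real \<times> real) set"
  assumes f: "f \<in> coordinate_ring Y"
    and p: "real_polynomial_function p" "\<And>y. y \<in> Y \<Longrightarrow> f y = p y"
    and Y1: "Y1 \<in> components (smooth_locus Y)"
    and flex: "flexible_on Y Y1"
    and trans: "infinitely_transitive_on (SAut Y) Y1"
    and nonconst: "\<not> f constant_on Y1"
    and X1: "X1 \<in> components (Susp Y1 f \<inter> smooth_locus (Susp Y f))"
begin

abbreviation X where "X \<equiv> Susp Y f"

lemma Y1_subset: "Y1 \<subseteq> Y"
  using in_components_subset[OF Y1] by (auto simp: smooth_locus_def smooth_point_def)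

lemma X1D:
  assumes "(y, u, v) \<in> X1"
  shows "y \<in> Y1" "(y, u, v) \<in> X" "u * v = f y" "smooth_point X (y, u, v)"
  using in_components_subset[OF X1] assms Y1_subset by (auto simp: Susp_def smooth_locus_def)

text \<open>An orbit is a connected curve of smooth points. Maximality of components is used twice:
  its projection stays in \<open>Y1\<close>, and then the orbit itself stays in
  \<open>X1\<close>.\<close>

lemma flow_X1:
  assumes \<Phi>: "polynomial_flow X \<Phi>" and x: "x \<in> X1"
  shows "\<Phi> t x \<in> X1"
proof -
  have xX: "x \<in> X" and x_smooth: "smooth_point X x" and xY: "fst x \<in> Y1"
    using X1D[of "fst x" "fst (snd x)" "snd (snd x)"] x by simp_all
  let ?C = "range (\<lambda>s. \<Phi> s x)"
  have \<Phi>0: "\<Phi> 0 x = x" using \<Phi> xX unfolding polynomial_flow_def by blast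
  have xC: "x \<in> ?C" using \<Phi>0 by (metis rangeI)
  have C: "connected ?C"
    by (intro connected_continuous_image polynomial_flow_continuous[OF \<Phi> xX] connected_UNIV)
  have smooth: "?C \<subseteq> smooth_locus X"
    using variety_aut_smooth_point[OF polynomial_flow_variety_aut[OF \<Phi>] x_smooth]
    by (auto simp: smooth_locus_def)
  have "fst ` ?C \<subseteq> Y1"
  proof (rule components_maximal[OF Y1])
    show "connected (fst ` ?C)"
      by (intro connected_continuous_image C continuous_on_fst continuous_on_id)
    show "fst ` ?C \<subseteq> smooth_locus Y"
    proof
      fix y assume "y \<in> fst ` ?C"
      then obtain z where z: "z \<in> ?C" "y = fst z" by blast
      then have "smooth_point X (y, snd z)" using smooth by (auto simp: smooth_locus_def)
      then show "y \<in> smooth_locus Y"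
        using Susp_smooth_base[OF p, where y = y and u = "fst (snd z)" and v = "snd (snd z)"] by (simp add: smooth_locus_def)
    qed
    show "Y1 \<inter> fst ` ?C \<noteq> {}" using xC xY by blast
  qed
  moreover have "?C \<subseteq> X" using polynomial_flow_closed[OF \<Phi> xX] by blast
  moreover have "z \<in> Susp Y1 f" if "fst z \<in> Y1" "z \<in> X" for z
    using that by (cases z) (simp add: Susp_def)
  ultimately have "?C \<subseteq> Susp Y1 f \<inter> smooth_locus X"
    using smooth by (simp add: image_subset_iff)
  then have "?C \<subseteq> X1"
    by (rule components_maximal[OF X1 C]) (use x xC in blast)
  then show ?thesis by blast
qed

lemma SAut_X1: "g \<in> SAut X \<Longrightarrow> x \<in> X1 \<Longrightarrow> g x \<in> X1"
  by (induction rule: SAut_induct) (auto intro: flow_X1)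

lemma SAut_X1_image:
  assumes "g \<in> SAut X"
  shows "g ` X1 = X1"
proof -
  obtain h where h: "h \<in> SAut X" "\<And>x. h (g x) = x" "\<And>x. g (h x) = x" by (rule SAut_inverse[OF assms]) (rule that)
  have "x \<in> g ` X1" if "x \<in> X1" for x
    using SAut_X1[OF h(1) that] by (metis h(3) image_eqI)
  then show ?thesis using SAut_X1[OF assms] by blast
qed

section \<open>Values of \<open>f\<close> on \<open>Y1\<close>, and flows that change
  \<open>f\<close>\<close>

lemma connected_f_image: "connected (f ` Y1)"
proof -
  have "continuous_on Y1 f \<longleftrightarrow> continuous_on Y1 p"
    using p(2) Y1_subset by (intro continuous_on_cong) auto
  then have "continuous_on Y1 f"
    using polynomial_function_continuous p(1) by (auto simp: real_polynomial_function_eq)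
  then show ?thesis
    using connected_continuous_image in_components_connected[OF Y1] by blast
qed

lemma f_image_interval:
  obtains a b where "a < b" "{a..b} \<subseteq> f ` Y1"
proof -
  obtain y z where yz: "y \<in> Y1" "z \<in> Y1" "f y \<noteq> f z"
    using nonconst unfolding constant_on_def by metis
  have "\<exists>a\<in>f ` Y1. \<exists>b\<in>f ` Y1. a < b" using yz by (metis imageI linorder_neqE)
  then show ?thesis using that connected_contains_Icc[OF connected_f_image] by blast
qed

lemma f_image_interval_zero:
  assumes "y \<in> Y1" "z \<in> Y1" "f y < 0" "0 < f z"
  shows "{f y..f z} \<subseteq> f ` Y1"
  using connected_contains_Icc[OF connected_f_image] assms by blast

lemma infinite_f_nonzero: "infinite (f ` Y1 - {0})"
proof -
  obtain a b where "a < b" "{a..b} \<subseteq> f ` Y1" by (rule f_image_interval)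
  then have "infinite (f ` Y1)" using infinite_Icc[of a b] finite_subset by blast
  then show ?thesis by (simp add: Diff_infinite_finite)
qed

lemma flow_Y1:
  assumes "polynomial_flow Y \<phi>" "y \<in> Y1"
  shows "\<phi> t y \<in> Y1"
  using trans SAut_flow[OF assms(1), of t] assms(2) unfolding infinitely_transitive_on_def by blast

text \<open>Otherwise \<open>f\<close> would be constant along all flows, hence invariant under
  \<open>SAut Y\<close>, and transitivity would make it constant on \<open>Y1\<close>.\<close>

lemma exists_transversal_flow:
  obtains \<phi> y where "polynomial_flow Y \<phi>" "y \<in> Y1" "flow_derivation Y \<phi> f y \<noteq> 0"
proof -
  have False if zero: "\<And>\<phi> y. polynomial_flow Y \<phi> \<Longrightarrow> y \<in> Y1 \<Longrightarrow> flow_derivation Y \<phi> f y = 0"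
  proof -
    have flow: "f (\<phi> t y) = f y" if "polynomial_flow Y \<phi>" "y \<in> Y1" for \<phi> t y
    proof -
      have y: "y \<in> Y" using that Y1_subset by blast
      have "((\<lambda>t. f (\<phi> t y)) has_field_derivative 0) (at t)" for t
        using flow_has_derivative[OF that(1) f y, of t] zero[OF that(1) flow_Y1[OF that]] by simp
      then have "f (\<phi> t y) = f (\<phi> 0 y)"
        by (rule DERIV_isconst_all[OF allI])
      then show ?thesis using that(1) y by (simp add: polynomial_flow_def)
    qed
    have inv: "g y \<in> Y1 \<and> f (g y) = f y" if "g \<in> SAut Y" "y \<in> Y1" for g y
      using that by (induction rule: SAut_induct) (auto simp: flow flow_Y1)
    have "f y = f z" if yz: "y \<in> Y1" "z \<in> Y1" for y z
    proof -
      obtain g where "g \<in> SAut Y" "g y = z"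
        using infinitely_transitive_on_family[OF trans, of "{0::nat}" "\<lambda>_. y" "\<lambda>_. z"] yz by auto
      then show ?thesis using inv yz by metis
    qed
    then show False using nonconst unfolding constant_on_def by blast
  qed
  then show ?thesis using that by blast
qed

text \<open>Smoothness of the crossing point gives a tangent vector on which the differential of
  \<open>f\<close> is nonzero. By flexibility this vector is a combination of orbit tangents, so one
  of them is not annihilated either.\<close>

lemma origin_transversal_flow:
  assumes "(y, 0, 0) \<in> X1"
  obtains \<phi> where "polynomial_flow Y \<phi>" "flow_derivation Y \<phi> f y \<noteq> 0"
proof -
  have y: "y \<in> Y1" "y \<in> Y" using X1D(1)[OF assms] Y1_subset by auto
  obtain v where v: "v \<in> tangent_space Y y" "frechet_derivative p (at y) v \<noteq> 0"
    by (rule Susp_singular_origin[OF p X1D(4)[OF assms]])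
  have lin: "linear (frechet_derivative p (at y))"
    using has_derivative_linear[OF real_polynomial_function_has_derivative[OF p(1)]] .
  have "v \<in> span (orbit_tangents Y y)"
    using flex y v(1) by (simp add: flexible_on_def flexible_point_iff)
  then obtain w where w: "w \<in> orbit_tangents Y y" "frechet_derivative p (at y) w \<noteq> 0"
    using linear_eq_0_on_span[OF lin] v(2) by blast
  then show ?thesis
    using that flow_derivation_tangent(1)[OF _ y(2) _ p] by (auto simp: orbit_tangents_def)
qed

section \<open>Moving finite families of points in \<open>X1\<close>\<close>

definition family :: "nat set \<Rightarrow> (nat \<Rightarrow> 'a \<times> real \<times> real) \<Rightarrow> bool" where
  "family I x \<longleftrightarrow> finite I \<and> inj_on x I \<and> x ` I \<subseteq> X1"

definition movable :: "nat set \<Rightarrow> (nat \<Rightarrow> 'a \<times> real \<times> real) \<Rightarrow> (nat \<Rightarrow> 'a \<times> real \<times> real) \<Rightarrow> bool" where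
  "movable I x x' \<longleftrightarrow> (\<exists>g\<in>SAut X. \<forall>i\<in>I. g (x i) = x' i)"

abbreviation u_coord :: "'a \<times> real \<times> real \<Rightarrow> real" where "u_coord x \<equiv> fst (snd x)"
abbreviation v_coord :: "'a \<times> real \<times> real \<Rightarrow> real" where "v_coord x \<equiv> snd (snd x)"

lemma movable_refl: "movable I x x"
  unfolding movable_def by (rule bexI[of _ id]) (simp_all add: SAut_id)

lemma movable_trans:
  assumes "movable I x x'" "movable I x' x''"
  shows "movable I x x''"
proof -
  obtain g h where "g \<in> SAut X" "h \<in> SAut X" "\<forall>i\<in>I. g (x i) = x' i" "\<forall>i\<in>I. h (x' i) = x'' i"
    using assms by (auto simp: movable_def)
  then show ?thesis unfolding movable_def by (intro bexI[of _ "h \<circ> g"]) (auto intro: SAut_comp)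
qed

lemma movable_sym:
  assumes "movable I x x'"
  shows "movable I x' x"
proof -
  obtain g where g: "g \<in> SAut X" "\<forall>i\<in>I. g (x i) = x' i"
    using assms by (auto simp: movable_def)
  obtain h where "h \<in> SAut X" "\<And>x. h (g x) = x" "\<And>x. g (h x) = x" by (rule SAut_inverse[OF g(1)]) (rule that)
  then show ?thesis unfolding movable_def using g(2) by metis
qed

lemma movable_family:
  assumes "family I x" "movable I x x'"
  shows "family I x'"
proof -
  obtain g where g: "g \<in> SAut X" "\<forall>i\<in>I. g (x i) = x' i"
    using assms by (auto simp: movable_def)
  obtain h where h: "h \<in> SAut X" "\<And>x. h (g x) = x" "\<And>x. g (h x) = x" by (rule SAut_inverse[OF g(1)]) (rule that)
  have "inj_on x' I"
  proof (rule inj_onI)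
    fix i j assume ij: "i \<in> I" "j \<in> I" "x' i = x' j"
    then have "x i = x j" using g(2) h(2)[of "x i"] h(2)[of "x j"] by simp
    then show "i = j" using assms(1) ij unfolding family_def by (meson inj_onD)
  qed
  moreover have "x' i \<in> X1" if "i \<in> I" for i
  proof -
    have "x i \<in> X1" using assms(1) that unfolding family_def by blast
    then show ?thesis using SAut_X1[OF g(1)] g(2) that by metis
  qed
  then have "x' ` I \<subseteq> X1" by blast
  ultimately show ?thesis using assms(1) by (simp add: family_def)
qed

lemma familyD:
  assumes "family I x" "i \<in> I"
  shows "(fst (x i), u_coord (x i), v_coord (x i)) \<in> X1" "fst (x i) \<in> Y1"
    "(fst (x i), u_coord (x i), v_coord (x i)) \<in> X" "u_coord (x i) * v_coord (x i) = f (fst (x i))"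
proof -
  show 1: "(fst (x i), u_coord (x i), v_coord (x i)) \<in> X1" using assms by (auto simp: family_def)
  show "fst (x i) \<in> Y1" "(fst (x i), u_coord (x i), v_coord (x i)) \<in> X"
    "u_coord (x i) * v_coord (x i) = f (fst (x i))"
    using X1D(1,2,3)[OF 1] .
qed

lemma family_u_move:
  assumes x: "family I x" and z: "\<And>i. i \<in> I \<Longrightarrow> z i \<in> Y1"
    and inj: "\<And>i j. i \<in> I \<Longrightarrow> j \<in> I \<Longrightarrow> u_coord (x i) \<noteq> 0 \<Longrightarrow> u_coord (x i) = u_coord (x j) \<Longrightarrow> z i = z j \<Longrightarrow> i = j"
  shows "movable I x (\<lambda>i. if u_coord (x i) = 0 then x i else (z i, u_coord (x i), f (z i) / u_coord (x i)))"
proof (rule Susp_u_move[of f Y Y1 I "\<lambda>i. fst (x i)" "\<lambda>i. u_coord (x i)" "\<lambda>i. v_coord (x i)" z, OF f trans])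
  fix G assume G: "G \<in> SAut X"
    "\<And>i. i \<in> I \<Longrightarrow> u_coord (x i) \<noteq> 0 \<Longrightarrow>
      G (fst (x i), u_coord (x i), v_coord (x i)) = (z i, u_coord (x i), f (z i) / u_coord (x i))"
    "\<And>i. i \<in> I \<Longrightarrow> u_coord (x i) = 0 \<Longrightarrow>
      G (fst (x i), u_coord (x i), v_coord (x i)) = (fst (x i), u_coord (x i), v_coord (x i))"
  then show ?thesis
    unfolding movable_def prod.collapse by (intro bexI[of _ G]) simp_all
next
  show "inj_on (\<lambda>i. (fst (x i), u_coord (x i), v_coord (x i))) I" using x by (simp add: family_def)
qed (use familyD[OF x] z inj x in \<open>simp_all add: family_def\<close>)

lemma family_v_move:
  assumes x: "family I x" and z: "\<And>i. i \<in> I \<Longrightarrow> z i \<in> Y1"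
    and inj: "\<And>i j. i \<in> I \<Longrightarrow> j \<in> I \<Longrightarrow> v_coord (x i) \<noteq> 0 \<Longrightarrow> v_coord (x i) = v_coord (x j) \<Longrightarrow> z i = z j \<Longrightarrow> i = j"
  shows "movable I x (\<lambda>i. if v_coord (x i) = 0 then x i else (z i, f (z i) / v_coord (x i), v_coord (x i)))"
proof (rule Susp_v_move[of f Y Y1 I "\<lambda>i. fst (x i)" "\<lambda>i. u_coord (x i)" "\<lambda>i. v_coord (x i)" z, OF f trans])
  fix G assume G: "G \<in> SAut X"
    "\<And>i. i \<in> I \<Longrightarrow> v_coord (x i) \<noteq> 0 \<Longrightarrow>
      G (fst (x i), u_coord (x i), v_coord (x i)) = (z i, f (z i) / v_coord (x i), v_coord (x i))"
    "\<And>i. i \<in> I \<Longrightarrow> v_coord (x i) = 0 \<Longrightarrow>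
      G (fst (x i), u_coord (x i), v_coord (x i)) = (fst (x i), u_coord (x i), v_coord (x i))"
  then show ?thesis
    unfolding movable_def prod.collapse by (intro bexI[of _ G]) simp_all
next
  show "inj_on (\<lambda>i. (fst (x i), u_coord (x i), v_coord (x i))) I" using x by (simp add: family_def)
qed (use familyD[OF x] z inj x in \<open>simp_all add: family_def\<close>)

text \<open>The swapped lift of a flow transversal at the chosen crossing point shifts
  \<open>u\<close> there with nonzero speed. For small \<open>t\<close> no nonzero \<open>u\<close>
  becomes zero, so the number of points with \<open>u = 0\<close> drops; those that remain still
  have \<open>v = 0\<close>, so the hypothesis persists.\<close>

lemma family_leave_origin:
  assumes "family I x" "\<forall>i\<in>I. u_coord (x i) = 0 \<longrightarrow> v_coord (x i) = 0"
  shows "\<exists>x'. movable I x x' \<and> (\<forall>i\<in>I. u_coord (x' i) \<noteq> 0)"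
  using assms
proof (induction "card {i \<in> I. u_coord (x i) = 0}" arbitrary: x rule: less_induct)
  case less
  have I: "finite I" using less.prems(1) by (simp add: family_def)
  show ?case
  proof (cases "\<forall>i\<in>I. u_coord (x i) \<noteq> 0")
    case True
    then show ?thesis using movable_refl by blast
  next
    case False
    then obtain k where k: "k \<in> I" "u_coord (x k) = 0" "v_coord (x k) = 0" using less.prems(2) by blast
    have "(fst (x k), 0, 0) \<in> X1" using familyD(1)[OF less.prems(1) k(1)] k by simp
    then obtain \<phi> where \<phi>: "polynomial_flow Y \<phi>" "flow_derivation Y \<phi> f (fst (x k)) \<noteq> 0"
      by (rule origin_transversal_flow)
    obtain \<Phi> where \<Phi>: "polynomial_flow X \<Phi>"
      "\<And>t y u v. (y, u, v) \<in> X \<Longrightarrow> u \<noteq> 0 \<Longrightarrow>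
        \<Phi> t (y, u, v) = (\<phi> (t * (u * 1)) y, u, f (\<phi> (t * (u * 1)) y) / u)"
      "\<And>t y v. (y, 0, v) \<in> X \<Longrightarrow> \<Phi> t (y, 0, v) = (y, 0, v + t * 1 * flow_derivation Y \<phi> f y)"
      by (rule Susp_lift_flow[OF \<phi>(1) f, of "\<lambda>u. 1"]) (simp, rule that)
    define \<Psi> where "\<Psi> = (\<lambda>t x. swap_uv (\<Phi> t (swap_uv x)))"
    have \<Psi>: "polynomial_flow X \<Psi>" unfolding \<Psi>_def by (rule polynomial_flow_swap[OF \<Phi>(1)])
    have "eventually (\<lambda>t. u_coord (\<Psi> t (x i)) \<noteq> 0) (at 0)" if i: "i \<in> I" "u_coord (x i) \<noteq> 0" for i
    proof -
      have xi: "x i \<in> X" using familyD(3)[OF less.prems(1) i(1)] by simp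
      have "((\<lambda>t. \<Psi> t (x i)) \<longlongrightarrow> \<Psi> 0 (x i)) (at 0)"
        using polynomial_flow_continuous[OF \<Psi> xi, of UNIV] by (auto simp: continuous_on_def)
      moreover have "\<Psi> 0 (x i) = x i" using \<Psi> xi by (simp add: polynomial_flow_def)
      ultimately have "((\<lambda>t. u_coord (\<Psi> t (x i))) \<longlongrightarrow> u_coord (x i)) (at 0)"
        by (metis tendsto_fst tendsto_snd)
      then show ?thesis using i(2) tendsto_imp_eventually_ne by blast
    qed
    then have "eventually (\<lambda>t. \<forall>i\<in>{i \<in> I. u_coord (x i) \<noteq> 0}. u_coord (\<Psi> t (x i)) \<noteq> 0) (at 0)"
      using I by (intro eventually_ball_finite) auto
    moreover have "eventually (\<lambda>t::real. t \<noteq> 0) (at 0)" by (simp add: eventually_at_filter)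
    ultimately have "eventually (\<lambda>t::real. (\<forall>i\<in>{i \<in> I. u_coord (x i) \<noteq> 0}. u_coord (\<Psi> t (x i)) \<noteq> 0) \<and> t \<noteq> 0) (at 0)"
      by (rule eventually_conj)
    then obtain t :: real where t: "\<And>i. i \<in> I \<Longrightarrow> u_coord (x i) \<noteq> 0 \<Longrightarrow> u_coord (\<Psi> t (x i)) \<noteq> 0" "t \<noteq> 0"
      using eventually_happens'[OF trivial_limit_at] by blast
    have origin: "\<Psi> t (x i) = (fst (x i), t * flow_derivation Y \<phi> f (fst (x i)), 0)"
      if i: "i \<in> I" "u_coord (x i) = 0" for i
    proof -
      have v: "v_coord (x i) = 0" using less.prems(2) i by blast
      then have xi: "x i = (fst (x i), 0, 0)" using i(2) by (simp add: prod_eq_iff)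
      have "(fst (x i), 0, 0) \<in> X" using familyD(3)[OF less.prems(1) i(1)] i(2) v by simp
      then show ?thesis by (subst xi) (simp add: \<Psi>_def \<Phi>(3))
    qed
    have mov: "movable I x (\<lambda>i. \<Psi> t (x i))"
      unfolding movable_def using SAut_flow[OF \<Psi>] by blast
    have "{i \<in> I. u_coord (\<Psi> t (x i)) = 0} \<subset> {i \<in> I. u_coord (x i) = 0}"
    proof
      show "{i \<in> I. u_coord (\<Psi> t (x i)) = 0} \<subseteq> {i \<in> I. u_coord (x i) = 0}" using t(1) by auto
      have "u_coord (\<Psi> t (x k)) \<noteq> 0" using origin[OF k(1,2)] t(2) \<phi>(2) by simp
      then show "{i \<in> I. u_coord (\<Psi> t (x i)) = 0} \<noteq> {i \<in> I. u_coord (x i) = 0}" using k by blast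
    qed
    then have smaller: "card {i \<in> I. u_coord (\<Psi> t (x i)) = 0} < card {i \<in> I. u_coord (x i) = 0}"
      using I by (intro psubset_card_mono) auto
    have "\<forall>i\<in>I. u_coord (\<Psi> t (x i)) = 0 \<longrightarrow> v_coord (\<Psi> t (x i)) = 0"
      using t(1) origin by (metis snd_conv)
    from less.hyps[OF smaller movable_family[OF less.prems(1) mov] this]
    show ?thesis using movable_trans[OF mov] by blast
  qed
qed

text \<open>Moving along the levels of \<open>v\<close> to points with \<open>f \<noteq> 0\<close>
  makes \<open>u = f / v\<close> nonzero wherever \<open>v \<noteq> 0\<close>. After that, a zero
  \<open>u\<close> can occur only at crossing points.\<close>

lemma family_u_nonzero:
  assumes x: "family I x"
  obtains x' where "movable I x x'" "family I x'" "\<forall>i\<in>I. u_coord (x' i) \<noteq> 0"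
proof -
  have I: "finite I" using x by (simp add: family_def)
  have "infinite {y \<in> Y1. f y \<noteq> 0}"
    using infinite_f_nonzero finite_subset[of "f ` Y1 - {0}" "f ` {y \<in> Y1. f y \<noteq> 0}"] by auto
  then obtain z where z: "\<forall>i\<in>I. z i \<in> {y \<in> Y1. f y \<noteq> 0}" "inj_on z I"
    using infinite_choice_inj[OF I, of "\<lambda>_. {y \<in> Y1. f y \<noteq> 0}" "\<lambda>_. id"] by auto
  let ?x = "\<lambda>i. if v_coord (x i) = 0 then x i else (z i, f (z i) / v_coord (x i), v_coord (x i))"
  have mov: "movable I x ?x"
    by (rule family_v_move[OF x]) (use z in \<open>auto dest: inj_onD\<close>)
  have "\<forall>i\<in>I. u_coord (?x i) = 0 \<longrightarrow> v_coord (?x i) = 0" using z(1) by auto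
  then obtain x' where "movable I ?x x'" "\<forall>i\<in>I. u_coord (x' i) \<noteq> 0"
    using family_leave_origin[OF movable_family[OF x mov]] by blast
  then show ?thesis using that movable_trans[OF mov] movable_family[OF x] by blast
qed

text \<open>
  With \<open>f = s\<close> at the \<open>y\<close>-coordinate, \<open>v = s / u\<close>; moving \<open>y\<close> along the level \<open>v\<close>
  to a point with \<open>f = \<rho> s\<close> multiplies \<open>u\<close> by \<open>\<rho>\<close>.
\<close>

definition admissible_ratio :: "real \<Rightarrow> bool" where
  "admissible_ratio \<rho> \<longleftrightarrow> \<rho> \<noteq> 0 \<and> infinite {s \<in> f ` Y1. s \<noteq> 0 \<and> \<rho> * s \<in> f ` Y1}"

text \<open>Infinitely many choices of \<open>s\<close> allow two kinds of distinctness at once: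
  distinct values \<open>s i\<close> keep the targets on a common level of \<open>u\<close> apart,
  and distinct quotients \<open>s i / u\<close> put all points on different levels of
  \<open>v\<close>, so the second move has no collisions to avoid.\<close>

lemma family_rescale:
  assumes x: "family I x" and u: "\<forall>i\<in>I. u_coord (x i) \<noteq> 0" and \<rho>: "\<forall>i\<in>I. admissible_ratio (\<rho> i)"
  shows "\<exists>x'. movable I x x' \<and> (\<forall>i\<in>I. u_coord (x' i) = \<rho> i * u_coord (x i))"
proof -
  have I: "finite I" using x by (simp add: family_def)
  let ?A = "\<lambda>i. {s \<in> f ` Y1. s \<noteq> 0 \<and> \<rho> i * s \<in> f ` Y1}"
  have "inj_on (\<lambda>s. s / u_coord (x i)) (?A i)" if "i \<in> I" for i
    using u that by (intro inj_onI) simp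
  then obtain s where s: "\<forall>i\<in>I. s i \<in> ?A i" "inj_on s I" "inj_on (\<lambda>i. s i / u_coord (x i)) I"
    using infinite_choice_inj[OF I, of ?A "\<lambda>i s. s / u_coord (x i)"] \<rho> by (auto simp: admissible_ratio_def)
  have "\<forall>i\<in>I. \<exists>y\<in>Y1. \<exists>z\<in>Y1. f y = s i \<and> f z = \<rho> i * s i"
    using s(1) by (force simp: image_iff)
  then obtain y z where yz: "\<And>i. i \<in> I \<Longrightarrow> y i \<in> Y1" "\<And>i. i \<in> I \<Longrightarrow> z i \<in> Y1"
    "\<And>i. i \<in> I \<Longrightarrow> f (y i) = s i" "\<And>i. i \<in> I \<Longrightarrow> f (z i) = \<rho> i * s i" by metis
  define x1 where "x1 = (\<lambda>i. if u_coord (x i) = 0 then x i else (y i, u_coord (x i), f (y i) / u_coord (x i)))"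
  have mov1: "movable I x x1"
    unfolding x1_def
    by (rule family_u_move[OF x]) (use yz s(2) in \<open>auto dest: inj_onD\<close>, metis inj_onD s(2) yz(3))
  have x1: "x1 i = (y i, u_coord (x i), s i / u_coord (x i))" if "i \<in> I" for i
    using that u yz(3) by (simp add: x1_def)
  define x2 where "x2 = (\<lambda>i. if v_coord (x1 i) = 0 then x1 i else (z i, f (z i) / v_coord (x1 i), v_coord (x1 i)))"
  have mov2: "movable I x1 x2"
    unfolding x2_def
  proof (rule family_v_move[OF movable_family[OF x mov1]])
    show "i = j" if "i \<in> I" "j \<in> I" "v_coord (x1 i) = v_coord (x1 j)" for i j
      using that x1 s(3) by (auto dest: inj_onD)
  qed (rule yz(2))
  have "u_coord (x2 i) = \<rho> i * u_coord (x i)" if "i \<in> I" for i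
    using that x1 yz(4) s(1) u by (auto simp: x2_def)
  then show ?thesis using movable_trans[OF mov1 mov2] by blast
qed

lemma admissible_ratio_near_one:
  obtains \<eta> where "\<eta> > 0" "\<And>\<rho>. \<bar>\<rho> - 1\<bar> \<le> \<eta> \<Longrightarrow> admissible_ratio \<rho>"
proof -
  obtain a b where ab: "a < b" "{a..b} \<subseteq> f ` Y1" by (rule f_image_interval)
  obtain \<alpha> \<beta> where \<alpha>\<beta>: "\<alpha> < \<beta>" "{\<alpha>..\<beta>} \<subseteq> {a..b}" "0 \<notin> {\<alpha><..<\<beta>}"
  proof (cases "b > 0")
    case True
    then show ?thesis using ab(1) by (intro that[of "max a (b / 2)" b]) auto
  next
    case False
    then show ?thesis using ab(1) by (intro that[of a b]) auto
  qed
  \<comment> \<open>Here \<open>d\<close> is a quarter of the length: \<open>s\<close> stays within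
    \<open>d\<close> of the midpoint \<open>c\<close>, and multiplication by \<open>\<rho>\<close>
    may shift it by another \<open>d\<close>, which together is the half-length.\<close>
  define c d where "c = (\<alpha> + \<beta>) / 2" and "d = (\<beta> - \<alpha>) / 4"
  have d: "d > 0" using \<alpha>\<beta>(1) by (simp add: d_def)
  \<comment> \<open>Since \<open>\<bar>s\<bar>\<close> is at most \<open>\<bar>c\<bar> + d\<close>,
    the second bound makes the shift at most \<open>d\<close>; the bound \<open>1 / 2\<close> keeps
    \<open>\<rho>\<close> away from 0.\<close>
  define \<eta> where "\<eta> = min (1 / 2) (d / (\<bar>c\<bar> + d))"
  have "admissible_ratio \<rho>" if \<rho>: "\<bar>\<rho> - 1\<bar> \<le> \<eta>" for \<rho>
    unfolding admissible_ratio_def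
  proof
    have "\<bar>\<rho> - 1\<bar> \<le> 1 / 2" using \<rho> by (simp add: \<eta>_def)
    then show "\<rho> \<noteq> 0" by auto
    have "{c - d<..<c + d} \<subseteq> {s \<in> f ` Y1. s \<noteq> 0 \<and> \<rho> * s \<in> f ` Y1}"
    proof
      fix s assume "s \<in> {c - d<..<c + d}"
      then have s: "\<bar>s - c\<bar> < d" by auto
      have "\<bar>\<rho> * s - s\<bar> = \<bar>\<rho> - 1\<bar> * \<bar>s\<bar>" by (simp add: abs_mult[symmetric] algebra_simps)
      also have "\<dots> \<le> d / (\<bar>c\<bar> + d) * (\<bar>c\<bar> + d)"
        using \<rho> s d by (intro mult_mono) (auto simp: \<eta>_def)
      also have "\<dots> = d" using d by simp
      finally have "\<bar>\<rho> * s - s\<bar> \<le> d" .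
      moreover have "c - 2 * d = \<alpha>" "c + 2 * d = \<beta>" by (simp_all add: c_def d_def field_simps)
      ultimately have m: "\<rho> * s \<in> {\<alpha>..\<beta>}" "s \<in> {\<alpha>..\<beta>}" "s \<in> {\<alpha><..<\<beta>}"
        using s unfolding atLeastAtMost_iff greaterThanLessThan_iff by linarith+
      have sub: "{\<alpha>..\<beta>} \<subseteq> f ` Y1" using \<alpha>\<beta>(2) ab(2) by (rule order_trans)
      have "s \<noteq> 0" using m(3) \<alpha>\<beta>(3) by (cases "s = 0") simp_all
      then show "s \<in> {s \<in> f ` Y1. s \<noteq> 0 \<and> \<rho> * s \<in> f ` Y1}"
        by (intro CollectI conjI subsetD[OF sub m(1)] subsetD[OF sub m(2)])
    qed
    then show "infinite {s \<in> f ` Y1. s \<noteq> 0 \<and> \<rho> * s \<in> f ` Y1}"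
      by (rule infinite_super) (use d in \<open>simp add: infinite_Ioo\<close>)
  qed
  moreover have "\<eta> > 0" using d by (simp add: \<eta>_def)
  ultimately show ?thesis using that by blast
qed

text \<open>Each factor \<open>r i\<close> is spread over \<open>n\<close> steps with ratio
  \<open>exp (ln (r i) / n)\<close>, and \<open>n\<close> is taken so large that all these ratios
  are close enough to 1 to be admissible.\<close>

lemma family_rescale_pos:
  assumes x: "family I x" and u: "\<forall>i\<in>I. u_coord (x i) \<noteq> 0" and r: "\<forall>i\<in>I. r i > 0"
  shows "\<exists>x'. movable I x x' \<and> (\<forall>i\<in>I. u_coord (x' i) = r i * u_coord (x i))"
proof -
  have I: "finite I" using x by (simp add: family_def)
  obtain \<eta> where \<eta>: "\<eta> > 0" "\<And>\<rho>. \<bar>\<rho> - 1\<bar> \<le> \<eta> \<Longrightarrow> admissible_ratio \<rho>"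
    by (rule admissible_ratio_near_one) (rule that)
  have "eventually (\<lambda>n. \<bar>exp (ln (r i) / real n) - 1\<bar> \<le> \<eta>) sequentially" for i
  proof -
    have "(\<lambda>n. exp (ln (r i) / real n)) \<longlonglongrightarrow> exp 0"
      by (intro tendsto_exp lim_const_over_n)
    then have "eventually (\<lambda>n. dist (exp (ln (r i) / real n)) 1 < \<eta>) sequentially"
      using \<eta>(1) by (simp add: tendsto_iff)
    then show ?thesis by eventually_elim (simp add: dist_real_def)
  qed
  then have "eventually (\<lambda>n. \<forall>i\<in>I. \<bar>exp (ln (r i) / real n) - 1\<bar> \<le> \<eta>) sequentially"
    using I by (intro eventually_ball_finite) auto
  then have "eventually (\<lambda>n. (\<forall>i\<in>I. \<bar>exp (ln (r i) / real n) - 1\<bar> \<le> \<eta>) \<and> n > 0) sequentially"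
    by (rule eventually_conj) (rule eventually_gt_at_top)
  then obtain n :: nat where n: "\<forall>i\<in>I. \<bar>exp (ln (r i) / real n) - 1\<bar> \<le> \<eta>" "n > 0"
    using eventually_happens'[OF trivial_limit_sequentially] by blast
  define \<rho> where "\<rho> = (\<lambda>i. exp (ln (r i) / real n))"
  have "\<exists>x'. movable I x x' \<and> (\<forall>i\<in>I. u_coord (x' i) = \<rho> i ^ k * u_coord (x i))" for k
  proof (induction k)
    case 0
    show ?case by (rule exI[of _ x]) (simp add: movable_refl)
  next
    case (Suc k)
    then obtain x' where x': "movable I x x'" "\<forall>i\<in>I. u_coord (x' i) = \<rho> i ^ k * u_coord (x i)" by blast
    have "\<forall>i\<in>I. u_coord (x' i) \<noteq> 0" using x'(2) u by (simp add: \<rho>_def)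
    moreover have "\<forall>i\<in>I. admissible_ratio (\<rho> i)" using n(1) \<eta>(2) by (simp add: \<rho>_def)
    ultimately obtain x'' where "movable I x' x''" "\<forall>i\<in>I. u_coord (x'' i) = \<rho> i * u_coord (x' i)"
      using family_rescale[OF movable_family[OF x x'(1)]] by blast
    then show ?case using movable_trans[OF x'(1)] x'(2) by (intro exI[of _ x'']) simp
  qed
  from this[of n] show ?thesis
    using r n(2) by (simp add: \<rho>_def exp_of_nat_mult[symmetric])
qed

text \<open>When \<open>f\<close> takes both signs, its image contains an interval around 0, so
  infinitely many values have their negative in the image as well. The ratio \<open>- 1\<close> is
  then admissible for the points with negative \<open>u\<close>, while the others use the ratio
  1.\<close>

lemma family_u_pos:
  assumes x: "family I x" "\<forall>i\<in>I. u_coord (x i) \<noteq> 0"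
    and yz: "y \<in> Y1" "z \<in> Y1" "f y < 0" "0 < f z"
  obtains x' where "movable I x x'" "\<forall>i\<in>I. u_coord (x' i) > 0"
proof -
  have J: "{f y..f z} \<subseteq> f ` Y1" by (rule f_image_interval_zero[OF yz])
  have "{s \<in> f ` Y1. s \<noteq> 0 \<and> 1 * s \<in> f ` Y1} = f ` Y1 - {0}" by auto
  then have "admissible_ratio 1"
    using infinite_f_nonzero by (simp add: admissible_ratio_def)
  moreover have "admissible_ratio (- 1)"
  proof -
    have sub: "{0<..<min (f z) (- f y)} \<subseteq> {s \<in> f ` Y1. s \<noteq> 0 \<and> - 1 * s \<in> f ` Y1}"
    proof
      fix s assume s: "s \<in> {0<..<min (f z) (- f y)}"
      then have "s \<in> {f y..f z}" "- 1 * s \<in> {f y..f z}" using yz by auto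
      then show "s \<in> {s \<in> f ` Y1. s \<noteq> 0 \<and> - 1 * s \<in> f ` Y1}" using J s by auto
    qed
    have "infinite {0<..<min (f z) (- f y)}" using yz by (simp add: infinite_Ioo)
    from infinite_super[OF sub this] show ?thesis by (simp add: admissible_ratio_def)
  qed
  ultimately have "\<forall>i\<in>I. admissible_ratio (sgn (u_coord (x i)))"
    using x(2) by (auto simp: sgn_if)
  from family_rescale[OF x this] obtain x' where
    "movable I x x'" "\<forall>i\<in>I. u_coord (x' i) = sgn (u_coord (x i)) * u_coord (x i)" by blast
  moreover have "0 < sgn u * u" if "u \<noteq> 0" for u :: real
    using that by (simp add: sgn_if)
  ultimately have "movable I x x'" "\<forall>i\<in>I. u_coord (x' i) > 0" using x(2) by simp_all
  then show ?thesis by (rule that)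
qed

text \<open>
  If \<open>e f \<ge> 0\<close> on \<open>Y1\<close>, a point of \<open>X1\<close> with \<open>u + e v = 0\<close> would have \<open>u = v = 0\<close>, and \<open>f\<close>
  would have an extremum at \<open>y\<close>, making that point singular.
\<close>

lemma same_sign:
  assumes e: "e = 1 \<or> e = - 1" "\<And>y. y \<in> Y1 \<Longrightarrow> 0 \<le> e * f y"
    and x: "x \<in> X1" "x' \<in> X1" "u_coord x \<noteq> 0" "u_coord x' > 0"
  shows "u_coord x > 0"
proof -
  let ?h = "\<lambda>x. u_coord x + e * v_coord x"
  have uv: "u_coord x * v_coord x = f (fst x)" "fst x \<in> Y1" if "x \<in> X1" for x
    using X1D[of "fst x" "u_coord x" "v_coord x"] that by simp_all
  have h: "?h x \<noteq> 0" if x: "x \<in> X1" for x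
  proof
    assume "?h x = 0"
    then have ux: "u_coord x = - e * v_coord x" by simp
    have "e * f (fst x) = - (v_coord x)\<^sup>2"
      unfolding uv(1)[OF x, symmetric] ux using e(1) by (auto simp: power2_eq_square)
    then have v: "v_coord x = 0" using e(2)[OF uv(2)[OF x]] by simp
    define y where "y = fst x"
    have xy: "x = (y, 0, 0)" using ux v by (simp add: y_def prod_eq_iff)
    then have y: "y \<in> Y1" "y \<in> Y" "f y = 0" using uv[OF x] v Y1_subset by auto
    obtain \<phi> where \<phi>: "polynomial_flow Y \<phi>" "flow_derivation Y \<phi> f y \<noteq> 0"
      by (rule origin_transversal_flow[of y]) (use x xy in auto)
    have \<phi>0: "\<phi> 0 y = y" using \<phi>(1) y(2) by (simp add: polynomial_flow_def)
    have "((\<lambda>t. e * f (\<phi> t y)) has_field_derivative e * flow_derivation Y \<phi> f y) (at 0)"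
      using DERIV_cmult[OF flow_has_derivative[OF \<phi>(1) f y(2), of 0]] \<phi>0 by simp
    then have "e * flow_derivation Y \<phi> f y = 0"
      by (rule DERIV_local_min[of _ _ _ 1]) (use e(2)[OF flow_Y1[OF \<phi>(1) y(1)]] y(3) \<phi>0 in auto)
    then show False using e(1) \<phi>(2) by auto
  qed
  have conn: "connected (?h ` X1)"
    by (intro connected_continuous_image in_components_connected[OF X1] continuous_intros)
  \<comment> \<open>The numbers \<open>u\<close> and \<open>e * v\<close> never have opposite signs.
    The comparison goes through \<open>?h\<close> because \<open>u\<close> itself may vanish on
    \<open>X1\<close>, at points with \<open>v \<noteq> 0\<close>.\<close>
  have sign: "?h x > 0 \<longleftrightarrow> u_coord x > 0" if "x \<in> X1" "u_coord x \<noteq> 0" for x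
  proof -
    have "0 \<le> u_coord x * (e * v_coord x)"
      using e(2)[OF uv(2)[OF that(1)]] uv(1)[OF that(1)] by (simp add: mult.left_commute)
    moreover have "a + b > 0 \<longleftrightarrow> a > 0" if "0 \<le> a * b" "a \<noteq> 0" for a b :: real
      using that by (auto simp: zero_le_mult_iff)
    ultimately show ?thesis using that(2) by blast
  qed
  have "?h x > 0"
  proof (rule ccontr)
    assume "\<not> ?h x > 0"
    then have "0 \<in> {?h x..?h x'}" using sign[OF x(2)] x(4) by auto
    then have "0 \<in> ?h ` X1" using connected_contains_Icc[OF conn] x(1,2) by blast
    then show False using h by auto
  qed
  then show ?thesis using sign[OF x(1,3)] by simp
qed

lemma family_movable:
  assumes x: "family I x" and x': "family I x'"
  shows "movable I x x'"
proof -
  obtain a where a: "movable I x a" "family I a" "\<forall>i\<in>I. u_coord (a i) \<noteq> 0"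
    by (rule family_u_nonzero[OF x])
  obtain a' where a': "movable I x' a'" "family I a'" "\<forall>i\<in>I. u_coord (a' i) \<noteq> 0"
    by (rule family_u_nonzero[OF x'])
  obtain b b' where b: "movable I x b" "movable I x' b'" "\<forall>i\<in>I. u_coord (b' i) / u_coord (b i) > 0"
  proof (cases "\<exists>y\<in>Y1. \<exists>z\<in>Y1. f y < 0 \<and> 0 < f z")
    case True
    then obtain y z where yz: "y \<in> Y1" "z \<in> Y1" "f y < 0" "0 < f z" by blast
    obtain b where b: "movable I a b" "\<forall>i\<in>I. u_coord (b i) > 0" by (rule family_u_pos[OF a(2,3) yz])
    obtain b' where b': "movable I a' b'" "\<forall>i\<in>I. u_coord (b' i) > 0"
      by (rule family_u_pos[OF a'(2,3) yz])
    show ?thesis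
      by (rule that[OF movable_trans[OF a(1) b(1)] movable_trans[OF a'(1) b'(1)]])
        (use b(2) b'(2) in simp)
  next
    case False
    then have "(\<forall>y\<in>Y1. 0 \<le> f y) \<or> (\<forall>y\<in>Y1. f y \<le> 0)" by (meson linorder_not_le)
    then obtain e :: real where e: "e = 1 \<or> e = - 1" "\<And>y. y \<in> Y1 \<Longrightarrow> 0 \<le> e * f y"
      by (metis mult_1 mult_minus1 neg_0_le_iff_le)
    have sign: "u_coord (a' i) / u_coord (a i) > 0" if i: "i \<in> I" for i
    proof -
      have "a i \<in> X1" "a' i \<in> X1" using a(2) a'(2) i by (auto simp: family_def)
      moreover have "u_coord (a i) \<noteq> 0" "u_coord (a' i) \<noteq> 0" using a(3) a'(3) i by auto
      ultimately have "u_coord (a i) > 0 \<longleftrightarrow> u_coord (a' i) > 0"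
        using same_sign[OF e] by blast
      then show ?thesis using \<open>u_coord (a i) \<noteq> 0\<close> \<open>u_coord (a' i) \<noteq> 0\<close>
        by (auto simp: zero_less_divide_iff)
    qed
    show ?thesis by (rule that[OF a(1) a'(1)]) (simp add: sign)
  qed
  have fam: "family I b" "family I b'" using movable_family b x x' by blast+
  have u: "\<forall>i\<in>I. u_coord (b i) \<noteq> 0" "\<forall>i\<in>I. u_coord (b' i) \<noteq> 0" using b(3) by auto
  obtain c where c: "movable I b c" "\<forall>i\<in>I. u_coord (c i) = u_coord (b' i) / u_coord (b i) * u_coord (b i)"
    using family_rescale_pos[OF fam(1) u(1) b(3)] by blast
  have uc: "u_coord (c i) = u_coord (b' i)" if "i \<in> I" for i using c(2) u that by simp
  \<comment> \<open>With \<open>u\<close> nonzero, \<open>v\<close> is determined by the other two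
    coordinates, so matching \<open>u\<close> and then \<open>y\<close> matches the whole point; for
    the same reason targets on a common level are distinct.\<close>
  have b'_eq: "b' i = (fst (b' i), u_coord (b' i), f (fst (b' i)) / u_coord (b' i))" if "i \<in> I" for i
    using familyD(4)[OF fam(2) that] u(2) that by (simp add: prod_eq_iff field_simps)
  have "movable I c (\<lambda>i. if u_coord (c i) = 0 then c i
      else (fst (b' i), u_coord (c i), f (fst (b' i)) / u_coord (c i)))"
  proof (rule family_u_move[OF movable_family[OF fam(1) c(1)]])
    show "fst (b' i) \<in> Y1" if "i \<in> I" for i using familyD(2)[OF fam(2) that] .
    show "i = j" if ij: "i \<in> I" "j \<in> I" "u_coord (c i) = u_coord (c j)" "fst (b' i) = fst (b' j)" for i j
    proof -
      have "b' i = b' j" using b'_eq[OF ij(1)] b'_eq[OF ij(2)] uc ij by metis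
      then show ?thesis using fam(2) ij by (auto simp: family_def dest: inj_onD)
    qed
  qed
  then have "movable I c b'"
    unfolding movable_def using uc u(2) b'_eq by fastforce
  then show ?thesis
    by (intro movable_trans[OF b(1)] movable_trans[OF c(1)] movable_trans[OF _ movable_sym[OF b(2)]])
qed

lemma SAut_X1_transitive: "infinitely_transitive_on (SAut X) X1"
  unfolding infinitely_transitive_on_def
proof (intro conjI ballI allI impI)
  show "g ` X1 = X1" if "g \<in> SAut X" for g by (rule SAut_X1_image[OF that])
next
  fix m :: nat and xs ys
  assume *: "length xs = m \<and> length ys = m \<and> distinct xs \<and> distinct ys \<and> set xs \<subseteq> X1 \<and> set ys \<subseteq> X1"
  have "family {..<m} (nth xs)" "family {..<m} (nth ys)"
    using * by (auto simp: family_def inj_on_nth)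
  then obtain g where "g \<in> SAut X" "\<forall>i\<in>{..<m}. g (xs ! i) = ys ! i"
    using family_movable unfolding movable_def by blast
  then show "\<exists>g\<in>SAut X. map g xs = ys"
    using * by (intro bexI[of _ g] nth_equalityI) auto
qed

text \<open>A one-point family can be moved over a point \<open>y\<close> where some flow changes
  \<open>f\<close> to first order, and there \<open>Susp_flexible_point\<close> applies. Symmetry of
  \<open>movable\<close> provides the automorphism back to \<open>x\<close>.\<close>

lemma X1_flexible: "flexible_on X X1"
  unfolding flexible_on_def
proof
  fix x assume x: "x \<in> X1"
  have fam: "family {0} (\<lambda>_. x)" using x by (simp add: family_def)
  obtain a where a: "movable {0} (\<lambda>_. x) a" "family {0} a" "\<forall>i\<in>{0}. u_coord (a i) \<noteq> 0"
    by (rule family_u_nonzero[OF fam])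
  let ?u = "u_coord (a 0)"
  have u: "?u \<noteq> 0" using a(3) by simp
  obtain \<phi> y where \<phi>: "polynomial_flow Y \<phi>" "y \<in> Y1" "flow_derivation Y \<phi> f y \<noteq> 0"
    by (rule exists_transversal_flow)
  have mov: "movable {0} a (\<lambda>i. if u_coord (a i) = 0 then a i else (y, u_coord (a i), f y / u_coord (a i)))"
    by (rule family_u_move[OF a(2)]) (use \<phi>(2) in auto)
  have "movable {0} (\<lambda>i. if u_coord (a i) = 0 then a i else (y, u_coord (a i), f y / u_coord (a i))) (\<lambda>_. x)"
    by (rule movable_sym[OF movable_trans[OF a(1) mov]])
  then obtain g where g: "g \<in> SAut X" "g (y, ?u, f y / ?u) = x" using u by (auto simp: movable_def)
  have "flexible_point X (y, ?u, f y / ?u)"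
  proof (rule Susp_flexible_point[OF f p _ u _ \<phi>(1,3)])
    show "(y, ?u, f y / ?u) \<in> X" using u \<phi>(2) Y1_subset by (auto simp: Susp_def)
    show "flexible_point Y y" using flex \<phi>(2) by (simp add: flexible_on_def)
  qed
  then show "flexible_point X x" using flexible_point_SAut[OF g(1)] g(2) by metis
qed

end

theorem theorem2:
  fixes Y Y1 :: "'a::euclidean_space set"
    and f :: "'a \<Rightarrow> real"
    and X X1 :: "('a \<times> real \<times> real) set"
  assumes "affine_variety Y"
    and "f \<in> coordinate_ring Y"
    and "Y1 \<in> components (smooth_locus Y)"
    and "flexible_on Y Y1"
    and "\<forall>y\<in>Y1. 2 \<le> dim (tangent_space Y y)"
    and "infinitely_transitive_on (SAut Y) Y1"
    and "\<not> f constant_on Y1"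
    and "X = Susp Y f"
    and "X1 \<in> components (Susp Y1 f \<inter> smooth_locus X)"
  shows "flexible_on X X1 \<and> infinitely_transitive_on (SAut X) X1"
proof -
  obtain p where "real_polynomial_function p" "f = (\<lambda>x. if x \<in> Y then p x else 0)"
    using assms(2) by (rule coordinate_ringE)
  then interpret flexible_suspension Y Y1 f p X1
    using assms by unfold_locales auto
  show ?thesis
    unfolding assms(8) using X1_flexible SAut_X1_transitive by blast
qed

end
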